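(* For all $R>0$ and $\varepsilon>0$ there is a $C>0$ such that for any imaginary quadratic field $F$, with $M_F=\mathrm{SL}_2(\mathcal O_F)\backslash\mathbb H^3$, we have $$\operatorname{vol}\,(M_F)_{\le R}\le C\,(\operatorname{vol}M_F)^{1-(1/3-\varepsilon)}.$$
   Context: $\mathcal O_F$ is the ring of integers of $F$. For $M=\Gamma\backslash\mathbb H^3$, the injectivity radius at $x\in M$ is $\operatorname{inj}_x(M)=\frac12\inf_\gamma d(\tilde x,\gamma\tilde x)$, with $\tilde x\in\mathbb H^3$ a lift of $x$ and $\gamma$ running over elements of $\Gamma$ acting non-trivially on $\mathbb H^3$; the $R$-thin part is $(M)_{\le R}=\{x\in M:\operatorname{inj}_x(M)\le R\}$. *)

theory Defs
  imports "HOL-Analysis.Analysis" "HOL-Computational_Algebra.Computational_Algebra"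
begin

section \<open>Imaginary quadratic fields and their rings of integers\<close>

text \<open>
  Number fields are taken as subfields of \<^typ>\<open>complex\<close>. For imaginary quadratic fields nothing
  is lost: the two complex embeddings of such a field are exchanged by complex conjugation and
  have the same image.
\<close>

definition rat_scale :: "rat \<Rightarrow> complex \<Rightarrow> complex" where
  "rat_scale q z = of_rat q * z"

lemma vector_space_rat_scale: "vector_space rat_scale"
  by unfold_locales (simp_all add: rat_scale_def algebra_simps of_rat_add of_rat_mult)

definition complex_subfield :: "complex set \<Rightarrow> bool" where
  "complex_subfield F \<longleftrightarrow>
     0 \<in> F \<and> 1 \<in> F \<and>
     (\<forall>x\<in>F. \<forall>y\<in>F. x + y \<in> F \<and> x * y \<in> F) \<and>
     (\<forall>x\<in>F. - x \<in> F \<and> inverse x \<in> F)"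

definition imaginary_quadratic_field :: "complex set \<Rightarrow> bool" where
  "imaginary_quadratic_field F \<longleftrightarrow>
     complex_subfield F \<and> vector_space.dim rat_scale F = 2 \<and> \<not> F \<subseteq> \<real>"

definition ring_of_integers :: "complex set \<Rightarrow> complex set" where
  "ring_of_integers F = {x \<in> F. algebraic_int x}"

definition SL2 :: "complex set \<Rightarrow> (complex ^ 2 ^ 2) set" where
  "SL2 S = {A. (\<forall>i j. A $ i $ j \<in> S) \<and> det A = 1}"


section \<open>Hyperbolic 3-space\<close>

text \<open>The upper half-space model, with curvature \<open>-1\<close>.\<close>

definition H3 :: "(complex \<times> real) set" where
  "H3 = {(z, t). t > 0}"

definition hyp_dist :: "complex \<times> real \<Rightarrow> complex \<times> real \<Rightarrow> real" where
  "hyp_dist = (\<lambda>(z, t) (w, s). arcosh (1 + ((cmod (z - w))\<^sup>2 + (t - s)\<^sup>2) / (2 * t * s)))"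

definition hyp_volume :: "(complex \<times> real) measure" where
  "hyp_volume = density (restrict_space lborel H3) (\<lambda>(z, t). ennreal (1 / t ^ 3))"

text \<open>
  The Poincare extension of the Moebius action. With \<open>(z, t)\<close> read as the quaternion
  \<open>P = z + t j\<close>, this is \<open>(a P + b) (c P + d)\<inverse>\<close> for matrices of determinant \<open>1\<close>.
\<close>

definition hyp_act :: "complex ^ 2 ^ 2 \<Rightarrow> complex \<times> real \<Rightarrow> complex \<times> real" where
  "hyp_act A = (\<lambda>(z, t).
     let a = A $ 1 $ 1; b = A $ 1 $ 2; c = A $ 2 $ 1; d = A $ 2 $ 2;
         N = (cmod (c * z + d))\<^sup>2 + (cmod c)\<^sup>2 * t\<^sup>2
     in (((a * z + b) * cnj (c * z + d) + a * cnj c * of_real (t\<^sup>2)) / of_real N, t / N))"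

definition acts_nontrivially :: "complex ^ 2 ^ 2 \<Rightarrow> bool" where
  "acts_nontrivially A \<longleftrightarrow> (\<exists>p\<in>H3. hyp_act A p \<noteq> p)"


section \<open>Quotients of hyperbolic 3-space\<close>

definition hyp_orbit :: "(complex ^ 2 ^ 2) set \<Rightarrow> complex \<times> real \<Rightarrow> (complex \<times> real) set" where
  "hyp_orbit \<Gamma> p = (\<lambda>A. hyp_act A p) ` \<Gamma>"

definition hyp_quotient :: "(complex ^ 2 ^ 2) set \<Rightarrow> (complex \<times> real) set set" where
  "hyp_quotient \<Gamma> = hyp_orbit \<Gamma> ` H3"

definition fundamental_domain :: "(complex ^ 2 ^ 2) set \<Rightarrow> (complex \<times> real) set \<Rightarrow> bool" where
  "fundamental_domain \<Gamma> D \<longleftrightarrow>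
     D \<in> sets hyp_volume \<and>
     (\<Union>A\<in>\<Gamma>. hyp_act A ` D) = H3 \<and>
     (\<forall>A\<in>\<Gamma>. acts_nontrivially A \<longrightarrow> emeasure hyp_volume (D \<inter> hyp_act A ` D) = 0)"

text \<open>
  The volume on the quotient induced by the hyperbolic volume. A point of the quotient is an
  orbit, so \<open>\<Union>X\<close> is the preimage of \<open>X\<close> in \<open>H3\<close>. For a discrete group \<open>\<Gamma>\<close> and \<open>X\<close> with
  Borel preimage, the value does not depend on the choice of the fundamental domain.
\<close>

definition quotient_volume ::
    "(complex ^ 2 ^ 2) set \<Rightarrow> (complex \<times> real) set set \<Rightarrow> ennreal" where
  "quotient_volume \<Gamma> X = emeasure hyp_volume ((SOME D. fundamental_domain \<Gamma> D) \<inter> \<Union>X)"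

text \<open>
  The infimum is taken in \<^typ>\<open>ereal\<close>, so that it is \<open>\<infinity>\<close> if no element acts non-trivially.
  For a group \<open>\<Gamma>\<close> the value does not depend on the choice of the lift.
\<close>

definition injectivity_radius ::
    "(complex ^ 2 ^ 2) set \<Rightarrow> (complex \<times> real) set \<Rightarrow> ereal" where
  "injectivity_radius \<Gamma> x =
     (let p = (SOME p. p \<in> x)
      in (INF A\<in>{A\<in>\<Gamma>. acts_nontrivially A}. ereal (hyp_dist p (hyp_act A p))) / 2)"

definition thin_part :: "(complex ^ 2 ^ 2) set \<Rightarrow> real \<Rightarrow> (complex \<times> real) set set" where
  "thin_part \<Gamma> R = {x \<in> hyp_quotient \<Gamma>. injectivity_radius \<Gamma> x \<le> ereal R}"

end

theory Submission imports Defs begin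

no_notation fps_nth (infixl \<open>$\<close> 75)

text \<open>
  Write the ring of integers as \<open>\<int> + \<int> w\<close> and let \<open>y = Im w\<close>, which is half the square root of the
  absolute discriminant. All bounds are in terms of \<open>y\<close>: the volume of the quotient is at least a constant
  times \<open>y\<^sup>3\<close>, and the volume of the thin part is at most a constant times \<open>y\<close> to the power \<open>2 + 3 \<epsilon>\<close>.

  For the lower bound, the points at height about \<open>48 / y\<close> above at least half of a fundamental rectangle
  of the ring are identified by \<open>\<Gamma>\<close> only with boundedly many others.

  For the upper bound, by the box principle every orbit reaches height \<open>1 / (80 y)\<close> above one of the cusps, whose number is
  at most a constant times \<open>y\<close> to the power \<open>1 + \<epsilon>\<close>. In coordinates with the cusp at infinity, a point moved a bounded distance by
  an element with lower left entry \<open>\<kappa>\<close> is either high in the cusp, or lies at height at least \<open>1 / (80 y)\<close> above a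
  disc of radius comparable to \<open>1 / |\<kappa>|\<close>. The trace of the element is bounded and its determinant is \<open>1\<close>, so that,
  modulo the translations of the cusp, the divisor bound limits the number of elements; the volumes of the
  boxes above the discs are then summed.
\<close>

section \<open>The divisor bound\<close>

text \<open>The powers of \<open>y\<close> balance as follows. A box above a disc of radius about
  \<open>1 / |\<kappa>|\<close>, cut at height \<open>1 / (80 y)\<close>, has volume of order
  \<open>y\<^sup>2 / |\<kappa>|\<^sup>2\<close>, and
  \<open>|\<kappa>|\<^sup>2 = a\<^sup>2 N\<close>, where \<open>N\<close> is the index of a
  sublattice of the ring. Reduced modulo it, the upper left entry is \<open>j + i w\<close> with
  \<open>(i + 1) (j + 1) \<le> N\<close>, and \<open>N\<close> divides a norm fixed by this entry
  and the trace. So the sum of \<open>1 / N\<close> costs only harmonic sums in \<open>i\<close>,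
  \<open>j\<close> and a divisor count. The factor \<open>1 / a\<^sup>2\<close> makes the sum over
  cusps harmonic too, as at most \<open>a\<close> of them share \<open>a\<close>: the boxes give
  \<open>y\<^sup>2\<close> up to small powers. The high neighbourhoods have volume of order
  \<open>y\<close> whatever \<open>a\<close> is; there the number of cusps enters and again gives
  \<open>y\<^sup>2\<close>. Against a total volume of order at least \<open>y\<^sup>3\<close>, this
  is the exponent 2/3. An obstacle is that quotient volumes are defined by an unspecified choice of
  fundamental domain: one must be constructed so that the choice succeeds, and both bounds must then
  hold for any domain, hence the covering and multiplicity inequalities.\<close>

lemma card_divisors_prime_power_mult:
  fixes p m k :: nat
  assumes "prime p" "m > 0"
  shows "card {d. d dvd p ^ k * m} \<le> (k + 1) * card {d. d dvd m}"
proof -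
  have "{d. d dvd p ^ k * m} \<subseteq> (\<lambda>(i, d). p ^ i * d) ` ({..k} \<times> {d. d dvd m})"
  proof
    fix d assume "d \<in> {d. d dvd p ^ k * m}"
    then obtain x y where xy: "d = x * y" "x dvd p ^ k" "y dvd m"
      using division_decomp[of d "p ^ k" m] by auto
    then obtain i where "i \<le> k" "x = p ^ i"
      using divides_primepow_nat[OF assms(1)] by auto
    with xy show "d \<in> (\<lambda>(i, d). p ^ i * d) ` ({..k} \<times> {d. d dvd m})" by auto
  qed
  moreover have fin: "finite ({..k} \<times> {d. d dvd m})" using assms by simp
  ultimately have "card {d. d dvd p ^ k * m} \<le> card ((\<lambda>(i, d). p ^ i * d) ` ({..k} \<times> {d. d dvd m}))"
    by (intro card_mono) auto
  also have "\<dots> \<le> card ({..k} \<times> {d. d dvd m})" by (rule card_image_le[OF fin])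
  finally show ?thesis by (simp add: card_cartesian_product)
qed

text \<open>Prime powers are split off one at a time. The factor \<open>k + 1\<close> is at most
  \<open>p\<close> to the power \<open>\<epsilon> k\<close> once \<open>p \<ge> T\<close>, and costs
  a constant \<open>c\<close> for smaller primes; \<open>S n\<close> collects the latter, so at most
  \<open>T\<close> constants accumulate.\<close>

lemma divisor_bound:
  fixes \<epsilon> :: real
  assumes "\<epsilon> > 0"
  shows "\<exists>C\<ge>1. \<forall>n::nat. n > 0 \<longrightarrow> real (card {d. d dvd n}) \<le> C * real n powr \<epsilon>"
proof -
  define T where "T = nat \<lceil>2 powr (1 / \<epsilon>)\<rceil> + 2"
  define c where "c = max 1 (1 / (\<epsilon> * ln 2))"
  have c1: "c \<ge> 1" by (simp add: c_def)
  have small: "real k + 1 \<le> c * (real p powr \<epsilon>) ^ k" if "p \<ge> 2" for p k :: nat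
  proof -
    have "1 + real k * (\<epsilon> * ln 2) \<le> exp (real k * (\<epsilon> * ln 2))" by (rule exp_ge_add_one_self)
    also have "\<dots> = (2 powr \<epsilon>) ^ k" by (simp add: powr_def exp_of_nat_mult)
    also have "\<dots> \<le> (real p powr \<epsilon>) ^ k"
      using that assms by (intro power_mono powr_mono2) auto
    finally have 1: "1 + real k * (\<epsilon> * ln 2) \<le> (real p powr \<epsilon>) ^ k" .
    have "c * (\<epsilon> * ln 2) \<ge> 1 / (\<epsilon> * ln 2) * (\<epsilon> * ln 2)"
      using assms by (intro mult_right_mono) (auto simp: c_def)
    then have "c * (\<epsilon> * ln 2) \<ge> 1" using assms by simp
    then have "real k * 1 \<le> real k * (c * (\<epsilon> * ln 2))" by (intro mult_left_mono) auto
    then have "real k + 1 \<le> c * (1 + real k * (\<epsilon> * ln 2))"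
      using c1 by (simp add: algebra_simps)
    also have "\<dots> \<le> c * (real p powr \<epsilon>) ^ k" using 1 c1 by (intro mult_left_mono) auto
    finally show ?thesis .
  qed
  have big: "real k + 1 \<le> (real p powr \<epsilon>) ^ k" if "p \<ge> T" for p k :: nat
  proof -
    have "real p \<ge> 2 powr (1 / \<epsilon>)" using that unfolding T_def by linarith
    then have "real p powr \<epsilon> \<ge> (2 powr (1 / \<epsilon>)) powr \<epsilon>"
      using assms by (intro powr_mono2) auto
    then have 2: "real p powr \<epsilon> \<ge> 2" using assms by (simp add: powr_powr)
    have "real k + 1 \<le> 2 ^ k"
    proof (induction k)
      case (Suc k)
      have "(1::real) \<le> 2 ^ k" by simp
      with Suc show ?case by simp
    qed simp
    also have "\<dots> \<le> (real p powr \<epsilon>) ^ k" using 2 by (intro power_mono) auto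
    finally show ?thesis .
  qed
  define S where "S n = {p \<in> {..<T}. prime p \<and> p dvd n}" for n :: nat
  have finS: "finite (S n)" for n by (simp add: S_def)
  have main: "n > 0 \<longrightarrow> real (card {d. d dvd n}) \<le> c ^ card (S n) * real n powr \<epsilon>" for n :: nat
  proof (induction n rule: less_induct)
    case (less n)
    show ?case
    proof (cases "n \<le> 1")
      case True
      then have "n = 0 \<or> n = 1" by auto
      then show ?thesis using c1 by (auto intro: one_le_power)
    next
      case False
      then obtain p where p: "prime p" "p dvd n" using prime_factor_nat[of n] by auto
      define k where "k = multiplicity p n"
      obtain m where m: "n = p ^ k * m" "\<not> p dvd m"
        using multiplicity_decompose'[of n p] False p unfolding k_def
        by (metis not_one_le_zero not_prime_unit nat_le_linear)
      have "k \<noteq> 0" using m p by (metis mult_1 power_0)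
      then have k: "k \<ge> 1" by simp
      have m0: "m > 0" using m(1) False by (cases m) auto
      have p2: "p \<ge> 2" using p by (simp add: prime_ge_2_nat)
      have pk: "p ^ k \<ge> 2"
        using self_le_power[of p k] p2 k by linarith
      have "m < n" using pk m0 unfolding m(1) by simp
      then have IH: "real (card {d. d dvd m}) \<le> c ^ card (S m) * real m powr \<epsilon>"
        using less m0 by auto
      have npow: "real n powr \<epsilon> = (real p powr \<epsilon>) ^ k * real m powr \<epsilon>"
        unfolding m(1) using p2 m0
        by (simp add: powr_mult powr_powr powr_realpow[symmetric] mult.commute)
      have sub: "S m \<subseteq> S n" unfolding S_def m(1) by auto
      have step: "(real k + 1) * c ^ card (S m) \<le> c ^ card (S n) * (real p powr \<epsilon>) ^ k"
      proof (cases "p < T")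
        case True
        have "insert p (S m) \<subseteq> S n" using sub True p by (auto simp: S_def)
        then have "card (insert p (S m)) \<le> card (S n)" by (intro card_mono finS)
        moreover have "p \<notin> S m" using m by (simp add: S_def)
        ultimately have le: "card (S m) + 1 \<le> card (S n)" using finS by simp
        have "(real k + 1) * c ^ card (S m) \<le> (c * (real p powr \<epsilon>) ^ k) * c ^ card (S m)"
          using small[OF p2] c1 by (intro mult_right_mono) auto
        also have "\<dots> = c ^ (card (S m) + 1) * (real p powr \<epsilon>) ^ k" by simp
        also have "\<dots> \<le> c ^ card (S n) * (real p powr \<epsilon>) ^ k"
          using le c1 by (intro mult_right_mono power_increasing) auto
        finally show ?thesis .
      next
        case False
        have "(real k + 1) * c ^ card (S m) \<le> (real p powr \<epsilon>) ^ k * c ^ card (S n)"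
          using big False c1 sub finS by (intro mult_mono power_increasing card_mono) auto
        then show ?thesis by (simp add: mult.commute)
      qed
      have "real (card {d. d dvd n}) \<le> (real k + 1) * real (card {d. d dvd m})"
        using card_divisors_prime_power_mult[OF p(1) m0, of k, folded m(1)]
        by (simp only: of_nat_le_iff[symmetric, where ?'a = real] of_nat_mult of_nat_add of_nat_1)
      also have "\<dots> \<le> (real k + 1) * (c ^ card (S m) * real m powr \<epsilon>)"
        using IH by (intro mult_left_mono) auto
      also have "\<dots> = ((real k + 1) * c ^ card (S m)) * real m powr \<epsilon>" by simp
      also have "\<dots> \<le> (c ^ card (S n) * (real p powr \<epsilon>) ^ k) * real m powr \<epsilon>"
        using step by (intro mult_right_mono) auto
      finally show ?thesis unfolding npow by (simp add: mult.assoc)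
    qed
  qed
  show ?thesis
  proof (intro exI[of _ "c ^ T"] conjI allI impI)
    show "1 \<le> c ^ T" using c1 by (rule one_le_power)
    fix n :: nat assume n: "n > 0"
    have "card (S n) \<le> card {..<T}" by (intro card_mono) (auto simp: S_def)
    then have "c ^ card (S n) \<le> c ^ T" using c1 by (intro power_increasing) auto
    then have "c ^ card (S n) * real n powr \<epsilon> \<le> c ^ T * real n powr \<epsilon>" by (intro mult_right_mono) auto
    with main n show "real (card {d. d dvd n}) \<le> c ^ T * real n powr \<epsilon>" by (meson order_trans)
  qed
qed

section \<open>The action on hyperbolic space\<close>

text \<open>The point \<open>p\<close> as a Hermitian form of determinant \<open>1\<close>, evaluated at \<open>(a, b)\<close> and \<open>(c, d)\<close>, and its quadratic
  form \<open>hq\<close>. If \<open>A\<close> has lower row \<open>(c, d)\<close>, then \<open>hq p c d\<close> is the inverse of the height of \<open>hyp_act A p\<close>.\<close>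

definition hf :: "complex \<times> real \<Rightarrow> complex \<Rightarrow> complex \<Rightarrow> complex \<Rightarrow> complex \<Rightarrow> complex" where
  "hf p a b c d = ((a * fst p + b) * cnj (c * fst p + d) + a * cnj c * (of_real (snd p))\<^sup>2) / of_real (snd p)"

definition hq :: "complex \<times> real \<Rightarrow> complex \<Rightarrow> complex \<Rightarrow> real" where
  "hq p c d = ((cmod (c * fst p + d))\<^sup>2 + (cmod c)\<^sup>2 * (snd p)\<^sup>2) / snd p"

lemma hf_diag: "hf p c d c d = of_real (hq p c d)"
proof -
  have n: "x * cnj x = (complex_of_real (cmod x))\<^sup>2" for x
    using complex_norm_square[of x] by simp
  show ?thesis unfolding hf_def hq_def n by simp
qed

lemma mem_H3: "p \<in> H3 \<longleftrightarrow> snd p > 0"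
  by (cases p) (simp add: H3_def)

lemma hq_pos:
  assumes "snd p > 0" "c \<noteq> 0 \<or> d \<noteq> 0"
  shows "hq p c d > 0"
proof (cases "c = 0")
  case False
  then have "(cmod c)\<^sup>2 * (snd p)\<^sup>2 > 0" using assms by simp
  then show ?thesis unfolding hq_def using assms
    by (intro divide_pos_pos add_nonneg_pos) auto
qed (use assms in \<open>auto simp: hq_def\<close>)

lemma cnj_hf: "cnj (hf p a b c d) = hf p c d a b"
  unfolding hf_def by (simp add: algebra_simps)

lemma hf_bilinear:
  "hf p (u * a + w * c) (u * b + w * d) (u' * a + w' * c) (u' * b + w' * d) =
     u * cnj u' * hf p a b a b + u * cnj w' * hf p a b c d +
     w * cnj u' * hf p c d a b + w * cnj w' * hf p c d c d"
  unfolding hf_def by (simp add: algebra_simps add_divide_distrib)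

text \<open>A Gram determinant is the determinant of the form, here 1, times the squared modulus of
  the determinant of the two vectors. It recovers one diagonal value of the form from the other and
  the mixed value.\<close>

lemma hf_lagrange:
  assumes "snd p \<noteq> 0"
  shows "hf p a b a b * hf p c d c d = hf p a b c d * hf p c d a b + (a * d - b * c) * cnj (a * d - b * c)"
proof -
  define t where "t = complex_of_real (snd p)"
  have t: "t \<noteq> 0" using assms by (simp add: t_def)
  show ?thesis unfolding hf_def t_def[symmetric] using t
    by (simp add: field_simps power2_eq_square)
qed

lemma det2: "det (A :: complex ^ 2 ^ 2) = A $ 1 $ 1 * A $ 2 $ 2 - A $ 1 $ 2 * A $ 2 $ 1"
  by (simp add: det_2)

lemma matrix_mult_2:
  fixes A B :: "complex ^ 2 ^ 2"
  shows "(A ** B) $ i $ j = A $ i $ 1 * B $ 1 $ j + A $ i $ 2 * B $ 2 $ j"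
  by (simp add: matrix_matrix_mult_def sum_2)

lemma fst_hyp_act:
  assumes "p \<in> H3"
  shows "fst (hyp_act A p) = hf p (A $ 1 $ 1) (A $ 1 $ 2) (A $ 2 $ 1) (A $ 2 $ 2) / of_real (hq p (A $ 2 $ 1) (A $ 2 $ 2))"
  using assms by (cases p) (simp add: hyp_act_def Let_def hf_def hq_def mem_H3)

lemma snd_hyp_act:
  assumes "p \<in> H3"
  shows "snd (hyp_act A p) = 1 / hq p (A $ 2 $ 1) (A $ 2 $ 2)"
  using assms by (cases p) (simp add: hyp_act_def Let_def hq_def)

lemma hyp_act_H3:
  assumes "det A = 1" "p \<in> H3"
  shows "hyp_act A p \<in> H3"
proof -
  have "A $ 2 $ 1 \<noteq> 0 \<or> A $ 2 $ 2 \<noteq> 0" using assms(1) by (auto simp: det2)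
  then show ?thesis using hq_pos assms(2) by (simp add: mem_H3 snd_hyp_act)
qed

text \<open>Moving a point by \<open>A\<close> means pulling its form back along \<open>A\<close>.
  The image point is read off from the values on the rows of \<open>A\<close>, and
  \<open>hf_lagrange\<close> supplies the missing one. Composition and isometry are deduced from
  this rule instead of from quaternions.\<close>

lemma hf_hyp_act:
  assumes "det A = 1" and p: "p \<in> H3"
  shows "hf (hyp_act A p) u w u' w' =
    hf p (u * A $ 1 $ 1 + w * A $ 2 $ 1) (u * A $ 1 $ 2 + w * A $ 2 $ 2)
         (u' * A $ 1 $ 1 + w' * A $ 2 $ 1) (u' * A $ 1 $ 2 + w' * A $ 2 $ 2)"
proof -
  define a b c d where abcd: "a = A $ 1 $ 1" "b = A $ 1 $ 2" "c = A $ 2 $ 1" "d = A $ 2 $ 2"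
  have det: "a * d - b * c = 1" using assms(1) by (simp add: det2 abcd)
  have sp: "snd p > 0" using p by (simp add: mem_H3)
  define N where "N = complex_of_real (hq p c d)"
  have "hq p c d > 0" using det by (intro hq_pos sp) auto
  then have N: "N \<noteq> 0" by (simp add: N_def)
  define h where "h = hf p a b c d"
  have L: "hf p a b a b * N = h * cnj h + 1"
    using hf_lagrange[of p a b c d] sp det by (simp add: N_def hf_diag h_def cnj_hf)
  have cN: "cnj N = N" by (simp add: N_def)
  have ch: "hf p c d a b = cnj h" by (simp add: h_def cnj_hf)
  have L': "hf p a b a b = (h * cnj h + 1) / N" using L N by (simp add: field_simps)
  have s: "complex_of_real (snd (hyp_act A p)) = 1 / N"
    using snd_hyp_act[OF p] by (simp add: N_def abcd)
  have f: "fst (hyp_act A p) = h / N"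
    using fst_hyp_act[OF p] by (simp add: N_def h_def abcd)
  have "hf (hyp_act A p) u w u' w' = ((u * (h / N) + w) * cnj (u' * (h / N) + w') + u * cnj u' * (1 / N)\<^sup>2) / (1 / N)"
    unfolding hf_def s f ..
  also have "\<dots> = u * cnj u' * ((h * cnj h + 1) / N) + u * cnj w' * h + w * cnj u' * cnj h + w * cnj w' * N"
    using N cN by (simp add: field_simps power2_eq_square)
  also have "\<dots> = hf p (u * a + w * c) (u * b + w * d) (u' * a + w' * c) (u' * b + w' * d)"
    unfolding hf_bilinear L' ch by (simp add: h_def[symmetric] hf_diag N_def)
  finally show ?thesis by (simp add: abcd)
qed

lemma hq_hyp_act:
  assumes "det A = 1" "p \<in> H3"
  shows "hq (hyp_act A p) u w = hq p (u * A $ 1 $ 1 + w * A $ 2 $ 1) (u * A $ 1 $ 2 + w * A $ 2 $ 2)"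
  using hf_hyp_act[OF assms, of u w u w] unfolding hf_diag by (simp only: of_real_eq_iff)

lemma H3_point_eqI:
  assumes "snd p > 0" "snd q > 0" "hf p 1 0 0 1 = hf q 1 0 0 1" "hq p 0 1 = hq q 0 1"
  shows "p = q"
  using assms by (cases p; cases q) (auto simp: hf_def hq_def)

lemma hyp_act_mult:
  assumes "det A = 1" "det B = 1" "p \<in> H3"
  shows "hyp_act A (hyp_act B p) = hyp_act (A ** B) p"
proof -
  have AB: "det (A ** B) = 1" using assms by (simp add: det_mul)
  have Bp: "hyp_act B p \<in> H3" using assms hyp_act_H3 by blast
  show ?thesis
  proof (rule H3_point_eqI)
    show "snd (hyp_act A (hyp_act B p)) > 0" "snd (hyp_act (A ** B) p) > 0"
      using hyp_act_H3 assms Bp AB by (auto simp: mem_H3[symmetric])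
  qed (simp_all add: hf_hyp_act hq_hyp_act assms Bp AB matrix_mult_2 ring_distribs)
qed

lemma hyp_act_mat1: "p \<in> H3 \<Longrightarrow> hyp_act (mat 1) p = p"
  by (cases p) (simp add: hyp_act_def mat_def H3_def)

text \<open>The inverse for determinant 1, in a form that visibly keeps the entries in a
  ring.\<close>

definition adj2 :: "complex ^ 2 ^ 2 \<Rightarrow> complex ^ 2 ^ 2" where
  "adj2 A = vector [vector [A $ 2 $ 2, - A $ 1 $ 2], vector [- A $ 2 $ 1, A $ 1 $ 1]]"

lemma adj2_nth [simp]:
  "adj2 A $ 1 $ 1 = A $ 2 $ 2" "adj2 A $ 1 $ 2 = - A $ 1 $ 2"
  "adj2 A $ 2 $ 1 = - A $ 2 $ 1" "adj2 A $ 2 $ 2 = A $ 1 $ 1"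
  by (simp_all add: adj2_def)

lemma det_adj2 [simp]: "det (adj2 A) = det A"
  by (simp add: det2)

lemma mat2_eq_iff:
  "(A :: complex ^ 2 ^ 2) = B \<longleftrightarrow> A $ 1 $ 1 = B $ 1 $ 1 \<and> A $ 1 $ 2 = B $ 1 $ 2 \<and> A $ 2 $ 1 = B $ 2 $ 1 \<and> A $ 2 $ 2 = B $ 2 $ 2"
  by (auto simp: vec_eq_iff forall_2)

lemma adj2_mult:
  assumes "det A = 1"
  shows "adj2 A ** A = mat 1" "A ** adj2 A = mat 1"
  using assms by (auto simp: mat2_eq_iff matrix_mult_2 det2 mat_def algebra_simps)

lemma hyp_act_adj2:
  assumes "det A = 1" "p \<in> H3"
  shows "hyp_act (adj2 A) (hyp_act A p) = p" "hyp_act A (hyp_act (adj2 A) p) = p"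
  using assms by (simp_all add: hyp_act_mult adj2_mult hyp_act_mat1)

text \<open>The argument of \<open>arcosh\<close> is half the polarised determinant of the two
  Hermitian forms, an expression that behaves well under a change of basis.\<close>

lemma hyp_dist_hf:
  assumes "p \<in> H3" "q \<in> H3"
  shows "hyp_dist p q = arcosh ((hq p 1 0 * hq q 0 1 + hq p 0 1 * hq q 1 0) / 2 - Re (hf p 1 0 0 1 * hf q 0 1 1 0))"
proof -
  obtain z t w s where pq: "p = (z, t)" "q = (w, s)" by (cases p, cases q)
  have ts: "t > 0" "s > 0" using assms by (auto simp: pq mem_H3)
  have n: "(cmod (z - w))\<^sup>2 = (cmod z)\<^sup>2 + (cmod w)\<^sup>2 - 2 * Re (z * cnj w)"
    by (simp add: cmod_power2 power2_diff algebra_simps)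
  have "hf p 1 0 0 1 * hf q 0 1 1 0 = (z * cnj w) / of_real (t * s)"
    by (simp add: hf_def pq)
  then have r: "Re (hf p 1 0 0 1 * hf q 0 1 1 0) = Re (z * cnj w) / (t * s)"
    by (metis Re_divide_of_real)
  have "1 + ((cmod (z - w))\<^sup>2 + (t - s)\<^sup>2) / (2 * t * s) =
     (hq p 1 0 * hq q 0 1 + hq p 0 1 * hq q 1 0) / 2 - Re (hf p 1 0 0 1 * hf q 0 1 1 0)"
    unfolding r n using ts by (simp add: hq_def pq field_simps power2_eq_square)
  then show ?thesis by (simp add: hyp_dist_def pq)
qed

lemma hf_expand: "hf p a b c d = a * cnj c * of_real (hq p 1 0) + a * cnj d * hf p 1 0 0 1 + b * cnj c * hf p 0 1 1 0 + b * cnj d * of_real (hq p 0 1)"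
  using hf_bilinear[of p a 1 b 0 0 1 c d] by (simp add: hf_diag)

text \<open>The polarised determinant \<open>F\<close> picks up the factor
  \<open>|det A|\<^sup>2 = 1\<close> under the change of basis.\<close>

lemma hyp_dist_isometry:
  assumes "det A = 1" "p \<in> H3" "q \<in> H3"
  shows "hyp_dist (hyp_act A p) (hyp_act A q) = hyp_dist p q"
proof -
  define a b c d where abcd: "a = A $ 1 $ 1" "b = A $ 1 $ 2" "c = A $ 2 $ 1" "d = A $ 2 $ 2"
  have det: "a * d - b * c = 1" using assms(1) by (simp add: det2 abcd)
  define F where "F P Q = hf P 1 0 1 0 * hf Q 0 1 0 1 + hf P 0 1 0 1 * hf Q 1 0 1 0 - hf P 1 0 0 1 * hf Q 0 1 1 0 - hf P 0 1 1 0 * hf Q 1 0 0 1" for P Q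
  have dist: "hyp_dist P Q = arcosh (Re (F P Q) / 2)" if "P \<in> H3" "Q \<in> H3" for P Q
  proof -
    have c: "hf P 0 1 1 0 * hf Q 1 0 0 1 = cnj (hf P 1 0 0 1 * hf Q 0 1 1 0)" by (simp add: cnj_hf)
    show ?thesis unfolding hyp_dist_hf[OF that] F_def hf_diag c
      by (simp add: field_simps)
  qed
  have e: "hf P (1 * a + 0 * c) (1 * b + 0 * d) (1 * a + 0 * c) (1 * b + 0 * d) = hf P a b a b"
    "hf P (0 * a + 1 * c) (0 * b + 1 * d) (0 * a + 1 * c) (0 * b + 1 * d) = hf P c d c d"
    "hf P (1 * a + 0 * c) (1 * b + 0 * d) (0 * a + 1 * c) (0 * b + 1 * d) = hf P a b c d"
    "hf P (0 * a + 1 * c) (0 * b + 1 * d) (1 * a + 0 * c) (1 * b + 0 * d) = hf P c d a b" for P by simp_all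
  have inv: "F (hyp_act A p) (hyp_act A q) = (a * d - b * c) * cnj (a * d - b * c) * F p q"
    unfolding F_def hf_hyp_act[OF assms(1,2)] hf_hyp_act[OF assms(1,3)] abcd[symmetric]
    unfolding e hf_expand[of _ a b] hf_expand[of _ c d]
    unfolding hf_diag
    by (simp add: algebra_simps)
  show ?thesis using dist assms hyp_act_H3 inv det by simp
qed

lemma cosh_le_of_hyp_dist_le:
  assumes "p \<in> H3" "q \<in> H3" "hyp_dist p q \<le> r"
  shows "((cmod (fst p - fst q))\<^sup>2 + (snd p)\<^sup>2 + (snd q)\<^sup>2) / (2 * snd p * snd q) \<le> cosh r"
proof -
  obtain z t w s where pq: "p = (z, t)" "q = (w, s)" by (cases p, cases q)
  have ts: "t > 0" "s > 0" using assms by (auto simp: pq mem_H3)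
  define X where "X = 1 + ((cmod (z - w))\<^sup>2 + (t - s)\<^sup>2) / (2 * t * s)"
  have X1: "X \<ge> 1" unfolding X_def using ts by simp
  have "arcosh X \<le> r" using assms(3) by (simp add: hyp_dist_def pq X_def)
  moreover have "arcosh X \<ge> 0" using X1 by simp
  ultimately have "cosh (arcosh X) \<le> cosh r"
    by (subst cosh_real_nonneg_le_iff) auto
  then have "X \<le> cosh r" using X1 by (simp add: cosh_arcosh_real)
  moreover have "X = ((cmod (z - w))\<^sup>2 + t\<^sup>2 + s\<^sup>2) / (2 * t * s)"
    unfolding X_def using ts by (simp add: field_simps power2_eq_square)
  ultimately show ?thesis by (simp add: pq)
qed

text \<open>The rows of the matrix \<open>n\<inverse> A n\<close>, where \<open>n\<close> is the upper triangular matrix taking \<open>(0, 1)\<close> to \<open>(z, t)\<close>,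
  are bounded because \<open>A\<close> moves \<open>(z, t)\<close> by a bounded distance.\<close>

lemma displacement_bounds:
  assumes A: "det A = 1" and p: "p \<in> H3" and r: "hyp_dist p (hyp_act A p) \<le> r"
  defines "K \<equiv> 2 * cosh r"
  shows "cmod (A $ 2 $ 1) * snd p \<le> K"
    "cmod (A $ 2 $ 1 * fst p + A $ 2 $ 2) \<le> K"
    "cmod (A $ 1 $ 1 - A $ 2 $ 1 * fst p) \<le> K"
    "cmod ((A $ 1 $ 1 - A $ 2 $ 1 * fst p) * fst p + A $ 1 $ 2 - A $ 2 $ 2 * fst p) \<le> K * snd p"
proof -
  define a b c d where abcd: "a = A $ 1 $ 1" "b = A $ 1 $ 2" "c = A $ 2 $ 1" "d = A $ 2 $ 2"
  define z t w s where zt: "z = fst p" "t = snd p" "w = fst (hyp_act A p)" "s = snd (hyp_act A p)"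
  have pos: "t > 0" "s > 0" using p hyp_act_H3[OF A p] by (auto simp: zt mem_H3)
  have K1: "K \<ge> 1" unfolding K_def using cosh_real_ge_1[of r] by linarith
  have sq: "x \<le> K" if "x\<^sup>2 \<le> K" for x :: real
  proof (rule power2_le_imp_le)
    have "K * 1 \<le> K * K" using K1 by (intro mult_left_mono) auto
    then show "x\<^sup>2 \<le> K\<^sup>2" using that by (simp add: power2_eq_square)
  qed (use K1 in simp)
  have main: "(cmod (z - w))\<^sup>2 + t\<^sup>2 + s\<^sup>2 \<le> K * (t * s)"
    using cosh_le_of_hyp_dist_le[OF p hyp_act_H3[OF A p] r] pos
    by (simp add: zt[symmetric] K_def divide_le_eq mult_ac)
  have "t * t \<le> t * (K * s)" using main zero_le_power2[of s] zero_le_power2[of "cmod (z - w)"]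
    unfolding power2_eq_square by (smt (verit) mult.left_commute)
  then have tK: "t \<le> K * s" using pos by (simp only: mult_le_cancel_left_pos)
  have s: "s = 1 / hq p c d" using snd_hyp_act[OF p, of A] by (simp add: zt abcd)
  have q: "hq p c d = 1 / s" by (simp add: s)
  then have "(cmod (c * z + d))\<^sup>2 + (cmod c)\<^sup>2 * t\<^sup>2 = t / s"
    using pos by (simp add: hq_def zt[symmetric] field_simps)
  also have "\<dots> \<le> K" using tK pos by (simp add: field_simps)
  finally have 1: "(cmod (c * z + d))\<^sup>2 + (cmod c * t)\<^sup>2 \<le> K" by (simp add: power_mult_distrib)
  show "cmod (A $ 2 $ 1) * snd p \<le> K"
    using sq[of "cmod c * t"] 1 zero_le_power2[of "cmod (c * z + d)"] unfolding abcd zt by linarith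
  show "cmod (A $ 2 $ 1 * fst p + A $ 2 $ 2) \<le> K"
    using sq[of "cmod (c * z + d)"] 1 zero_le_power2[of "cmod c * t"] unfolding abcd zt by linarith
  define \<tau> \<kappa> where tk: "\<tau> = a - c * z" "\<kappa> = \<tau> * z + b - d * z"
  \<comment> \<open>Subtracting \<open>z\<close> times the lower row makes the mixed value with the
    lower row \<open>(w - z) / s\<close>; as the lower row has value \<open>1 / s\<close>,
    \<open>hf_lagrange\<close> gives the value of the new upper row, which is built from
    \<open>\<tau>\<close> and \<open>\<kappa>\<close>.\<close>
  have bil: "hf p (1 * a + (- z) * c) (1 * b + (- z) * d) (0 * a + 1 * c) (0 * b + 1 * d) = hf p a b c d - z * hf p c d c d"
    unfolding hf_bilinear by simp
  have "w = hf p a b c d / hf p c d c d"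
    using fst_hyp_act[OF p, of A] by (simp add: zt abcd hf_diag)
  moreover have nz: "hf p c d c d = 1 / of_real s" by (simp add: hf_diag q)
  ultimately have "hf p a b c d = w / of_real s" using pos by (simp add: field_simps)
  then have "hf p (a - z * c) (b - z * d) c d = (w - z) / of_real s"
    using bil nz by (simp add: diff_divide_distrib algebra_simps)
  moreover have "(a - z * c) * d - (b - z * d) * c = 1"
    using A by (simp add: det2 abcd algebra_simps)
  ultimately have "hf p (a - z * c) (b - z * d) (a - z * c) (b - z * d) * (1 / of_real s) =
     ((w - z) / of_real s) * cnj ((w - z) / of_real s) + 1"
    using hf_lagrange[of p "a - z * c" "b - z * d" c d] pos
    by (simp add: nz[symmetric] zt(2)[symmetric] cnj_hf[of p "a - z * c" "b - z * d" c d, symmetric])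
  then have "complex_of_real (hq p (a - z * c) (b - z * d) * (1 / s)) = complex_of_real ((cmod (w - z) / s)\<^sup>2 + 1)"
    using pos by (simp add: hf_diag power_divide complex_norm_square[symmetric] power2_eq_square[of "complex_of_real s"] del: complex_cnj_diff)
  then have "hq p (a - z * c) (b - z * d) * (1 / s) = (cmod (w - z) / s)\<^sup>2 + 1"
    by (simp only: of_real_eq_iff)
  then have "hq p (a - z * c) (b - z * d) * s = (cmod (z - w))\<^sup>2 + s\<^sup>2"
    using pos by (simp add: field_simps power2_eq_square norm_minus_commute)
  also have "\<dots> \<le> (K * t) * s" using main zero_le_power2[of t] unfolding mult.assoc by linarith
  finally have "hq p (a - z * c) (b - z * d) \<le> K * t" using pos by simp
  moreover have "hq p (a - z * c) (b - z * d) = ((cmod \<kappa>)\<^sup>2 + (cmod \<tau>)\<^sup>2 * t\<^sup>2) / t"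
    by (simp add: hq_def tk zt algebra_simps)
  ultimately have "((cmod \<kappa>)\<^sup>2 + (cmod \<tau>)\<^sup>2 * t\<^sup>2) / t \<le> K * t" by simp
  then have "(cmod \<kappa>)\<^sup>2 + (cmod \<tau>)\<^sup>2 * t\<^sup>2 \<le> K * t * t"
    using pos by (simp only: pos_divide_le_eq)
  then have "(cmod \<kappa>)\<^sup>2 + (cmod \<tau>)\<^sup>2 * t\<^sup>2 \<le> K * t\<^sup>2"
    by (simp add: power2_eq_square mult.assoc)
  then have 2: "(cmod \<kappa> / t)\<^sup>2 + (cmod \<tau>)\<^sup>2 \<le> K"
    using pos by (simp add: field_simps power2_eq_square)
  show "cmod (A $ 1 $ 1 - A $ 2 $ 1 * fst p) \<le> K"
    using sq[of "cmod \<tau>"] 2 zero_le_power2[of "cmod \<kappa> / t"] unfolding abcd zt tk by linarith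
  have "cmod \<kappa> / t \<le> K" using sq[of "cmod \<kappa> / t"] 2 zero_le_power2[of "cmod \<tau>"] by linarith
  then show "cmod ((A $ 1 $ 1 - A $ 2 $ 1 * fst p) * fst p + A $ 1 $ 2 - A $ 2 $ 2 * fst p) \<le> K * snd p"
    using pos by (simp add: abcd zt tk field_simps)
qed

section \<open>Invariance of the hyperbolic volume\<close>

lemma lborel_complex: "(lborel :: complex measure) = distr (lborel \<Otimes>\<^sub>M lborel) borel (\<lambda>(x, y). Complex x y)"
proof (rule lborel_eqI)
  fix l u :: complex
  assume lu: "\<And>b. b \<in> Basis \<Longrightarrow> l \<bullet> b \<le> u \<bullet> b"
  have le: "Re l \<le> Re u" "Im l \<le> Im u"
    using lu[of 1] lu[of \<i>] by (auto simp: Basis_complex_def inner_complex_def)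
  have [measurable]: "(\<lambda>(x, y). Complex x y) \<in> borel_measurable (lborel \<Otimes>\<^sub>M lborel)"
    unfolding lborel_prod by (auto intro!: borel_measurable_continuous_onI continuous_intros simp: split_beta Complex_eq)
  have eq: "(\<lambda>(x, y). Complex x y) -` box l u \<inter> space (lborel \<Otimes>\<^sub>M lborel) = box (Re l) (Re u) \<times> box (Im l) (Im u)"
    by (auto simp: in_box_complex_iff space_pair_measure)
  have "emeasure (distr (lborel \<Otimes>\<^sub>M lborel) borel (\<lambda>(x, y). Complex x y)) (box l u) = ennreal (Re u - Re l) * ennreal (Im u - Im l)"
    by (subst emeasure_distr) (use le in \<open>simp_all add: eq lborel.emeasure_pair_measure_Times\<close>)
  then show "emeasure (distr (lborel \<Otimes>\<^sub>M lborel) borel (\<lambda>(x, y). Complex x y)) (box l u) = (\<Prod>b\<in>Basis. (u - l) \<bullet> b)"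
    using le by (simp add: Basis_complex_def inner_complex_def ennreal_mult)
qed simp

lemma measurable_Complex [measurable (raw)]:
  assumes "f \<in> borel_measurable M" "g \<in> borel_measurable M"
  shows "(\<lambda>x. Complex (f x) (g x)) \<in> borel_measurable M"
  unfolding Complex_eq using assms by simp

lemma nn_integral_complex:
  assumes [measurable]: "f \<in> borel_measurable borel"
  shows "(\<integral>\<^sup>+z. f z \<partial>(lborel :: complex measure)) = (\<integral>\<^sup>+y. \<integral>\<^sup>+x. f (Complex x y) \<partial>lborel \<partial>lborel)"
    and "(\<integral>\<^sup>+z. f z \<partial>(lborel :: complex measure)) = (\<integral>\<^sup>+x. \<integral>\<^sup>+y. f (Complex x y) \<partial>lborel \<partial>lborel)"
proof -
  have "(\<integral>\<^sup>+z. f z \<partial>(lborel :: complex measure)) = (\<integral>\<^sup>+p. f (Complex (fst p) (snd p)) \<partial>(lborel \<Otimes>\<^sub>M lborel))"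
    by (subst lborel_complex, subst nn_integral_distr) (auto simp: split_beta)
  note * = this
  show "(\<integral>\<^sup>+z. f z \<partial>(lborel :: complex measure)) = (\<integral>\<^sup>+y. \<integral>\<^sup>+x. f (Complex x y) \<partial>lborel \<partial>lborel)"
    unfolding * by (subst lborel_pair.nn_integral_snd[symmetric]) simp_all
  show "(\<integral>\<^sup>+z. f z \<partial>(lborel :: complex measure)) = (\<integral>\<^sup>+x. \<integral>\<^sup>+y. f (Complex x y) \<partial>lborel \<partial>lborel)"
    unfolding * by (subst lborel.nn_integral_fst[symmetric]) simp_all
qed

lemma nn_integral_real_affine':
  fixes c :: real
  assumes "f \<in> borel_measurable borel" "c \<noteq> 0"
  shows "(\<integral>\<^sup>+x. f (t + c * x) \<partial>lborel) = ennreal (1 / \<bar>c\<bar>) * (\<integral>\<^sup>+x. f x \<partial>lborel)"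
proof -
  have "ennreal (1 / \<bar>c\<bar>) * (\<integral>\<^sup>+x. f x \<partial>lborel) = ennreal (1 / \<bar>c\<bar>) * (ennreal \<bar>c\<bar> * (\<integral>\<^sup>+x. f (t + c * x) \<partial>lborel))"
    using nn_integral_real_affine[OF assms, of t] by simp
  also have "\<dots> = ennreal (1 / \<bar>c\<bar> * \<bar>c\<bar>) * (\<integral>\<^sup>+x. f (t + c * x) \<partial>lborel)"
    by (simp add: mult.assoc[symmetric] ennreal_mult'[symmetric])
  finally show ?thesis using assms by simp
qed

text \<open>If \<open>p \<noteq> 0\<close>, one elimination step with second pivot
  \<open>\<delta>\<close> reduces the claim to two affine substitutions in a single real variable,
  separated by Fubini; if \<open>p = 0\<close>, the matrix is already triangular up to the order of
  the variables.\<close>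

lemma nn_integral_complex_linear:
  fixes f :: "complex \<Rightarrow> ennreal"
  assumes [measurable]: "f \<in> borel_measurable borel" and det: "p * s - q * r \<noteq> 0"
  shows "(\<integral>\<^sup>+z. f (Complex (p * Re z + q * Im z) (r * Re z + s * Im z)) \<partial>lborel) =
    ennreal (1 / \<bar>p * s - q * r\<bar>) * (\<integral>\<^sup>+z. f z \<partial>lborel)"
proof (cases "p = 0")
  case False
  define \<delta> where "\<delta> = (p * s - q * r) / p"
  have d0: "\<delta> \<noteq> 0" using det False by (simp add: \<delta>_def)
  have "(\<integral>\<^sup>+z. f (Complex (p * Re z + q * Im z) (r * Re z + s * Im z)) \<partial>lborel) =
      (\<integral>\<^sup>+y. \<integral>\<^sup>+x. f (Complex (p * x + q * y) (r * x + s * y)) \<partial>lborel \<partial>lborel)"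
    by (subst nn_integral_complex(1)) simp_all
  also have "\<dots> = (\<integral>\<^sup>+y. \<integral>\<^sup>+x. f (Complex (q * y + p * x) (r / p * (q * y + p * x) + \<delta> * y)) \<partial>lborel \<partial>lborel)"
  proof (intro nn_integral_cong)
    fix x y :: real
    have "r * x + s * y = r / p * (q * y + p * x) + \<delta> * y" using False by (simp add: \<delta>_def field_simps)
    then show "f (Complex (p * x + q * y) (r * x + s * y)) = f (Complex (q * y + p * x) (r / p * (q * y + p * x) + \<delta> * y))"
      by (simp add: add.commute)
  qed
  also have "\<dots> = (\<integral>\<^sup>+y. ennreal (1 / \<bar>p\<bar>) * (\<integral>\<^sup>+x. f (Complex x (r / p * x + \<delta> * y)) \<partial>lborel) \<partial>lborel)"
    by (intro nn_integral_cong nn_integral_real_affine'[where f = "\<lambda>x. f (Complex x (r / p * x + \<delta> * y))" for y] False) measurable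
  also have "\<dots> = ennreal (1 / \<bar>p\<bar>) * (\<integral>\<^sup>+y. \<integral>\<^sup>+x. f (Complex x (r / p * x + \<delta> * y)) \<partial>lborel \<partial>lborel)"
    by (rule nn_integral_cmult) measurable
  also have "(\<integral>\<^sup>+y. \<integral>\<^sup>+x. f (Complex x (r / p * x + \<delta> * y)) \<partial>lborel \<partial>lborel) =
      (\<integral>\<^sup>+x. \<integral>\<^sup>+y. f (Complex x (r / p * x + \<delta> * y)) \<partial>lborel \<partial>lborel)"
    by (rule lborel_pair.Fubini') measurable
  also have "\<dots> = (\<integral>\<^sup>+x. ennreal (1 / \<bar>\<delta>\<bar>) * (\<integral>\<^sup>+y. f (Complex x y) \<partial>lborel) \<partial>lborel)"
    by (intro nn_integral_cong nn_integral_real_affine'[where f = "\<lambda>y. f (Complex x y)" for x] d0) measurable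
  also have "\<dots> = ennreal (1 / \<bar>\<delta>\<bar>) * (\<integral>\<^sup>+x. (\<integral>\<^sup>+y. f (Complex x y) \<partial>lborel) \<partial>lborel)"
    by (rule nn_integral_cmult) measurable
  also have "\<dots> = ennreal (1 / \<bar>\<delta>\<bar>) * (\<integral>\<^sup>+z. f z \<partial>lborel)"
    by (subst nn_integral_complex(2)) simp_all
  also have "ennreal (1 / \<bar>p\<bar>) * (ennreal (1 / \<bar>\<delta>\<bar>) * (\<integral>\<^sup>+z. f z \<partial>lborel)) = ennreal (1 / \<bar>p * s - q * r\<bar>) * (\<integral>\<^sup>+z. f z \<partial>lborel)"
    using False by (simp add: mult.assoc[symmetric] ennreal_mult'[symmetric] \<delta>_def abs_divide)
  finally show ?thesis .
next
  case True
  then have qr: "q \<noteq> 0" "r \<noteq> 0" using det by auto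
  have "(\<integral>\<^sup>+z. f (Complex (p * Re z + q * Im z) (r * Re z + s * Im z)) \<partial>lborel) =
      (\<integral>\<^sup>+y. \<integral>\<^sup>+x. f (Complex (0 + q * y) (s * y + r * x)) \<partial>lborel \<partial>lborel)"
    using True by (subst nn_integral_complex(1)) (simp_all add: add.commute)
  also have "\<dots> = (\<integral>\<^sup>+y. ennreal (1 / \<bar>r\<bar>) * (\<integral>\<^sup>+x. f (Complex (0 + q * y) x) \<partial>lborel) \<partial>lborel)"
    by (intro nn_integral_cong nn_integral_real_affine'[where f = "\<lambda>x. f (Complex (0 + q * y) x)" for y] qr) measurable
  also have "\<dots> = ennreal (1 / \<bar>r\<bar>) * (\<integral>\<^sup>+y. (\<integral>\<^sup>+x. f (Complex (0 + q * y) x) \<partial>lborel) \<partial>lborel)"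
    by (rule nn_integral_cmult) measurable
  also have "(\<integral>\<^sup>+y. (\<integral>\<^sup>+x. f (Complex (0 + q * y) x) \<partial>lborel) \<partial>lborel) = ennreal (1 / \<bar>q\<bar>) * (\<integral>\<^sup>+y. (\<integral>\<^sup>+x. f (Complex y x) \<partial>lborel) \<partial>lborel)"
    by (rule nn_integral_real_affine'[where f = "\<lambda>y. \<integral>\<^sup>+x. f (Complex y x) \<partial>lborel"]) (use qr in measurable)
  also have "(\<integral>\<^sup>+y. (\<integral>\<^sup>+x. f (Complex y x) \<partial>lborel) \<partial>lborel) = (\<integral>\<^sup>+z. f z \<partial>lborel)"
    by (subst nn_integral_complex(2)) simp_all
  also have "ennreal (1 / \<bar>r\<bar>) * (ennreal (1 / \<bar>q\<bar>) * (\<integral>\<^sup>+z. f z \<partial>lborel)) = ennreal (1 / \<bar>r\<bar> * (1 / \<bar>q\<bar>)) * (\<integral>\<^sup>+z. f z \<partial>lborel)"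
    by (simp only: mult.assoc[symmetric] ennreal_mult' divide_nonneg_nonneg abs_ge_zero zero_le_one)
  also have "1 / \<bar>r\<bar> * (1 / \<bar>q\<bar>) = 1 / \<bar>p * s - q * r\<bar>"
    using True by (simp add: abs_mult)
  finally show ?thesis .
qed

lemma nn_integral_complex_affine:
  fixes f :: "complex \<Rightarrow> ennreal"
  assumes [measurable]: "f \<in> borel_measurable borel" and l: "l \<noteq> 0"
  shows "(\<integral>\<^sup>+z. f (l * z + b) \<partial>lborel) = ennreal (1 / (cmod l)\<^sup>2) * (\<integral>\<^sup>+z. f z \<partial>lborel)"
proof -
  have d: "Re l * Re l - (- Im l) * Im l = (cmod l)\<^sup>2" unfolding cmod_power2 by (simp add: power2_eq_square)
  have e: "l * z = Complex (Re l * Re z + (- Im l) * Im z) (Im l * Re z + Re l * Im z)" for z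
    by (simp add: complex_eq_iff)
  have "(\<integral>\<^sup>+z. f (l * z + b) \<partial>lborel) = ennreal (1 / \<bar>Re l * Re l - (- Im l) * Im l\<bar>) * (\<integral>\<^sup>+z. f (z + b) \<partial>lborel)"
    unfolding e by (rule nn_integral_complex_linear[where f = "\<lambda>z. f (z + b)"]) (use l d in auto)
  also have "(\<integral>\<^sup>+z. f (z + b) \<partial>lborel) = (\<integral>\<^sup>+z. f z \<partial>distr lborel borel ((+) b))"
    by (subst nn_integral_distr) (simp_all add: add.commute)
  finally show ?thesis unfolding d lborel_distr_plus by simp
qed

lemma nn_integral_complex_cnj:
  fixes f :: "complex \<Rightarrow> ennreal"
  assumes "f \<in> borel_measurable borel"
  shows "(\<integral>\<^sup>+z. f (cnj z) \<partial>lborel) = (\<integral>\<^sup>+z. f z \<partial>lborel)"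
proof -
  have e: "cnj z = Complex (1 * Re z + 0 * Im z) (0 * Re z + (- 1) * Im z)" for z
    by (simp add: complex_eq_iff)
  show ?thesis unfolding e by (subst nn_integral_complex_linear[OF assms]) auto
qed

text \<open>The substitution \<open>t = exp s\<close> is made on the compact intervals from
  \<open>exp (- n)\<close> to \<open>exp n\<close>, and monotone convergence removes the cut. For
  \<open>t \<le> 0\<close> the weight is 0, because \<open>ennreal\<close> sends negative numbers to
  0 and \<open>1 / 0 = 0\<close>.\<close>

lemma nn_integral_dt_over_t:
  fixes h :: "real \<Rightarrow> ennreal"
  assumes [measurable]: "h \<in> borel_measurable borel"
  shows "(\<integral>\<^sup>+t. h t * ennreal (1 / t) \<partial>lborel) = (\<integral>\<^sup>+s. h (exp s) \<partial>lborel)"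
proof -
  have step: "(\<integral>\<^sup>+t. h t * ennreal (1 / t) * indicator {exp (- real n)..exp (real n)} t \<partial>lborel) =
      (\<integral>\<^sup>+s. h (exp s) * indicator {- real n..real n} s \<partial>lborel)" for n
  proof (cases "n = 0")
    case True
    have "(\<integral>\<^sup>+t. h t * ennreal (1 / t) * indicator {1::real} t \<partial>lborel) = 0"
      "(\<integral>\<^sup>+s. h (exp s) * indicator {0::real} s \<partial>lborel) = 0"
      by (simp_all add: nn_integral_indicator_singleton')
    then show ?thesis using True by simp
  next
    case False
    have "(\<integral>\<^sup>+t. (h t * ennreal (1 / t)) * indicator {exp (- real n)..exp (real n)} t \<partial>lborel) =
      (\<integral>\<^sup>+s. (h (exp s) * ennreal (1 / exp s)) * ennreal (exp s) * indicator {- real n..real n} s \<partial>lborel)"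
      by (rule nn_integral_substitution_aux)
         (use False in \<open>auto intro!: derivative_eq_intros continuous_intros\<close>)
    also have "\<dots> = (\<integral>\<^sup>+s. h (exp s) * indicator {- real n..real n} s \<partial>lborel)"
      by (intro nn_integral_cong) (simp add: mult.assoc ennreal_mult'[symmetric])
    finally show ?thesis .
  qed
  have ind: "indicator A x \<le> (indicator B x :: ennreal)" if "A \<subseteq> B" for A B :: "real set" and x
    using that by (auto simp: indicator_def)
  have mono1: "indicator {exp (- real n)..exp (real n)} t \<le> (indicator {exp (- real m)..exp (real m)} t :: ennreal)"
    if "n \<le> m" for n m t
  proof -
    have "exp (- real m) \<le> exp (- real n)" "exp (real n) \<le> exp (real m)" using that by auto
    then have "{exp (- real n)..exp (real n)} \<subseteq> {exp (- real m)..exp (real m)}"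
      by (simp only: atLeastatMost_subset_iff) simp
    then show ?thesis by (rule ind)
  qed
  have mono2: "indicator {- real n..real n} t \<le> (indicator {- real m..real m} t :: ennreal)" if "n \<le> m" for n m t
    using that by (auto split: split_indicator)
  have sup1: "(SUP n. h t * ennreal (1 / t) * indicator {exp (- real n)..exp (real n)} t) = h t * ennreal (1 / t)" for t
  proof (cases "t > 0")
    case True
    obtain n :: nat where n: "real n \<ge> \<bar>ln t\<bar>" using real_arch_simple by blast
    have "exp (- real n) \<le> exp (ln t)" "exp (ln t) \<le> exp (real n)" using n by (auto simp only: exp_le_cancel_iff)
    then have "t \<in> {exp (- real n)..exp (real n)}" using True by simp
    then have "h t * ennreal (1 / t) \<le> (SUP n. h t * ennreal (1 / t) * indicator {exp (- real n)..exp (real n)} t)"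
      by (intro SUP_upper2[of n]) auto
    then show ?thesis by (intro antisym SUP_least) (auto split: split_indicator)
  qed (auto simp: ennreal_neg divide_nonpos_nonpos)
  have sup2: "(SUP n. h (exp s) * indicator {- real n..real n} s) = h (exp s)" for s
  proof -
    obtain n :: nat where n: "real n \<ge> \<bar>s\<bar>" using real_arch_simple by blast
    then have "s \<in> {- real n..real n}" by auto
    then have "h (exp s) \<le> (SUP n. h (exp s) * indicator {- real n..real n} s)"
      by (intro SUP_upper2[of n]) auto
    then show ?thesis by (intro antisym SUP_least) (auto split: split_indicator)
  qed
  have "(\<integral>\<^sup>+t. h t * ennreal (1 / t) \<partial>lborel) =
      (\<integral>\<^sup>+t. (SUP n. h t * ennreal (1 / t) * indicator {exp (- real n)..exp (real n)} t) \<partial>lborel)"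
    by (simp add: sup1)
  also have "\<dots> = (SUP n. \<integral>\<^sup>+t. h t * ennreal (1 / t) * indicator {exp (- real n)..exp (real n)} t \<partial>lborel)"
    by (rule nn_integral_monotone_convergence_SUP) (auto intro!: incseq_SucI le_funI mult_left_mono mono1)
  also have "\<dots> = (SUP n. \<integral>\<^sup>+s. h (exp s) * indicator {- real n..real n} s \<partial>lborel)"
    by (simp only: step)
  also have "\<dots> = (\<integral>\<^sup>+s. (SUP n. h (exp s) * indicator {- real n..real n} s) \<partial>lborel)"
    by (rule nn_integral_monotone_convergence_SUP[symmetric]) (auto intro!: incseq_SucI le_funI mult_left_mono mono2)
  finally show ?thesis by (simp add: sup2)
qed

text \<open>In the variable \<open>ln t\<close> the map is the reflection
  \<open>s \<mapsto> - ln c - s\<close>.\<close>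

lemma nn_integral_dt_over_t_inverse:
  fixes h :: "real \<Rightarrow> ennreal"
  assumes [measurable]: "h \<in> borel_measurable borel" and c: "c > 0"
  shows "(\<integral>\<^sup>+t. h (1 / (c * t)) * ennreal (1 / t) \<partial>lborel) = (\<integral>\<^sup>+t. h t * ennreal (1 / t) \<partial>lborel)"
proof -
  have "(\<integral>\<^sup>+t. h (1 / (c * t)) * ennreal (1 / t) \<partial>lborel) = (\<integral>\<^sup>+s. h (1 / (c * exp s)) \<partial>lborel)"
    by (rule nn_integral_dt_over_t) simp
  also have "\<dots> = (\<integral>\<^sup>+s. h (exp (- ln c + (- 1) * s)) \<partial>lborel)"
    by (intro nn_integral_cong) (use c in \<open>simp add: exp_diff exp_minus field_simps\<close>)
  also have "\<dots> = (\<integral>\<^sup>+s. h (exp s) \<partial>lborel)"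
    by (subst nn_integral_real_affine'[where f = "\<lambda>s. h (exp s)"]) auto
  also have "\<dots> = (\<integral>\<^sup>+t. h t * ennreal (1 / t) \<partial>lborel)"
    by (rule nn_integral_dt_over_t[symmetric]) simp
  finally show ?thesis .
qed

section \<open>Integration against the hyperbolic volume\<close>

lemma measurable_complex_real [measurable (raw)]:
  assumes "f \<in> borel_measurable M"
  shows "(\<lambda>x. fst (f x :: complex \<times> real)) \<in> borel_measurable M" "(\<lambda>x. snd (f x :: complex \<times> real)) \<in> borel_measurable M"
  by (rule measurable_compose[OF assms], simp add: borel_measurable_continuous_onI continuous_on_fst continuous_on_snd)+

lemma measurable_cnj [measurable (raw)]:
  assumes "f \<in> borel_measurable M"
  shows "(\<lambda>x. cnj (f x)) \<in> borel_measurable M"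
  by (rule measurable_compose[OF assms], intro borel_measurable_continuous_onI continuous_intros)

text \<open>The truncation of \<open>ennreal\<close> makes the weight vanish at heights
  \<open>t \<le> 0\<close>, so this is the integral over \<open>H3\<close> although the measure is
  that of the whole product.\<close>

definition hyp_integral :: "(complex \<times> real \<Rightarrow> ennreal) \<Rightarrow> ennreal" where
  "hyp_integral f = (\<integral>\<^sup>+p. f p * ennreal (1 / snd p ^ 3) \<partial>lborel)"

lemma weight_neg: "t \<le> 0 \<Longrightarrow> ennreal (1 / t ^ 3) = 0" for t :: real
  by (rule ennreal_neg) (simp add: divide_nonneg_nonpos power_le_zero_eq)

lemma hyp_integral_cong:
  assumes "\<And>z t. t > 0 \<Longrightarrow> f (z, t) = g (z, t)"
  shows "hyp_integral f = hyp_integral g"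
  unfolding hyp_integral_def
proof (rule nn_integral_cong)
  fix p :: "complex \<times> real"
  show "f p * ennreal (1 / snd p ^ 3) = g p * ennreal (1 / snd p ^ 3)"
    using assms[of "snd p" "fst p"] weight_neg[of "snd p"] by (cases "snd p > 0") auto
qed

lemma hyp_integral_Fubini:
  assumes [measurable]: "f \<in> borel_measurable borel"
  shows "hyp_integral f = (\<integral>\<^sup>+t. (\<integral>\<^sup>+z. f (z, t) \<partial>lborel) * ennreal (1 / t ^ 3) \<partial>lborel)"
proof -
  have [measurable]: "(\<lambda>p. f p * ennreal (1 / snd p ^ 3)) \<in> borel_measurable (lborel \<Otimes>\<^sub>M lborel)"
    unfolding lborel_prod by measurable
  show ?thesis
    unfolding hyp_integral_def lborel_prod[symmetric]
    by (subst lborel_pair.nn_integral_snd[symmetric]) (simp_all add: nn_integral_multc)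
qed

text \<open>The plane contributes the square of \<open>|l|\<close> and the height one more factor,
  which cancel against the cube in the weight.\<close>

lemma hyp_integral_affine:
  assumes [measurable]: "f \<in> borel_measurable borel" and l: "l \<noteq> 0"
  shows "hyp_integral (\<lambda>p. f (l * fst p + b, cmod l * snd p)) = hyp_integral f"
proof -
  define r where "r = cmod l"
  have r: "r > 0" using l by (simp add: r_def)
  have "hyp_integral (\<lambda>p. f (l * fst p + b, r * snd p)) =
      (\<integral>\<^sup>+t. (\<integral>\<^sup>+z. f (l * z + b, r * t) \<partial>lborel) * ennreal (1 / t ^ 3) \<partial>lborel)"
    by (subst hyp_integral_Fubini) simp_all
  also have "\<dots> = (\<integral>\<^sup>+t. (ennreal r * ((\<integral>\<^sup>+z. f (z, 0 + r * t) \<partial>lborel) * ennreal (1 / (0 + r * t) ^ 3))) \<partial>lborel)"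
  proof (rule nn_integral_cong)
    fix t :: real
    have "(\<integral>\<^sup>+z. f (l * z + b, r * t) \<partial>lborel) = ennreal (1 / r\<^sup>2) * (\<integral>\<^sup>+z. f (z, r * t) \<partial>lborel)"
      unfolding r_def by (rule nn_integral_complex_affine[where f = "\<lambda>z. f (z, cmod l * t)"]) (use l in simp_all)
    moreover have "ennreal (1 / r\<^sup>2) * ennreal (1 / t ^ 3) = ennreal r * ennreal (1 / (r * t) ^ 3)"
      using r by (simp add: ennreal_mult'[symmetric] power_mult_distrib field_simps power2_eq_square power3_eq_cube)
    ultimately show "(\<integral>\<^sup>+z. f (l * z + b, r * t) \<partial>lborel) * ennreal (1 / t ^ 3) =
        ennreal r * ((\<integral>\<^sup>+z. f (z, 0 + r * t) \<partial>lborel) * ennreal (1 / (0 + r * t) ^ 3))"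
      by (simp only: add_0 mult.assoc mult.left_commute[of "ennreal (1 / r\<^sup>2)"] mult.left_commute[of "ennreal r"])
  qed
  also have "\<dots> = ennreal r * (\<integral>\<^sup>+t. ((\<integral>\<^sup>+z. f (z, 0 + r * t) \<partial>lborel) * ennreal (1 / (0 + r * t) ^ 3)) \<partial>lborel)"
    by (rule nn_integral_cmult) measurable
  also have "\<dots> = ennreal r * (ennreal (1 / \<bar>r\<bar>) * (\<integral>\<^sup>+t. (\<integral>\<^sup>+z. f (z, t) \<partial>lborel) * ennreal (1 / t ^ 3) \<partial>lborel))"
    by (subst nn_integral_real_affine'[where f = "\<lambda>t. (\<integral>\<^sup>+z. f (z, t) \<partial>lborel) * ennreal (1 / t ^ 3)"]) (use r in \<open>simp_all\<close>)
  also have "\<dots> = hyp_integral f"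
    using r by (simp add: hyp_integral_Fubini mult.assoc[symmetric] ennreal_mult'[symmetric])
  finally show ?thesis by (simp add: r_def)
qed

text \<open>In the coordinates \<open>(w, t) = (z / t, t)\<close> the hyperbolic volume is \<open>dw dt / t\<close>, and inversion in the
  unit sphere acts on each vertical line as \<open>t \<mapsto> 1 / ((1 + |w|\<^sup>2) t)\<close>.\<close>

lemma hyp_integral_cone_coords:
  assumes [measurable]: "f \<in> borel_measurable borel"
  shows "hyp_integral f = (\<integral>\<^sup>+w. \<integral>\<^sup>+t. f (of_real t * w, t) * ennreal (1 / t) \<partial>lborel \<partial>lborel)"
proof -
  have "hyp_integral f = (\<integral>\<^sup>+t. (\<integral>\<^sup>+w. f (of_real t * w, t) \<partial>lborel) * ennreal (1 / t) \<partial>lborel)"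
    unfolding hyp_integral_Fubini[OF assms]
  proof (rule nn_integral_cong)
    fix t :: real
    show "(\<integral>\<^sup>+z. f (z, t) \<partial>lborel) * ennreal (1 / t ^ 3) = (\<integral>\<^sup>+w. f (of_real t * w, t) \<partial>lborel) * ennreal (1 / t)"
    proof (cases "t > 0")
      case True
      have "(\<integral>\<^sup>+w. f (of_real t * w + 0, t) \<partial>lborel) = ennreal (1 / (cmod (of_real t))\<^sup>2) * (\<integral>\<^sup>+z. f (z, t) \<partial>lborel)"
        by (rule nn_integral_complex_affine[where f = "\<lambda>z. f (z, t)"]) (use True in simp_all)
      moreover have "ennreal (1 / t ^ 3) = ennreal (1 / t) * ennreal (1 / t\<^sup>2)"
        using True by (simp add: ennreal_mult'[symmetric] power2_eq_square power3_eq_cube)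
      ultimately show ?thesis using True by (simp add: mult_ac)
    qed (simp add: weight_neg ennreal_neg divide_nonneg_nonpos)
  qed
  also have "\<dots> = (\<integral>\<^sup>+t. \<integral>\<^sup>+w. f (of_real t * w, t) * ennreal (1 / t) \<partial>lborel \<partial>lborel)"
    by (intro nn_integral_cong nn_integral_multc[symmetric]) measurable
  also have "\<dots> = (\<integral>\<^sup>+w. \<integral>\<^sup>+t. f (of_real t * w, t) * ennreal (1 / t) \<partial>lborel \<partial>lborel)"
    by (rule lborel_pair.Fubini') measurable
  finally show ?thesis .
qed

text \<open>The map extends \<open>z \<mapsto> 1 / z\<close>: it is the inversion in the unit sphere
  followed by conjugation. The conjugation only changes the direction \<open>w\<close>, whence the
  last substitution.\<close>

lemma hyp_integral_inversion:
  assumes [measurable]: "f \<in> borel_measurable borel"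
  shows "hyp_integral (\<lambda>p. f (cnj (fst p) / of_real ((cmod (fst p))\<^sup>2 + (snd p)\<^sup>2), snd p / ((cmod (fst p))\<^sup>2 + (snd p)\<^sup>2))) = hyp_integral f"
    (is "hyp_integral ?g = _")
proof -
  have "hyp_integral ?g = (\<integral>\<^sup>+w. \<integral>\<^sup>+t. ?g (of_real t * w, t) * ennreal (1 / t) \<partial>lborel \<partial>lborel)"
    by (rule hyp_integral_cone_coords) measurable
  also have "\<dots> = (\<integral>\<^sup>+w. \<integral>\<^sup>+t. f (of_real t * cnj w, t) * ennreal (1 / t) \<partial>lborel \<partial>lborel)"
  proof (rule nn_integral_cong)
    fix w :: complex
    define c where "c = 1 + (cmod w)\<^sup>2"
    have c: "c > 0" unfolding c_def by (rule add_pos_nonneg) auto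
    define h where "h s = f (of_real s * cnj w, s)" for s
    have [measurable]: "h \<in> borel_measurable borel" unfolding h_def by measurable
    have "(\<integral>\<^sup>+t. ?g (of_real t * w, t) * ennreal (1 / t) \<partial>lborel) = (\<integral>\<^sup>+t. h (1 / (c * t)) * ennreal (1 / t) \<partial>lborel)"
    proof (rule nn_integral_cong)
      fix t :: real
      show "?g (of_real t * w, t) * ennreal (1 / t) = h (1 / (c * t)) * ennreal (1 / t)"
      proof (cases "t > 0")
        case True
        have rho: "(cmod (of_real t * w))\<^sup>2 + t\<^sup>2 = c * t * t"
          by (simp add: norm_mult power_mult_distrib c_def algebra_simps power2_eq_square)
        have "?g (of_real t * w, t) = h (1 / (c * t))"
          unfolding fst_conv snd_conv rho h_def using True c by (simp add: field_simps)
        then show ?thesis by simp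
      qed (simp add: ennreal_neg divide_nonneg_nonpos)
    qed
    also have "\<dots> = (\<integral>\<^sup>+t. h t * ennreal (1 / t) \<partial>lborel)"
      by (rule nn_integral_dt_over_t_inverse) (use c in simp_all)
    finally show "(\<integral>\<^sup>+t. ?g (of_real t * w, t) * ennreal (1 / t) \<partial>lborel) = (\<integral>\<^sup>+t. f (of_real t * cnj w, t) * ennreal (1 / t) \<partial>lborel)"
      by (simp add: h_def)
  qed
  also have "\<dots> = (\<integral>\<^sup>+w. \<integral>\<^sup>+t. f (of_real t * w, t) * ennreal (1 / t) \<partial>lborel \<partial>lborel)"
    by (rule nn_integral_complex_cnj[where f = "\<lambda>w. \<integral>\<^sup>+t. f (of_real t * w, t) * ennreal (1 / t) \<partial>lborel"]) measurable
  also have "\<dots> = hyp_integral f" by (rule hyp_integral_cone_coords[symmetric]) simp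
  finally show ?thesis .
qed

lemma hyp_act_measurable [measurable]: "hyp_act A \<in> borel_measurable borel"
proof -
  have "hyp_act A = (\<lambda>p. (((A $ 1 $ 1 * fst p + A $ 1 $ 2) * cnj (A $ 2 $ 1 * fst p + A $ 2 $ 2) + A $ 1 $ 1 * cnj (A $ 2 $ 1) * of_real ((snd p)\<^sup>2)) /
     of_real ((cmod (A $ 2 $ 1 * fst p + A $ 2 $ 2))\<^sup>2 + (cmod (A $ 2 $ 1))\<^sup>2 * (snd p)\<^sup>2),
     snd p / ((cmod (A $ 2 $ 1 * fst p + A $ 2 $ 2))\<^sup>2 + (cmod (A $ 2 $ 1))\<^sup>2 * (snd p)\<^sup>2)))"
    by (simp only: fun_eq_iff hyp_act_def Let_def split_beta split_paired_all) simp
  then show ?thesis by (simp only:) measurable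
qed

text \<open>Bruhat decomposition: an upper triangular matrix acts by a similarity, and any other one
  is a translation by \<open>d / c\<close>, an inversion and a further similarity.\<close>

lemma hyp_integral_hyp_act:
  assumes [measurable]: "f \<in> borel_measurable borel" and det: "det A = 1"
  shows "hyp_integral (\<lambda>p. f (hyp_act A p)) = hyp_integral f"
proof -
  define a b c d where abcd: "a = A $ 1 $ 1" "b = A $ 1 $ 2" "c = A $ 2 $ 1" "d = A $ 2 $ 2"
  have ad: "a * d - b * c = 1" using det by (simp add: det_2 abcd)
  show ?thesis
  proof (cases "c = 0")
    case True
    then have d: "d = 1 / a" "a \<noteq> 0" using ad by (auto simp: eq_divide_eq mult.commute)
    have "hyp_integral (\<lambda>p. f (hyp_act A p)) = hyp_integral (\<lambda>p. f (a\<^sup>2 * fst p + a * b, cmod (a\<^sup>2) * snd p))"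
    proof (rule hyp_integral_cong)
      fix z :: complex and t :: real assume "t > 0"
      have "(a * z + b) * cnj d / of_real ((cmod d)\<^sup>2) = a\<^sup>2 * z + a * b"
        unfolding complex_norm_square using d by (simp add: power2_eq_square algebra_simps)
      moreover have "t / (cmod d)\<^sup>2 = cmod (a\<^sup>2) * t"
        using d by (simp add: norm_divide norm_power power_divide)
      ultimately have "hyp_act A (z, t) = (a\<^sup>2 * z + a * b, cmod (a\<^sup>2) * t)"
        using True by (simp add: hyp_act_def Let_def abcd[symmetric])
      then show "f (hyp_act A (z, t)) = f (a\<^sup>2 * fst (z, t) + a * b, cmod (a\<^sup>2) * snd (z, t))" by simp
    qed
    also have "\<dots> = hyp_integral f" by (rule hyp_integral_affine) (use d in simp_all)
    finally show ?thesis .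
  next
    case False
    \<comment> \<open>From
      \<open>(a z + b) / (c z + d) = a / c - 1 / (c\<^sup>2 (z + d / c))\<close> for determinant
      1.\<close>
    define l where "l = - 1 / c\<^sup>2"
    define g where "g p = f (l * fst p + a / c, cmod l * snd p)" for p
    define h where "h p = g (cnj (fst p) / of_real ((cmod (fst p))\<^sup>2 + (snd p)\<^sup>2), snd p / ((cmod (fst p))\<^sup>2 + (snd p)\<^sup>2))" for p :: "complex \<times> real"
    have l: "l \<noteq> 0" "cmod l = 1 / (cmod c)\<^sup>2" using False by (auto simp: l_def norm_divide norm_power)
    have gm [measurable]: "g \<in> borel_measurable borel" unfolding g_def by measurable
    have hm [measurable]: "h \<in> borel_measurable borel" unfolding h_def by measurable
    have "hyp_integral (\<lambda>p. f (hyp_act A p)) = hyp_integral (\<lambda>p. h (1 * fst p + d / c, cmod 1 * snd p))"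
    proof (rule hyp_integral_cong)
      fix z :: complex and t :: real assume t: "t > 0"
      define z1 where "z1 = z + d / c"
      define \<rho> where "\<rho> = (cmod z1)\<^sup>2 + t\<^sup>2"
      have rho: "\<rho> > 0" unfolding \<rho>_def using t by (intro add_nonneg_pos) auto
      have cz: "c * z + d = c * z1" using False by (simp add: z1_def field_simps)
      have N: "(cmod (c * z + d))\<^sup>2 + (cmod c)\<^sup>2 * t\<^sup>2 = (cmod c)\<^sup>2 * \<rho>"
        unfolding cz by (simp add: norm_mult power_mult_distrib \<rho>_def algebra_simps)
      have az: "a * z + b = a * z1 - 1 / c"
      proof -
        have "c * (a * z + b) = c * (a * z1 - 1 / c)" using False ad by (simp add: z1_def field_simps)
        then show ?thesis using False by simp
      qed
      have rc: "complex_of_real \<rho> = z1 * cnj z1 + (of_real t)\<^sup>2"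
        by (simp add: \<rho>_def complex_norm_square[symmetric])
      have num: "(a * z + b) * cnj (c * z + d) + a * cnj c * of_real (t\<^sup>2) = a * cnj c * of_real \<rho> - cnj c * cnj z1 / c"
        unfolding az cz rc by (simp add: algebra_simps)
      have cc: "complex_of_real ((cmod c)\<^sup>2) = c * cnj c" by (rule complex_norm_square)
      have "(a * cnj c * of_real \<rho> - cnj c * cnj z1 / c) / (c * cnj c * of_real \<rho>) = l * (cnj z1 / of_real \<rho>) + a / c"
        using False rho by (simp add: l_def field_simps power2_eq_square)
      moreover have "t / ((cmod c)\<^sup>2 * \<rho>) = cmod l * (t / \<rho>)" unfolding l by simp
      ultimately have "hyp_act A (z, t) = (l * (cnj z1 / of_real \<rho>) + a / c, cmod l * (t / \<rho>))"
        unfolding hyp_act_def Let_def split abcd[symmetric] N num of_real_mult cc by simp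
      then show "f (hyp_act A (z, t)) = h (1 * fst (z, t) + d / c, cmod 1 * snd (z, t))"
        by (simp add: h_def g_def z1_def[symmetric] \<rho>_def)
    qed
    also have "\<dots> = hyp_integral h" by (rule hyp_integral_affine) simp_all
    also have "\<dots> = hyp_integral g" unfolding h_def by (rule hyp_integral_inversion) simp
    also have "\<dots> = hyp_integral f" unfolding g_def by (rule hyp_integral_affine) (use l in simp_all)
    finally show ?thesis .
  qed
qed

section \<open>Discrete groups\<close>

lemma H3_borel [measurable]: "H3 \<in> sets borel"
proof -
  have "H3 = {p :: complex \<times> real. snd p > 0}" by (auto simp: H3_def)
  also have "\<dots> \<in> sets borel" by measurable
  finally show ?thesis .
qed

lemma sets_hyp_volume: "S \<in> sets hyp_volume \<longleftrightarrow> S \<in> sets borel \<and> S \<subseteq> H3"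
  by (auto simp: hyp_volume_def sets_restrict_space_iff)

lemma space_hyp_volume [simp]: "space hyp_volume = H3"
  by (simp add: hyp_volume_def space_restrict_space)

lemma emeasure_hyp_volume:
  assumes "S \<in> sets borel" "S \<subseteq> H3"
  shows "emeasure hyp_volume S = hyp_integral (indicator S)"
proof -
  have w: "(\<lambda>(z, t). ennreal (1 / t ^ 3)) = (\<lambda>p :: complex \<times> real. ennreal (1 / snd p ^ 3))" by auto
  have "emeasure hyp_volume S = (\<integral>\<^sup>+p. ennreal (1 / snd p ^ 3) * indicator S p \<partial>restrict_space lborel H3)"
    unfolding hyp_volume_def w using assms
    by (subst emeasure_density) (auto simp: sets_restrict_space_iff intro!: measurable_restrict_space1)
  also have "\<dots> = (\<integral>\<^sup>+p. ennreal (1 / snd p ^ 3) * indicator S p * indicator H3 p \<partial>lborel)"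
    by (rule nn_integral_restrict_space) simp
  also have "\<dots> = hyp_integral (indicator S)"
    unfolding hyp_integral_def using assms(2)
    by (intro nn_integral_cong) (auto split: split_indicator)
  finally show ?thesis .
qed

lemma hyp_act_vimage:
  assumes "det A = 1" "S \<in> sets hyp_volume"
  shows "{p \<in> H3. hyp_act A p \<in> S} \<in> sets hyp_volume"
    and "emeasure hyp_volume {p \<in> H3. hyp_act A p \<in> S} = emeasure hyp_volume S"
proof -
  have S [measurable]: "S \<in> sets borel" "S \<subseteq> H3" using assms(2) by (auto simp: sets_hyp_volume)
  have b: "{p \<in> H3. hyp_act A p \<in> S} \<in> sets borel" by measurable
  then show "{p \<in> H3. hyp_act A p \<in> S} \<in> sets hyp_volume" by (auto simp: sets_hyp_volume)
  have "emeasure hyp_volume {p \<in> H3. hyp_act A p \<in> S} = hyp_integral (indicator {p \<in> H3. hyp_act A p \<in> S})"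
    by (rule emeasure_hyp_volume[OF b]) auto
  also have "\<dots> = hyp_integral (\<lambda>p. indicator S (hyp_act A p))"
    by (rule hyp_integral_cong) (auto simp: mem_H3 split: split_indicator)
  also have "\<dots> = hyp_integral (indicator S)" by (rule hyp_integral_hyp_act) (use assms in simp_all)
  also have "\<dots> = emeasure hyp_volume S" by (rule emeasure_hyp_volume[symmetric]) (use S in auto)
  finally show "emeasure hyp_volume {p \<in> H3. hyp_act A p \<in> S} = emeasure hyp_volume S" .
qed

lemma hyp_act_image_eq:
  assumes "det A = 1" "S \<subseteq> H3"
  shows "hyp_act A ` S = {p \<in> H3. hyp_act (adj2 A) p \<in> S}"
proof (intro set_eqI iffI)
  fix p assume "p \<in> hyp_act A ` S"
  then show "p \<in> {p \<in> H3. hyp_act (adj2 A) p \<in> S}"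
    using assms by (auto simp: hyp_act_adj2 hyp_act_H3 subset_iff)
next
  fix p assume "p \<in> {p \<in> H3. hyp_act (adj2 A) p \<in> S}"
  then have "p = hyp_act A (hyp_act (adj2 A) p)" "hyp_act (adj2 A) p \<in> S"
    using assms by (auto simp: hyp_act_adj2)
  then show "p \<in> hyp_act A ` S" by blast
qed

lemma hyp_act_image:
  assumes "det A = 1" "S \<in> sets hyp_volume"
  shows "hyp_act A ` S \<in> sets hyp_volume" "emeasure hyp_volume (hyp_act A ` S) = emeasure hyp_volume S"
  using hyp_act_vimage[of "adj2 A" S] assms by (simp_all add: hyp_act_image_eq sets_hyp_volume)

lemma hyp_volume_cusp:
  assumes [measurable]: "Z \<in> sets borel" and t0: "t0 > 0"
  shows "{p. fst p \<in> Z \<and> t0 \<le> snd p} \<in> sets hyp_volume"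
    and "emeasure hyp_volume {p. fst p \<in> Z \<and> t0 \<le> snd p} = emeasure lborel Z * ennreal (1 / (2 * t0\<^sup>2))"
proof -
  let ?S = "{p. fst p \<in> Z \<and> t0 \<le> snd p}"
  have b [measurable]: "?S \<in> sets borel" by measurable
  have sub: "?S \<subseteq> H3" using t0 by (auto simp: mem_H3)
  show "?S \<in> sets hyp_volume" using b sub by (simp add: sets_hyp_volume)
  have "emeasure hyp_volume ?S = hyp_integral (indicator ?S)" by (rule emeasure_hyp_volume[OF b sub])
  also have "\<dots> = (\<integral>\<^sup>+t. (\<integral>\<^sup>+z. indicator Z z * indicator {t0..} t \<partial>lborel) * ennreal (1 / t ^ 3) \<partial>lborel)"
    by (subst hyp_integral_Fubini) (auto intro!: nn_integral_cong simp: indicator_def)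
  also have "\<dots> = (\<integral>\<^sup>+t. emeasure lborel Z * (ennreal (1 / t ^ 3) * indicator {t0..} t) \<partial>lborel)"
    by (intro nn_integral_cong) (simp add: nn_integral_multc mult_ac)
  also have "\<dots> = emeasure lborel Z * (\<integral>\<^sup>+t. ennreal (1 / t ^ 3) * indicator {t0..} t \<partial>lborel)"
    by (rule nn_integral_cmult) measurable
  also have "(\<integral>\<^sup>+t. ennreal (1 / t ^ 3) * indicator {t0..} t \<partial>lborel) = ennreal (0 - (- (1 / (2 * t0\<^sup>2))))"
  proof (rule nn_integral_FTC_atLeast)
    show "((\<lambda>t::real. - (1 / (2 * t\<^sup>2))) \<longlongrightarrow> 0) at_top"
    proof -
      have "((\<lambda>t::real. - (1 / (2 * t\<^sup>2))) \<longlongrightarrow> - 0) at_top"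
        by (intro tendsto_minus tendsto_divide_0[OF tendsto_const] filterlim_at_top_imp_at_infinity
            filterlim_tendsto_pos_mult_at_top[OF tendsto_const] filterlim_pow_at_top filterlim_ident) auto
      then show ?thesis by simp
    qed
    fix x assume "t0 \<le> x"
    then have "x > 0" using t0 by simp
    then show "DERIV (\<lambda>t. - (1 / (2 * t\<^sup>2))) x :> 1 / x ^ 3"
      by (auto intro!: derivative_eq_intros simp: field_simps power2_eq_square power3_eq_cube)
    show "0 \<le> 1 / x ^ 3" using \<open>x > 0\<close> by simp
  qed measurable
  finally show "emeasure hyp_volume ?S = emeasure lborel Z * ennreal (1 / (2 * t0\<^sup>2))" by simp
qed

lemma lborel_null_imp_hyp_null:
  assumes "N \<in> null_sets lborel"
  shows "N \<inter> H3 \<in> null_sets hyp_volume"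
proof -
  have b [measurable]: "N \<in> sets borel" using assms by auto
  have "hyp_integral (indicator (N \<inter> H3)) = (\<integral>\<^sup>+p. 0 \<partial>(lborel :: (complex \<times> real) measure))"
    unfolding hyp_integral_def
    by (rule nn_integral_cong_AE, rule eventually_mono[OF AE_not_in[OF assms]]) simp
  then show ?thesis
    by (intro null_setsI) (auto simp: emeasure_hyp_volume sets_hyp_volume)
qed

lemma hyp_act_upper:
  assumes det: "det A = 1" and c: "A $ 2 $ 1 = 0" and p: "p \<in> H3"
  shows "fst (hyp_act A p) = A $ 1 $ 1 * (A $ 1 $ 1 * fst p + A $ 1 $ 2)"
    and "snd (hyp_act A p) = (cmod (A $ 1 $ 1))\<^sup>2 * snd p"
proof -
  define a b d where abd: "a = A $ 1 $ 1" "b = A $ 1 $ 2" "d = A $ 2 $ 2"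
  have "a * d = 1" using det c by (simp add: det2 abd)
  then have d: "d = 1 / a" "a \<noteq> 0" by (auto simp: eq_divide_eq mult.commute)
  have t: "snd p > 0" using p by (simp add: mem_H3)
  have "hf p a b 0 d / hf p 0 d 0 d = (a * fst p + b) / d"
    using d t by (simp add: hf_def)
  also have "\<dots> = a * (a * fst p + b)" using d by simp
  finally show "fst (hyp_act A p) = A $ 1 $ 1 * (A $ 1 $ 1 * fst p + A $ 1 $ 2)"
    using fst_hyp_act[OF p, of A] c by (simp add: abd[symmetric] hf_diag)
  show "snd (hyp_act A p) = (cmod (A $ 1 $ 1))\<^sup>2 * snd p"
    using snd_hyp_act[OF p, of A] c d t by (simp add: abd[symmetric] hq_def norm_divide power_divide)
qed

text \<open>If \<open>c \<noteq> 0\<close>, preserving the height puts a fixed point on the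
  isometric sphere of \<open>A\<close>. If \<open>c = 0\<close> and
  \<open>a\<^sup>2 \<noteq> 1\<close>, the fixed points lie above one point of the plane, hence in a
  hyperplane. In the remaining case \<open>A\<close> is a proper translation and has none.\<close>

lemma fixed_points_null:
  assumes det: "det A = 1" and nt: "acts_nontrivially A"
  obtains N where "N \<in> null_sets hyp_volume" "{p \<in> H3. hyp_act A p = p} \<subseteq> N"
proof -
  define a b c d where abcd: "a = A $ 1 $ 1" "b = A $ 1 $ 2" "c = A $ 2 $ 1" "d = A $ 2 $ 2"
  have ad: "a * d - b * c = 1" using det by (simp add: det2 abcd)
  have "\<exists>M. negligible M \<and> M \<in> sets borel \<and> {p \<in> H3. hyp_act A p = p} \<subseteq> M"
  proof (cases "c = 0")
    case False
    let ?M = "sphere (- d / c, 0 :: real) (1 / cmod c)"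
    have "{p \<in> H3. hyp_act A p = p} \<subseteq> ?M"
    proof
      fix p assume p: "p \<in> {p \<in> H3. hyp_act A p = p}"
      then have t: "snd p > 0" and e: "snd (hyp_act A p) = snd p" by (auto simp: mem_H3)
      have "snd p = 1 / hq p c d" using snd_hyp_act[of p A] p e by (simp add: abcd)
      then have "hq p c d = 1 / snd p" by simp
      then have 1: "(cmod (c * fst p + d))\<^sup>2 + (cmod c)\<^sup>2 * (snd p)\<^sup>2 = 1"
        using t by (simp add: hq_def)
      have "c * fst p + d = c * (fst p - (- d / c))" using False by (simp add: field_simps)
      then have "cmod (c * fst p + d) = cmod c * dist (fst p) (- d / c)" by (simp only: norm_mult dist_norm)
      with 1 have "(cmod c)\<^sup>2 * ((dist (fst p) (- d / c))\<^sup>2 + (snd p)\<^sup>2) = 1"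
        by (simp add: power_mult_distrib algebra_simps)
      then have "(dist (fst p) (- d / c))\<^sup>2 + (snd p)\<^sup>2 = (1 / cmod c)\<^sup>2"
        using False by (simp add: field_simps)
      then have "dist p (- d / c, 0) = 1 / cmod c"
        by (simp add: dist_prod_def real_sqrt_unique)
      then show "p \<in> ?M" by (simp add: dist_commute)
    qed
    then show ?thesis
      by (intro exI[of _ ?M] conjI negligible_sphere borel_closed closed_sphere)
  next
    case True
    then have d: "d = 1 / a" "a \<noteq> 0" using ad by (auto simp: eq_divide_eq mult.commute)
    have act: "fst (hyp_act A p) = a\<^sup>2 * fst p + a * b" "snd (hyp_act A p) = (cmod a)\<^sup>2 * snd p" if "p \<in> H3" for p
      using hyp_act_upper[of A p] that det True by (simp_all add: abcd power2_eq_square algebra_simps)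
    show ?thesis
    proof (cases "a\<^sup>2 = 1")
      case True
      have am: "cmod a = 1" using arg_cong[OF True, of cmod] power2_eq_imp_eq[of "cmod a" 1] by (simp add: norm_power)
      obtain p0 where p0: "p0 \<in> H3" "hyp_act A p0 \<noteq> p0" using nt by (auto simp: acts_nontrivially_def)
      then have "a * b \<noteq> 0" using act[of p0] True am by (auto simp: prod_eq_iff)
      then have "{p \<in> H3. hyp_act A p = p} = {}" using act True by (force simp: prod_eq_iff)
      then show ?thesis by (intro exI[of _ "{}"]) auto
    next
      case False
      define z0 where "z0 = a * b / (1 - a\<^sup>2)"
      have "fst p = z0" if "p \<in> H3" "hyp_act A p = p" for p
      proof -
        have "a\<^sup>2 * fst p + a * b = fst p" using act(1)[OF that(1)] that(2) by simp
        then show ?thesis using False by (simp add: z0_def field_simps)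
      qed
      then have "{p \<in> H3. hyp_act A p = p} \<subseteq> {p. (1, 0) \<bullet> p = Re z0}"
        by (auto simp: inner_prod_def inner_complex_def)
      moreover have "negligible {p :: complex \<times> real. (1, 0) \<bullet> p = Re z0}"
        by (intro negligible_hyperplane) (auto simp: zero_prod_def)
      moreover have "{p :: complex \<times> real. (1, 0) \<bullet> p = Re z0} \<in> sets borel" by measurable
      ultimately show ?thesis by blast
    qed
  qed
  then obtain M where M: "negligible M" "M \<in> sets borel" "{p \<in> H3. hyp_act A p = p} \<subseteq> M" by blast
  have "M \<in> null_sets lborel"
    using M(1,2) by (simp add: negligible_iff_null_sets null_sets_completion_iff)
  then show ?thesis using that[of "M \<inter> H3"] lborel_null_imp_hyp_null M(3) by blast
qed

lemma finite_total_least: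
  assumes "finite M" "M \<noteq> {}"
    and "\<And>x y. L x y \<or> L y x" "\<And>x y z. L x y \<Longrightarrow> L y z \<Longrightarrow> L x z"
  shows "\<exists>m\<in>M. \<forall>x\<in>M. L m x"
  using assms(1,2)
proof (induction rule: finite_ne_induct)
  case (insert x F)
  then obtain m where m: "m \<in> F" "\<forall>y\<in>F. L m y" by blast
  show ?case
  proof (cases "L x m")
    case True
    then show ?thesis using m assms(3)[of x x] assms(4)[of x m] by blast
  next
    case False
    then show ?thesis using m assms(3)[of x m] by blast
  qed
next
  case (singleton x)
  show ?case using assms(3)[of x x] by simp
qed

text \<open>\<open>height_sum\<close> is twice the hyperbolic cosine of the distance to \<open>(0, 1)\<close>; the lexicographic order breaks ties,
  so that the Dirichlet domain contains exactly one point of each orbit.\<close>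

definition height_sum :: "complex \<times> real \<Rightarrow> real" where
  "height_sum p = hq p 1 0 + hq p 0 1"

definition lex_le :: "complex \<times> real \<Rightarrow> complex \<times> real \<Rightarrow> bool" where
  "lex_le p q \<longleftrightarrow> height_sum p < height_sum q \<or> height_sum p = height_sum q \<and>
     (Re (fst p) < Re (fst q) \<or> Re (fst p) = Re (fst q) \<and>
      (Im (fst p) < Im (fst q) \<or> Im (fst p) = Im (fst q) \<and> snd p \<le> snd q))"

lemma lex_le_total: "lex_le p q \<or> lex_le q p"
  unfolding lex_le_def by linarith

lemma lex_le_trans: "lex_le p q \<Longrightarrow> lex_le q r \<Longrightarrow> lex_le p r"
  unfolding lex_le_def by linarith

lemma lex_le_antisym: "lex_le p q \<Longrightarrow> lex_le q p \<Longrightarrow> p = q"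
  unfolding lex_le_def by (auto simp: prod_eq_iff complex_eq_iff)

text \<open>The sum is written as an integral over \<open>count_space\<close> so that it can be
  interchanged with an integral over the space.\<close>

lemma emeasure_UN_le_count_space:
  assumes "countable I" "\<And>i. i \<in> I \<Longrightarrow> X i \<in> sets M"
  shows "emeasure M (\<Union>i\<in>I. X i) \<le> (\<integral>\<^sup>+i. emeasure M (X i) \<partial>count_space I)"
proof -
  have "emeasure M (\<Union>i\<in>I. X i) = (\<integral>\<^sup>+p. indicator (\<Union>i\<in>I. X i) p \<partial>M)"
    using assms by (intro nn_integral_indicator[symmetric] sets.countable_UN'') auto
  also have "\<dots> \<le> (\<integral>\<^sup>+p. (\<integral>\<^sup>+i. indicator (X i) p \<partial>count_space I) \<partial>M)"
  proof (rule nn_integral_mono)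
    fix p
    show "indicator (\<Union>i\<in>I. X i) p \<le> (\<integral>\<^sup>+i. indicator (X i) p \<partial>count_space I)"
    proof (cases "\<exists>i\<in>I. p \<in> X i")
      case True
      then obtain i where i: "i \<in> I" "p \<in> X i" by blast
      then have "(indicator (\<Union>i\<in>I. X i) p :: ennreal) = (\<integral>\<^sup>+j. indicator {i} j \<partial>count_space I)"
        by (subst nn_integral_indicator) (auto simp: indicator_def)
      also have "\<dots> \<le> (\<integral>\<^sup>+j. indicator (X j) p \<partial>count_space I)"
        using i by (intro nn_integral_mono) (auto split: split_indicator)
      finally show ?thesis .
    qed auto
  qed
  also have "\<dots> = (\<integral>\<^sup>+i. (\<integral>\<^sup>+p. indicator (X i) p \<partial>M) \<partial>count_space I)"
    using assms by (intro nn_integral_count_space_nn_integral) auto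
  also have "\<dots> = (\<integral>\<^sup>+i. emeasure M (X i) \<partial>count_space I)"
    using assms by (intro nn_integral_cong) auto
  finally show ?thesis .
qed

text \<open>Discreteness is stated as proper discontinuity in the form that a Dirichlet domain
  needs. It counts matrices and not orbit points, so it also makes stabilisers finite.\<close>

locale discrete_group =
  fixes \<Gamma> :: "(complex ^ 2 ^ 2) set"
  assumes det1: "A \<in> \<Gamma> \<Longrightarrow> det A = 1"
    and mat1_mem: "mat 1 \<in> \<Gamma>"
    and mult_mem: "A \<in> \<Gamma> \<Longrightarrow> B \<in> \<Gamma> \<Longrightarrow> A ** B \<in> \<Gamma>"
    and adj2_mem: "A \<in> \<Gamma> \<Longrightarrow> adj2 A \<in> \<Gamma>"
    and countable: "countable \<Gamma>"
    and discrete: "p \<in> H3 \<Longrightarrow> finite {A \<in> \<Gamma>. height_sum (hyp_act A p) \<le> r}"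
begin

lemma act_mem_H3: "A \<in> \<Gamma> \<Longrightarrow> p \<in> H3 \<Longrightarrow> hyp_act A p \<in> H3"
  using det1 hyp_act_H3 by blast

lemma fundamental_domain_exists: "\<exists>D. fundamental_domain \<Gamma> D"
proof -
  define D where "D = {p \<in> H3. \<forall>A\<in>\<Gamma>. lex_le p (hyp_act A p)}"
  have DH: "D \<subseteq> H3" by (auto simp: D_def)
  have hm [measurable]: "height_sum \<in> borel_measurable borel"
    unfolding height_sum_def hq_def by measurable
  have "{p. lex_le p (hyp_act A p)} \<in> sets borel" for A
    unfolding lex_le_def by measurable
  then have "H3 \<inter> (\<Inter>A\<in>\<Gamma>. {p. lex_le p (hyp_act A p)}) \<in> sets borel"
    using countable mat1_mem by (intro sets.Int sets.countable_INT'') auto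
  also have "H3 \<inter> (\<Inter>A\<in>\<Gamma>. {p. lex_le p (hyp_act A p)}) = D" by (auto simp: D_def)
  finally have meas: "D \<in> sets hyp_volume" using DH by (simp add: sets_hyp_volume)
  have cover: "\<exists>A\<in>\<Gamma>. p \<in> hyp_act A ` D" if p: "p \<in> H3" for p
  proof -
    \<comment> \<open>These finitely many orbit points compete for being the least; every other
      orbit point has larger \<open>height_sum\<close>, so the least of \<open>M\<close> is the
      least of the whole orbit.\<close>
    define M where "M = (\<lambda>A. hyp_act A p) ` {A \<in> \<Gamma>. height_sum (hyp_act A p) \<le> height_sum p}"
    have "p \<in> M" unfolding M_def using mat1_mem p by (auto simp: hyp_act_mat1 intro!: image_eqI[of _ _ "mat 1"])
    then obtain m where m: "m \<in> M" "\<forall>x\<in>M. lex_le m x"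
      using finite_total_least[of M lex_le] discrete[OF p] lex_le_total lex_le_trans unfolding M_def by blast
    then obtain B where B: "B \<in> \<Gamma>" "m = hyp_act B p" "height_sum m \<le> height_sum p" by (auto simp: M_def)
    have "lex_le m (hyp_act A m)" if A: "A \<in> \<Gamma>" for A
    proof -
      have AB: "hyp_act A m = hyp_act (A ** B) p" using B A p det1 by (simp add: hyp_act_mult)
      show ?thesis
      proof (cases "height_sum (hyp_act A m) \<le> height_sum p")
        case True
        then show ?thesis using m(2) mult_mem[OF A B(1)] AB unfolding M_def by auto
      next
        case False
        then show ?thesis using B(3) by (simp add: lex_le_def)
      qed
    qed
    then have "m \<in> D" using B p act_mem_H3 by (auto simp: D_def)
    moreover have "p = hyp_act (adj2 B) m" using B p det1 by (simp add: hyp_act_adj2)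
    ultimately show ?thesis using adj2_mem[OF B(1)] by blast
  qed
  have null: "emeasure hyp_volume (D \<inter> hyp_act A ` D) = 0" if A: "A \<in> \<Gamma>" "acts_nontrivially A" for A
  proof -
    obtain N where N: "N \<in> null_sets hyp_volume" "{p \<in> H3. hyp_act A p = p} \<subseteq> N"
      using fixed_points_null[OF det1[OF A(1)] A(2)] .
    \<comment> \<open>A point of the overlap and its preimage under \<open>A\<close> are both least
      in the same orbit, so \<open>A\<close> fixes it.\<close>
    have "D \<inter> hyp_act A ` D \<subseteq> {p \<in> H3. hyp_act A p = p}"
    proof
      fix p assume "p \<in> D \<inter> hyp_act A ` D"
      then obtain q where q: "p \<in> D" "q \<in> D" "p = hyp_act A q" by blast
      have "lex_le q p" using q A by (auto simp: D_def)
      moreover have "hyp_act (adj2 A) p = q" using q A det1 by (auto simp: D_def hyp_act_adj2)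
      then have "lex_le p q" using q adj2_mem[OF A(1)] unfolding D_def by force
      ultimately have "p = q" using lex_le_antisym by blast
      then show "p \<in> {p \<in> H3. hyp_act A p = p}" using q DH by auto
    qed
    then have "emeasure hyp_volume (D \<inter> hyp_act A ` D) \<le> emeasure hyp_volume N"
      using N by (intro emeasure_mono) auto
    then show ?thesis using N by (simp add: null_sets_def)
  qed
  have "fundamental_domain \<Gamma> D"
    unfolding fundamental_domain_def using meas null cover act_mem_H3 DH by (auto simp: image_subset_iff subset_iff)
  then show ?thesis ..
qed

text \<open>The choice made in \<open>quotient_volume\<close>. It need not be the Dirichlet domain
  just constructed; only \<open>fundamental_domain\<close> is known of it.\<close>

definition "fd = (SOME D. fundamental_domain \<Gamma> D)"

lemma fd: "fundamental_domain \<Gamma> fd"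
  unfolding fd_def using fundamental_domain_exists by (rule someI_ex)

lemma fd_sets: "fd \<in> sets hyp_volume" and fd_sub: "fd \<subseteq> H3"
  using fd by (auto simp: fundamental_domain_def sets_hyp_volume)

lemma fd_null: "A \<in> \<Gamma> \<Longrightarrow> acts_nontrivially A \<Longrightarrow> fd \<inter> hyp_act A ` fd \<in> null_sets hyp_volume"
  using fd fd_sets hyp_act_image(1)[OF det1 fd_sets] unfolding fundamental_domain_def
  by (intro null_setsI) auto

lemma quotient_volume_fd: "quotient_volume \<Gamma> X = emeasure hyp_volume (fd \<inter> \<Union>X)"
  by (simp add: quotient_volume_def fd_def)

lemma Union_hyp_quotient: "\<Union>(hyp_quotient \<Gamma>) = H3"
proof -
  have "p \<in> hyp_orbit \<Gamma> p" if "p \<in> H3" for p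
    using imageI[OF mat1_mem, of "\<lambda>A. hyp_act A p"] hyp_act_mat1[OF that] by (simp add: hyp_orbit_def)
  then show ?thesis using act_mem_H3 by (force simp: hyp_quotient_def hyp_orbit_def)
qed

lemma quotient_volume_total: "quotient_volume \<Gamma> (hyp_quotient \<Gamma>) = emeasure hyp_volume fd"
  by (simp only: quotient_volume_fd Union_hyp_quotient Int_absorb2[OF fd_sub])

text \<open>A point \<open>e\<close> of \<open>E\<close> is used only for the first translate in an enumeration of \<open>\<Gamma>\<close> that lies in the
  fundamental domain; the points of \<open>fd\<close> lost in this way lie in the overlap of \<open>fd\<close> with a translate.\<close>

lemma volume_le_cover:
  assumes E: "E \<in> sets hyp_volume" and T: "\<And>p. p \<in> T \<Longrightarrow> \<exists>A\<in>\<Gamma>. hyp_act A p \<in> E" and TH: "T \<subseteq> H3"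
  shows "emeasure hyp_volume (fd \<inter> T) \<le> emeasure hyp_volume E"
proof -
  define e where "e = from_nat_into \<Gamma>"
  have ne: "\<Gamma> \<noteq> {}" using mat1_mem by auto
  have e: "e n \<in> \<Gamma>" for n unfolding e_def using ne by (rule from_nat_into)
  have esurj: "\<exists>n. e n = A" if "A \<in> \<Gamma>" for A
    unfolding e_def using from_nat_into_surj[OF countable that] .
  define V where "V n = {p \<in> H3. hyp_act (e n) p \<in> fd}" for n
  have V [measurable]: "V n \<in> sets hyp_volume" for n
    unfolding V_def using hyp_act_vimage(1)[OF det1[OF e] fd_sets] .
  define B where "B n = E \<inter> disjointed V n" for n
  have dV: "disjointed V n \<in> sets hyp_volume" for n
    using sets.range_disjointed_sets[of V hyp_volume] V by blast
  have B: "B n \<in> sets hyp_volume" for n unfolding B_def using E dV by auto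
  define N where "N = (\<Union>A\<in>{A\<in>\<Gamma>. acts_nontrivially A}. fd \<inter> hyp_act A ` fd)"
  have N: "N \<in> null_sets hyp_volume"
    unfolding N_def using countable fd_null by (intro null_sets_UN') (auto intro: countable_subset)
  have incl: "fd \<inter> T \<subseteq> (\<Union>n. hyp_act (e n) ` B n) \<union> N"
  proof
    fix x assume x: "x \<in> fd \<inter> T"
    then obtain A where A: "A \<in> \<Gamma>" "hyp_act A x \<in> E" using T by blast
    define y where "y = hyp_act A x"
    have xH: "x \<in> H3" using x TH by auto
    have yH: "y \<in> H3" using A xH act_mem_H3 by (auto simp: y_def)
    have xy: "x = hyp_act (adj2 A) y" using det1[OF A(1)] xH by (simp add: y_def hyp_act_adj2)
    obtain k where "e k = adj2 A" using esurj adj2_mem[OF A(1)] by blast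
    then have "y \<in> V k" using xy x yH by (auto simp: V_def)
    then have "y \<in> (\<Union>n. disjointed V n)" unfolding UN_disjointed_eq by blast
    then obtain n where n: "y \<in> disjointed V n" by blast
    then have yB: "y \<in> B n" using A by (simp add: B_def y_def)
    have yV: "y \<in> V n" using subsetD[OF disjointed_subset n] .
    \<comment> \<open>\<open>C\<close> takes the representative \<open>w\<close> used for
      \<open>y\<close> back to \<open>x\<close>, and both lie in \<open>fd\<close>. If
      \<open>C\<close> acts non-trivially, \<open>x\<close> is in the overlap collected in
      \<open>N\<close>; otherwise \<open>x = w\<close>.\<close>
    define C where "C = adj2 A ** adj2 (e n)"
    have C: "C \<in> \<Gamma>" unfolding C_def using mult_mem adj2_mem A e by blast
    define w where "w = hyp_act (e n) y"
    have w: "w \<in> fd" using yV by (simp add: V_def w_def)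
    have wH: "w \<in> H3" using w fd_sub by auto
    have "hyp_act (adj2 (e n)) w = y" using det1[OF e] yH by (simp add: w_def hyp_act_adj2)
    then have xw: "x = hyp_act C w"
      unfolding C_def using det1[OF A(1)] det1[OF e] wH xy by (simp add: hyp_act_mult[symmetric])
    show "x \<in> (\<Union>n. hyp_act (e n) ` B n) \<union> N"
    proof (cases "acts_nontrivially C")
      case True
      then show ?thesis using x w xw C by (auto simp: N_def)
    next
      case False
      then have "x = w" using xw wH by (auto simp: acts_nontrivially_def)
      then show ?thesis using yB by (auto simp: w_def)
    qed
  qed
  have Bi: "hyp_act (e n) ` B n \<in> sets hyp_volume" for n using hyp_act_image(1)[OF det1[OF e] B] .
  have "emeasure hyp_volume (fd \<inter> T) \<le> emeasure hyp_volume ((\<Union>n. hyp_act (e n) ` B n) \<union> N)"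
    using Bi N by (intro emeasure_mono incl) auto
  also have "\<dots> = emeasure hyp_volume (\<Union>n. hyp_act (e n) ` B n)"
    using Bi N by (intro emeasure_Un_null_set) auto
  also have "\<dots> \<le> (\<Sum>n. emeasure hyp_volume (hyp_act (e n) ` B n))"
    using Bi by (intro emeasure_subadditive_countably) auto
  also have "\<dots> = (\<Sum>n. emeasure hyp_volume (B n))"
    using hyp_act_image(2)[OF det1[OF e] B] by simp
  also have "\<dots> = emeasure hyp_volume (\<Union>n. B n)"
    using B disjoint_family_disjointed[of V]
    by (intro suminf_emeasure) (auto simp: B_def disjoint_family_on_def)
  also have "\<dots> \<le> emeasure hyp_volume E"
    using E by (intro emeasure_mono) (auto simp: B_def)
  finally show ?thesis .
qed

text \<open>Unfolding: the translates of \<open>fd\<close> cover \<open>U\<close>, and moved back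
  into \<open>fd\<close> their parts in \<open>U\<close> cover a point \<open>p\<close> as often as
  \<open>hyp_act A p \<in> U\<close>. The hypothesis bounds this number for
  \<open>p \<in> U\<close>; for other points of \<open>H3\<close>, right multiplication by the
  inverse of some \<open>B\<close> with \<open>hyp_act B p \<in> U\<close> reduces to that
  case.\<close>

lemma volume_ge_multiplicity:
  assumes U: "U \<in> sets hyp_volume"
    and K: "\<And>p. p \<in> U \<Longrightarrow> finite {A \<in> \<Gamma>. hyp_act A p \<in> U} \<and> card {A \<in> \<Gamma>. hyp_act A p \<in> U} \<le> K"
  shows "emeasure hyp_volume U \<le> of_nat K * emeasure hyp_volume fd"
proof -
  have UH: "U \<subseteq> H3" using U by (simp add: sets_hyp_volume)
  have mult: "finite {A \<in> \<Gamma>. hyp_act A p \<in> U} \<and> card {A \<in> \<Gamma>. hyp_act A p \<in> U} \<le> K" if p: "p \<in> H3" for p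
  proof (cases "{A \<in> \<Gamma>. hyp_act A p \<in> U} = {}")
    case False
    then obtain B where B: "B \<in> \<Gamma>" "hyp_act B p \<in> U" by auto
    let ?f = "\<lambda>A. A ** adj2 B"
    have inj: "inj_on ?f {A \<in> \<Gamma>. hyp_act A p \<in> U}"
    proof (rule inj_onI)
      fix X Y assume "X ** adj2 B = Y ** adj2 B"
      then have "X ** (adj2 B ** B) = Y ** (adj2 B ** B)" by (simp add: matrix_mul_assoc)
      then show "X = Y" using det1[OF B(1)] by (simp add: adj2_mult)
    qed
    have sub: "?f ` {A \<in> \<Gamma>. hyp_act A p \<in> U} \<subseteq> {A \<in> \<Gamma>. hyp_act A (hyp_act B p) \<in> U}"
    proof
      fix C assume "C \<in> ?f ` {A \<in> \<Gamma>. hyp_act A p \<in> U}"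
      then obtain A where A: "A \<in> \<Gamma>" "hyp_act A p \<in> U" "C = A ** adj2 B" by auto
      have "hyp_act C (hyp_act B p) = hyp_act A p"
        unfolding A(3) using det1[OF A(1)] det1[OF B(1)] p act_mem_H3[OF B(1) p]
        by (simp add: hyp_act_mult[symmetric] hyp_act_adj2)
      then show "C \<in> {A \<in> \<Gamma>. hyp_act A (hyp_act B p) \<in> U}"
        using A B mult_mem adj2_mem by auto
    qed
    have f: "finite {A \<in> \<Gamma>. hyp_act A p \<in> U}"
      using inj_on_finite[OF inj sub] K[OF B(2)] by blast
    have "card {A \<in> \<Gamma>. hyp_act A p \<in> U} \<le> card {A \<in> \<Gamma>. hyp_act A (hyp_act B p) \<in> U}"
      using card_inj_on_le[OF inj sub] K[OF B(2)] by blast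
    then show ?thesis using f K[OF B(2)] by auto
  next
    case True
    show ?thesis unfolding True by simp
  qed
  define W where "W A = {p \<in> H3. hyp_act A p \<in> U}" for A
  have W: "W A \<in> sets hyp_volume" if "A \<in> \<Gamma>" for A
    unfolding W_def using hyp_act_vimage(1)[OF det1[OF that] U] .
  have im: "U \<inter> hyp_act A ` fd = hyp_act A ` (W A \<inter> fd)" if "A \<in> \<Gamma>" for A
    using act_mem_H3[OF that] fd_sub by (auto simp: W_def)
  have "U \<subseteq> (\<Union>A\<in>\<Gamma>. U \<inter> hyp_act A ` fd)"
    using fd UH unfolding fundamental_domain_def by blast
  then have "emeasure hyp_volume U \<le> emeasure hyp_volume (\<Union>A\<in>\<Gamma>. U \<inter> hyp_act A ` fd)"
    using U countable hyp_act_image(1)[OF det1 fd_sets] by (intro emeasure_mono sets.countable_UN'') auto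
  also have "\<dots> \<le> (\<integral>\<^sup>+A. emeasure hyp_volume (U \<inter> hyp_act A ` fd) \<partial>count_space \<Gamma>)"
    using U countable hyp_act_image(1)[OF det1 fd_sets] by (intro emeasure_UN_le_count_space) auto
  also have "\<dots> = (\<integral>\<^sup>+A. (\<integral>\<^sup>+p. indicator (W A) p * indicator fd p \<partial>hyp_volume) \<partial>count_space \<Gamma>)"
  proof (rule nn_integral_cong)
    fix A assume "A \<in> space (count_space \<Gamma>)"
    then have A: "A \<in> \<Gamma>" by simp
    have "emeasure hyp_volume (U \<inter> hyp_act A ` fd) = emeasure hyp_volume (W A \<inter> fd)"
      unfolding im[OF A] using W[OF A] fd_sets det1[OF A] by (intro hyp_act_image) auto
    also have "\<dots> = (\<integral>\<^sup>+p. indicator (W A \<inter> fd) p \<partial>hyp_volume)"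
      using W[OF A] fd_sets by (intro nn_integral_indicator[symmetric]) auto
    finally show "emeasure hyp_volume (U \<inter> hyp_act A ` fd) = (\<integral>\<^sup>+p. indicator (W A) p * indicator fd p \<partial>hyp_volume)"
      by (simp add: indicator_inter_arith)
  qed
  also have "\<dots> = (\<integral>\<^sup>+p. (\<integral>\<^sup>+A. indicator (W A) p * indicator fd p \<partial>count_space \<Gamma>) \<partial>hyp_volume)"
    using W fd_sets countable by (intro nn_integral_count_space_nn_integral[symmetric]) auto
  also have "\<dots> \<le> (\<integral>\<^sup>+p. of_nat K * indicator fd p \<partial>hyp_volume)"
  proof (rule nn_integral_mono)
    fix p assume "p \<in> space hyp_volume"
    then have p: "p \<in> H3" by simp
    have "(\<integral>\<^sup>+A. indicator (W A) p * indicator fd p \<partial>count_space \<Gamma>) =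
        (\<integral>\<^sup>+A. indicator {A \<in> \<Gamma>. hyp_act A p \<in> U} A \<partial>count_space \<Gamma>) * indicator fd p"
      by (subst nn_integral_multc[symmetric]) (auto intro!: nn_integral_cong simp: W_def p indicator_def)
    also have "(\<integral>\<^sup>+A. indicator {A \<in> \<Gamma>. hyp_act A p \<in> U} A \<partial>count_space \<Gamma>) = of_nat (card {A \<in> \<Gamma>. hyp_act A p \<in> U})"
      using mult[OF p] by (subst nn_integral_indicator) auto
    also have "\<dots> * indicator fd p \<le> of_nat K * indicator fd p"
      using mult[OF p] by (intro mult_right_mono) auto
    finally show "(\<integral>\<^sup>+A. indicator (W A) p * indicator fd p \<partial>count_space \<Gamma>) \<le> of_nat K * indicator fd p" .
  qed
  also have "\<dots> = of_nat K * emeasure hyp_volume fd"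
    using fd_sets by (subst nn_integral_cmult) auto
  finally show ?thesis .
qed

end

section \<open>Rings of integers of imaginary quadratic fields\<close>

lemma cmod_sq: "(cmod x)\<^sup>2 = Re x * Re x + Im x * Im x"
  by (simp add: cmod_power2 flip: power2_eq_square)

lemma cmod_sq_Re: "(cmod x)\<^sup>2 = Re (x * cnj x)"
  by (simp add: cmod_sq)

lemma Rats_power2_Ints:
  fixes q :: real
  assumes "q \<in> \<rat>" "q\<^sup>2 \<in> \<int>"
  shows "q \<in> \<int>"
proof -
  have "algebraic_int q"
  proof (rule algebraic_int.intros)
    show "lead_coeff [:- q\<^sup>2, 0, 1:] = 1" by simp
    show "\<forall>i. coeff [:- q\<^sup>2, 0, 1:] i \<in> \<int>" using assms(2) by (auto simp: coeff_pCons split: nat.splits)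
    show "poly [:- q\<^sup>2, 0, 1:] q = 0" by (simp add: power2_eq_square)
  qed
  then show ?thesis using assms rational_algebraic_int_is_int by blast
qed

lemma algebraic_int_quadratic:
  fixes x :: complex
  assumes "2 * Re x \<in> \<int>" "(cmod x)\<^sup>2 \<in> \<int>"
  shows "algebraic_int x"
proof -
  let ?p = "[:complex_of_real ((cmod x)\<^sup>2), - complex_of_real (2 * Re x), 1:]"
  obtain m n where mn: "2 * Re x = of_int m" "(cmod x)\<^sup>2 = of_int n" using assms by (auto elim!: Ints_cases)
  show ?thesis
  proof (rule algebraic_int.intros)
    show "lead_coeff ?p = 1" by simp
    show "\<forall>i. coeff ?p i \<in> \<int>" unfolding mn by (auto simp: coeff_pCons split: nat.splits)
    have "complex_of_real ((cmod x)\<^sup>2) = x * cnj x" "complex_of_real (2 * Re x) = x + cnj x"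
      by (rule complex_norm_square, simp add: complex_add_cnj)
    then show "poly ?p x = 0" by (simp only: poly_pCons poly_0) (simp add: algebra_simps)
  qed
qed

lemma finite_common_denominator:
  fixes S :: "real set"
  assumes "finite S" "S \<subseteq> \<rat>"
  shows "\<exists>D::int. D > 0 \<and> (\<forall>s\<in>S. of_int D * s \<in> \<int>)"
  using assms
proof (induction S rule: finite_induct)
  case (insert s S)
  then obtain D where D: "D > 0" "\<forall>s\<in>S. of_int D * s \<in> \<int>" by auto
  obtain a b where ab: "b > 0" "s = of_int a / of_int b" using insert.prems by (auto elim: Rats_cases')
  show ?case
  proof (intro exI[of _ "D * b"] conjI ballI)
    fix u assume u: "u \<in> insert s S"
    show "real_of_int (D * b) * u \<in> \<int>"
    proof (cases "u = s")
      case True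
      then have "real_of_int (D * b) * u = of_int (D * a)" using ab by simp
      then show ?thesis by (simp only: Ints_of_int)
    next
      case False
      then have "of_int D * u \<in> \<int>" using u D by auto
      then have "of_int b * (of_int D * u) \<in> \<int>" by (rule Ints_mult[OF Ints_of_int])
      then show ?thesis by (simp add: mult_ac)
    qed
  qed (use D ab in simp)
qed (auto intro: exI[of _ 1])

text \<open>In lowest terms, all powers of the denominator of \<open>N\<close> would divide
  \<open>D\<close>. This yields integrality of norms without any knowledge of conjugates.\<close>

lemma bounded_denominator_powers_Ints:
  fixes N :: real
  assumes "N \<in> \<rat>" "D > 0" "\<And>k. of_int D * N ^ k \<in> \<int>"
  shows "N \<in> \<int>"
proof -
  obtain u v where uv: "v > 0" "Rings.coprime u v" "N = of_int u / of_int v" using assms(1) by (auto elim: Rats_cases')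
  have dvd: "v ^ k dvd D" for k
  proof -
    obtain m where m: "of_int D * N ^ k = of_int m" using assms(3)[of k] by (auto elim: Ints_cases)
    then have "of_int (D * u ^ k) = (of_int (m * v ^ k) :: real)"
      using uv by (simp add: power_divide field_simps)
    then have "D * u ^ k = m * v ^ k" by (simp only: of_int_eq_iff)
    then have "v ^ k dvd D * u ^ k" by simp
    moreover have "Rings.coprime (v ^ k) (u ^ k)" using uv by (simp add: coprime_commute)
    ultimately show ?thesis by (simp add: coprime_dvd_mult_left_iff)
  qed
  have "v = 1"
  proof (rule ccontr)
    assume "v \<noteq> 1"
    then have v2: "v \<ge> 2" using uv by simp
    \<comment> \<open>The exponent \<open>D\<close> suffices, because
      \<open>2 ^ D > D\<close>.\<close>
    define k where "k = nat D"
    have "int k < 2 ^ k" using of_nat_less_two_power[of k] by simp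
    also have "\<dots> \<le> v ^ k" using v2 by (intro power_mono) auto
    also have "v ^ k \<le> D" using dvd assms(2) by (intro zdvd_imp_le) auto
    finally show False using assms(2) by (simp add: k_def)
  qed
  then show ?thesis using uv by simp
qed

text \<open>All powers lie in one finitely generated group, so numbers formed from them bilinearly
  have a common denominator.\<close>

lemma algebraic_int_powers:
  fixes x :: complex
  assumes "algebraic_int x"
  obtains n where "\<And>k. \<exists>c :: nat \<Rightarrow> int. x ^ k = (\<Sum>i<n. of_int (c i) * x ^ i)"
proof -
  obtain p where p: "lead_coeff p = 1" "\<forall>i. coeff p i \<in> \<int>" "poly p x = 0"
    using assms by (auto simp: algebraic_int.simps)
  define n where "n = degree p"
  have n: "n > 0" using p unfolding n_def by (intro Nat.gr0I) (auto elim!: degree_eq_zeroE)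
  obtain f where f: "\<And>i. coeff p i = of_int (f i)" using p(2) by (auto simp: Ints_def image_iff) metis
  have xn: "x ^ n = - (\<Sum>i<n. of_int (f i) * x ^ i)"
  proof -
    have "0 = (\<Sum>i\<le>n. coeff p i * x ^ i)" using p by (simp add: poly_altdef n_def)
    also have "\<dots> = (\<Sum>i<n. coeff p i * x ^ i) + x ^ n" using p by (simp add: lessThan_Suc_atMost[symmetric] n_def)
    finally show ?thesis by (simp add: f eq_neg_iff_add_eq_0 add.commute)
  qed
  have "\<exists>c :: nat \<Rightarrow> int. x ^ k = (\<Sum>i<n. of_int (c i) * x ^ i)" for k
  proof (induction k)
    case 0
    have "(\<Sum>i<n. of_int (if i = 0 then 1 else 0) * x ^ i) = (\<Sum>i\<in>{0}. of_int (if i = 0 then 1 else 0) * x ^ i)"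
      using n by (intro sum.mono_neutral_right) auto
    then show ?case by (intro exI[of _ "\<lambda>i. if i = 0 then 1 else 0"]) simp
  next
    case (Suc k)
    then obtain c where c: "x ^ k = (\<Sum>i<n. of_int (c i) * x ^ i)" by blast
    obtain m where m: "n = Suc m" using n by (cases n) auto
    \<comment> \<open>Multiplication by \<open>x\<close> shifts the coefficients, and the overflow
      \<open>x ^ n\<close> is removed by the monic relation.\<close>
    define e where "e i = (if i = 0 then 0 else c (i - 1)) - c m * f i" for i
    have "x ^ Suc k = (\<Sum>i<Suc m. of_int (c i) * x ^ Suc i)"
      by (simp add: c m sum_distrib_left mult_ac del: sum.lessThan_Suc)
    also have "\<dots> = (\<Sum>i<m. of_int (c i) * x ^ Suc i) + of_int (c m) * x ^ n"
      by (simp add: m)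
    also have "(\<Sum>i<m. of_int (c i) * x ^ Suc i) = (\<Sum>i<n. of_int (if i = 0 then 0 else c (i - 1)) * x ^ i)"
      unfolding m by (subst sum.lessThan_Suc_shift) simp
    also have "of_int (c m) * x ^ n = (\<Sum>i<n. - of_int (c m * f i) * x ^ i)"
      by (simp add: xn sum_distrib_left sum_negf mult_ac)
    also have "(\<Sum>i<n. of_int (if i = 0 then 0 else c (i - 1)) * x ^ i) + \<dots> = (\<Sum>i<n. of_int (e i) * x ^ i)"
      unfolding sum.distrib[symmetric] by (intro sum.cong refl) (simp only: e_def of_int_diff ring_distribs, simp)
    finally show ?case by blast
  qed
  then show ?thesis using that by blast
qed

definition quad_ints :: "complex \<Rightarrow> complex set" where
  "quad_ints w = {of_int a + of_int b * w | a b. True}"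

text \<open>What the sequel uses of the ring of integers, with the field eliminated:
  \<open>int_closed\<close> is integral closedness for quotients \<open>u / n\<close>, trace and
  norm being \<open>2 * Re\<close> and the squared modulus. The normalisation of \<open>Re w\<close>
  leaves the traces 0 and 1 for \<open>w\<close>.\<close>

locale quad_ring =
  fixes w :: complex
  assumes Im_w: "Im w > 0" and Re_w: "0 \<le> Re w" "Re w < 1"
    and tr_w: "2 * Re w \<in> \<int>" and nm_w: "(cmod w)\<^sup>2 \<in> \<int>"
    and int_closed: "\<And>u n. u \<in> quad_ints w \<Longrightarrow> n > 0 \<Longrightarrow> 2 * Re (u / of_int n) \<in> \<int> \<Longrightarrow>
      (cmod (u / of_int n))\<^sup>2 \<in> \<int> \<Longrightarrow> u / of_int n \<in> quad_ints w"

text \<open>With \<open>t = 2 Re\<close>, twice the trace \<open>2 Re (x cnj y)\<close> is \<open>t x * t y / 2 + \<delta> / 2\<close>, where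
  \<open>\<delta> = 4 Im x Im y\<close> is an integer because its square is, and has the parity of \<open>t x * t y\<close>.\<close>

lemma trace_product_Ints:
  fixes x y :: complex
  assumes "2 * Re (x * cnj y) \<in> \<rat>" "2 * Re x \<in> \<int>" "(cmod x)\<^sup>2 \<in> \<int>" "2 * Re y \<in> \<int>" "(cmod y)\<^sup>2 \<in> \<int>"
  shows "2 * Re (x * cnj y) \<in> \<int>"
proof -
  obtain tx nx ty ny where i: "2 * Re x = of_int tx" "(cmod x)\<^sup>2 = of_int nx" "2 * Re y = of_int ty" "(cmod y)\<^sup>2 = of_int ny"
    using assms(2-5) by (auto elim!: Ints_cases)
  define \<delta> where "\<delta> = 4 * Im x * Im y"
  have T: "2 * (2 * Re (x * cnj y)) = of_int (tx * ty) + \<delta>"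
    using i(1,3) by (simp add: \<delta>_def algebra_simps flip: i(1) i(3))
  have "\<delta> = 2 * (2 * Re (x * cnj y)) - of_int (tx * ty)" using T by simp
  then have dr: "\<delta> \<in> \<rat>" using assms(1) by (metis Rats_diff Rats_mult Rats_of_int Rats_number_of)
  have D: "4 * (Im z)\<^sup>2 = 4 * (cmod z)\<^sup>2 - (2 * Re z)\<^sup>2" for z
    by (simp add: cmod_power2)
  have "\<delta>\<^sup>2 = (4 * (Im x)\<^sup>2) * (4 * (Im y)\<^sup>2)" by (simp add: \<delta>_def power_mult_distrib)
  also have "\<dots> = of_int ((4 * nx - tx\<^sup>2) * (4 * ny - ty\<^sup>2))" unfolding D i by simp
  finally have d2: "\<delta>\<^sup>2 = of_int ((4 * nx - tx\<^sup>2) * (4 * ny - ty\<^sup>2))" .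
  then have "\<delta> \<in> \<int>" using Rats_power2_Ints[OF dr] by simp
  then obtain d where d: "\<delta> = of_int d" by (auto elim: Ints_cases)
  have "d\<^sup>2 = (4 * nx - tx\<^sup>2) * (4 * ny - ty\<^sup>2)" using d2 unfolding d by (metis of_int_eq_iff of_int_power)
  then have "even (d\<^sup>2) \<longleftrightarrow> even ((4 * nx - tx\<^sup>2) * (4 * ny - ty\<^sup>2))" by simp
  then have "even d \<longleftrightarrow> even (tx * ty)" by simp
  then have "even (tx * ty + d)" by simp
  then obtain k where "tx * ty + d = 2 * k" by blast
  then have "2 * (2 * Re (x * cnj y)) = 2 * of_int k" using T d by (metis of_int_add of_int_mult of_int_numeral)
  then have "2 * Re (x * cnj y) = of_int k" by simp
  then show ?thesis by simp
qed

text \<open>The field is \<open>\<rat> + \<rat> \<theta>\<close> and stable under conjugation. Its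
  algebraic integers are the elements with integral trace and norm: the norm by bounded denominators
  of its powers, the trace by comparing the norms of \<open>x\<close> and \<open>x + 1\<close>. Then
  \<open>w\<close> is an integer of least positive imaginary part, shifted into the strip
  \<open>0 \<le> Re w < 1\<close>.\<close>

lemma imaginary_quadratic_field_quad_ring:
  assumes "imaginary_quadratic_field F"
  obtains w where "quad_ring w" "ring_of_integers F = quad_ints w"
proof -
  interpret V: vector_space rat_scale by (rule vector_space_rat_scale)
  have F: "complex_subfield F" "V.dim F = 2" "\<not> F \<subseteq> \<real>" using assms by (auto simp: imaginary_quadratic_field_def)
  have F0: "0 \<in> F" "1 \<in> F" and Fadd: "\<And>x y. x \<in> F \<Longrightarrow> y \<in> F \<Longrightarrow> x + y \<in> F" and Fmul: "\<And>x y. x \<in> F \<Longrightarrow> y \<in> F \<Longrightarrow> x * y \<in> F"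
    and Fneg: "\<And>x. x \<in> F \<Longrightarrow> - x \<in> F" and Finv: "\<And>x. x \<in> F \<Longrightarrow> inverse x \<in> F"
    using F(1) by (auto simp: complex_subfield_def)
  have Fnat: "of_nat n \<in> F" for n by (induction n) (auto intro: F0 Fadd)
  have Fint: "of_int n \<in> F" for n using Fnat Fneg by (cases n) (auto simp del: of_nat_Suc)
  have Frat: "complex_of_real q \<in> F" if q: "q \<in> \<rat>" for q
  proof -
    obtain a b :: int where "q = of_int a / of_int b" using q unfolding Rats_eq_int_div_int by blast
    then have "complex_of_real q = of_int a * inverse (of_int b)" by (simp add: divide_inverse)
    then show ?thesis using Fint Fmul Finv by auto
  qed
  obtain \<theta> where th: "\<theta> \<in> F" "\<theta> \<notin> \<real>" using F(3) by blast
  have Imth: "Im \<theta> \<noteq> 0" using th(2) by (simp add: complex_is_Real_iff)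
  have rat_real: "(of_rat q :: complex) = complex_of_real (of_rat q)" for q by (cases q) (simp add: of_rat_rat)
  have "1 \<notin> V.span {\<theta>}"
  proof
    assume "1 \<in> V.span {\<theta>}"
    then obtain k where k: "1 = rat_scale k \<theta>" by (auto simp: V.span_singleton)
    then have "Im 1 = Im (complex_of_real (of_rat k) * \<theta>)" unfolding rat_scale_def rat_real by (rule arg_cong)
    then have "of_rat k * Im \<theta> = 0" by simp
    then have "of_rat k = (0::real)" using Imth by simp
    then show False using k by (simp add: rat_scale_def)
  qed
  then have ind: "V.independent {1, \<theta>}"
    using Imth by (auto simp: V.independent_insert V.dependent_single)
  obtain B where B: "{1, \<theta>} \<subseteq> B" "B \<subseteq> F" "V.independent B" "F \<subseteq> V.span B"
    using V.maximal_independent_subset_extend[of "{1, \<theta>}" F] ind F0 th by auto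
  have cB: "card B = 2" using V.basis_card_eq_dim[OF B(2,4,3)] F(2) by simp
  have "card {1, \<theta>} = 2" using Imth by (auto simp: card_insert_if)
  then have B2: "B = {1, \<theta>}" using cB B(1) by (metis card_subset_eq card.infinite zero_neq_numeral)
  have Frep: "\<exists>p q. p \<in> \<rat> \<and> q \<in> \<rat> \<and> x = of_real p + of_real q * \<theta>" if "x \<in> F" for x
  proof -
    have "x \<in> V.span {1, \<theta>}" using that B(4) B2 by auto
    then obtain k where "x - rat_scale k 1 \<in> V.span {\<theta>}" by (auto simp: V.span_breakdown_eq)
    then obtain k' where "x - rat_scale k 1 = rat_scale k' \<theta>" by (auto simp: V.span_singleton)
    then have "x = of_real (of_rat k) + of_real (of_rat k') * \<theta>"
      unfolding rat_real[symmetric] by (simp add: rat_scale_def algebra_simps)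
    then show ?thesis using Rats_of_rat[of k] Rats_of_rat[of k'] by blast
  qed
  obtain r1 r2 where r: "r1 \<in> \<rat>" "r2 \<in> \<rat>" "\<theta> * \<theta> = of_real r1 + of_real r2 * \<theta>"
    using Frep[OF Fmul[OF th(1) th(1)]] by auto
  have "2 * Re \<theta> * Im \<theta> = r2 * Im \<theta>" using arg_cong[OF r(3), of Im] by simp
  then have tr: "2 * Re \<theta> = r2" using Imth by simp
  have cnjth: "cnj \<theta> = of_real r2 - \<theta>" using tr by (auto simp: complex_eq_iff)
  have Fcnj: "cnj x \<in> F" if x: "x \<in> F" for x
  proof -
    obtain p q where pq: "p \<in> \<rat>" "q \<in> \<rat>" "x = of_real p + of_real q * \<theta>" using Frep[OF x] by blast
    then have c: "cnj x = of_real p + of_real q * (of_real r2 + - \<theta>)" using cnjth by simp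
    show ?thesis unfolding c by (intro Fadd Fmul Fneg Frat pq r th)
  qed
  have Freal: "Re x \<in> \<rat>" if x: "x \<in> F" "Im x = 0" for x
  proof -
    obtain p q where pq: "p \<in> \<rat>" "q \<in> \<rat>" "x = of_real p + of_real q * \<theta>" using Frep[OF x(1)] by blast
    then show ?thesis using x(2) Imth by auto
  qed
  have Ftr: "2 * Re x \<in> \<rat>" if "x \<in> F" for x
    using Freal[of "x + cnj x"] Fadd[OF that Fcnj[OF that]] by simp
  have Fnm: "(cmod x)\<^sup>2 \<in> \<rat>" if "x \<in> F" for x
    using Freal[of "x * cnj x"] Fmul[OF that Fcnj[OF that]] by (simp add: cmod_sq)
  have nm_int: "(cmod x)\<^sup>2 \<in> \<int>" if x: "x \<in> F" "algebraic_int x" for x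
  proof -
    obtain n where n: "\<And>k. \<exists>c :: nat \<Rightarrow> int. x ^ k = (\<Sum>i<n. of_int (c i) * x ^ i)"
      using algebraic_int_powers[OF x(2)] by blast
    have Fpow: "x ^ i \<in> F" for i by (induction i) (auto intro: F0 Fmul x)
    \<comment> \<open>Each power of the norm of \<open>x\<close> is half an integral combination of
      these finitely many rationals, so twice their common denominator \<open>D\<close> clears them
      all.\<close>
    define S where "S = (\<lambda>(i, j). 2 * Re (x ^ i * cnj (x ^ j))) ` ({..<n} \<times> {..<n})"
    have Sr: "2 * Re (x ^ i * cnj (x ^ j)) \<in> \<rat>" for i j by (rule Ftr[OF Fmul[OF Fpow Fcnj[OF Fpow]]])
    have "S \<subseteq> \<rat>" unfolding S_def image_subset_iff split_beta using Sr by blast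
    then obtain D where D: "D > 0" "\<forall>s\<in>S. of_int D * s \<in> \<int>"
      using finite_common_denominator[of S] by (auto simp: S_def)
    show ?thesis
    proof (rule bounded_denominator_powers_Ints[of _ "2 * D"])
      show "(cmod x)\<^sup>2 \<in> \<rat>" using Fnm x by blast
      fix k
      obtain c :: "nat \<Rightarrow> int" where c: "x ^ k = (\<Sum>i<n. of_int (c i) * x ^ i)" using n by blast
      have "((cmod x)\<^sup>2) ^ k = (cmod (x ^ k))\<^sup>2" by (simp add: norm_power power_mult[symmetric] mult.commute)
      also have "\<dots> = Re (x ^ k * cnj (x ^ k))" by (rule cmod_sq_Re)
      also have "x ^ k * cnj (x ^ k) = (\<Sum>i<n. \<Sum>j<n. of_int (c i) * x ^ i * (of_int (c j) * cnj (x ^ j)))"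
        unfolding c by (simp add: sum_product)
      also have "Re \<dots> = (\<Sum>i<n. \<Sum>j<n. of_int (c i * c j) * Re (x ^ i * cnj (x ^ j)))"
        unfolding Re_sum
      proof (intro sum.cong refl)
        fix i j
        have "of_int (c i) * x ^ i * (of_int (c j) * cnj (x ^ j)) = of_real (of_int (c i * c j)) * (x ^ i * cnj (x ^ j))" by simp
        then show "Re (of_int (c i) * x ^ i * (of_int (c j) * cnj (x ^ j))) = of_int (c i * c j) * Re (x ^ i * cnj (x ^ j))"
          by (metis Re_complex_of_real Im_complex_of_real times_complex.simps(1) mult_zero_left diff_zero)
      qed
      finally have "of_int (2 * D) * ((cmod x)\<^sup>2) ^ k = (\<Sum>i<n. \<Sum>j<n. of_int (c i * c j) * (of_int D * (2 * Re (x ^ i * cnj (x ^ j)))))"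
        by (simp add: sum_distrib_left mult_ac)
      also have "\<dots> \<in> \<int>"
      proof (intro Ints_sum)
        fix i j assume "i \<in> {..<n}" "j \<in> {..<n}"
        then have "2 * Re (x ^ i * cnj (x ^ j)) \<in> S" unfolding S_def by (intro image_eqI[of _ _ "(i, j)"]) (simp_all only: split lessThan_iff mem_Sigma_iff)
        then have "of_int D * (2 * Re (x ^ i * cnj (x ^ j))) \<in> \<int>" using D(2) by blast
        then show "of_int (c i * c j) * (of_int D * (2 * Re (x ^ i * cnj (x ^ j)))) \<in> \<int>" by (rule Ints_mult[OF Ints_of_int])
      qed
      finally show "of_int (2 * D) * ((cmod x)\<^sup>2) ^ k \<in> \<int>" .
    qed (use D in simp)
  qed
  have tr_int: "2 * Re x \<in> \<int>" if x: "x \<in> F" "algebraic_int x" for x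
  proof -
    have "algebraic_int (x + 1)"
    proof (rule algebraic_int_root[OF x(2), of "[:-1, 1:]"])
      show "\<forall>i. coeff [:-1, 1:] i \<in> (\<int> :: complex set)" by (auto simp: coeff_pCons split: nat.splits)
    qed simp_all
    then have "(cmod (x + 1))\<^sup>2 \<in> \<int>" using x F0 Fadd by (intro nm_int) auto
    moreover have "2 * Re x = (cmod (x + 1))\<^sup>2 - (cmod x)\<^sup>2 - 1" by (simp add: cmod_sq algebra_simps)
    ultimately show ?thesis using nm_int[OF x] by simp
  qed
  define R where "R = ring_of_integers F"
  have R: "x \<in> R \<longleftrightarrow> x \<in> F \<and> 2 * Re x \<in> \<int> \<and> (cmod x)\<^sup>2 \<in> \<int>" for x
    unfolding R_def ring_of_integers_def using nm_int tr_int algebraic_int_quadratic by blast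
  have Rcnj: "cnj x \<in> R" if "x \<in> R" for x using that Fcnj by (simp add: R)
  have Radd: "x + y \<in> R" if "x \<in> R" "y \<in> R" for x y
  proof -
    have xy: "x \<in> F" "y \<in> F" using that by (auto simp: R)
    have "2 * Re (x * cnj y) \<in> \<int>" using that Ftr[OF Fmul[OF xy(1) Fcnj[OF xy(2)]]] by (intro trace_product_Ints) (auto simp: R)
    moreover have "(cmod (x + y))\<^sup>2 = (cmod x)\<^sup>2 + (cmod y)\<^sup>2 + 2 * Re (x * cnj y)" by (simp add: cmod_sq algebra_simps)
    moreover have "2 * Re (x + y) = 2 * Re x + 2 * Re y" by simp
    ultimately show ?thesis using that Fadd[OF xy] unfolding R by (simp only: Ints_add)
  qed
  have Rneg: "- x \<in> R" if "x \<in> R" for x using that Fneg by (simp add: R)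
  have Rint: "of_int n \<in> R" for n
  proof -
    have "(cmod (of_int n))\<^sup>2 = of_int (n\<^sup>2)" by (simp add: power2_eq_square)
    then show ?thesis using Fint by (simp add: R)
  qed
  have Rmul: "of_int n * x \<in> R" if x: "x \<in> R" for n x
  proof -
    have "2 * Re (of_int n * x) = of_int n * (2 * Re x)" by simp
    moreover have "(cmod (of_int n * x))\<^sup>2 = of_int (n\<^sup>2) * (cmod x)\<^sup>2" by (simp add: norm_mult power_mult_distrib power2_eq_square)
    ultimately show ?thesis using x Fint Fmul unfolding R by (simp only: Ints_mult Ints_of_int)
  qed
  have RIm: "\<exists>n::nat. 4 * (Im x)\<^sup>2 = of_nat n" if x: "x \<in> R" for x
  proof -
    obtain t m where "2 * Re x = of_int t" "(cmod x)\<^sup>2 = of_int m" using x by (auto simp: R elim!: Ints_cases)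
    then have "4 * (Im x)\<^sup>2 = 4 * of_int m - (of_int t)\<^sup>2" by (simp add: cmod_power2 flip: \<open>2 * Re x = of_int t\<close>)
    then have e: "4 * (Im x)\<^sup>2 = of_int (4 * m - t\<^sup>2)" by simp
    then have "4 * m - t\<^sup>2 \<ge> 0" by (metis of_int_0_le_iff zero_le_power2 mult_nonneg_nonneg zero_le_numeral)
    then show ?thesis using e by (metis of_int_of_nat_eq nonneg_int_cases)
  qed
  have Rreal: "\<exists>n. x = of_int n" if "x \<in> R" "Im x = 0" for x
  proof -
    have "Re x \<in> \<rat>" "(Re x)\<^sup>2 \<in> \<int>" using that Freal by (auto simp: R cmod_power2)
    then have "Re x \<in> \<int>" by (rule Rats_power2_Ints)
    then show ?thesis using that by (auto simp: complex_eq_iff elim!: Ints_cases)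
  qed
  have "\<exists>x0\<in>R. Im x0 > 0"
  proof -
    obtain D where D: "D > 0" "\<forall>s\<in>{2 * Re \<theta>, (cmod \<theta>)\<^sup>2}. of_int D * s \<in> \<int>"
      using finite_common_denominator[of "{2 * Re \<theta>, (cmod \<theta>)\<^sup>2}"] Ftr[OF th(1)] Fnm[OF th(1)] by auto
    have "2 * Re (of_int D * \<theta>) = of_int D * (2 * Re \<theta>)"
      "(cmod (of_int D * \<theta>))\<^sup>2 = of_int D * (of_int D * (cmod \<theta>)\<^sup>2)"
      by (simp_all add: norm_mult power_mult_distrib power2_eq_square)
    then have "of_int D * \<theta> \<in> R" unfolding R using D Fmul[OF Fint th(1), of D] by (metis Ints_mult Ints_of_int insertCI)
    moreover have "Im (of_int D * \<theta>) \<noteq> 0" using D Imth by simp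
    ultimately obtain u where u: "u \<in> R" "Im u \<noteq> 0" by blast
    show ?thesis
    proof (cases "Im u > 0")
      case False
      then have "Im (- u) > 0" using u by simp
      then show ?thesis using Rneg[OF u(1)] by blast
    qed (use u in blast)
  qed
  \<comment> \<open>As \<open>4 (Im x)\<^sup>2\<close> is a natural number on \<open>R\<close>, a
    least positive imaginary part exists.\<close>
  then have "\<exists>n x. x \<in> R \<and> Im x > 0 \<and> 4 * (Im x)\<^sup>2 = of_nat n" using RIm by blast
  then obtain n where n: "\<exists>x. x \<in> R \<and> Im x > 0 \<and> 4 * (Im x)\<^sup>2 = of_nat n"
    "\<And>m. m < n \<Longrightarrow> \<not> (\<exists>x. x \<in> R \<and> Im x > 0 \<and> 4 * (Im x)\<^sup>2 = of_nat m)"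
    using exists_least_iff[of "\<lambda>n. \<exists>x. x \<in> R \<and> Im x > 0 \<and> 4 * (Im x)\<^sup>2 = of_nat n"] by blast
  then obtain x0 where x0: "x0 \<in> R" "Im x0 > 0" "4 * (Im x0)\<^sup>2 = of_nat n" by blast
  define w where "w = x0 + of_int (- \<lfloor>Re x0\<rfloor>)"
  have wR: "w \<in> R" unfolding w_def by (intro Radd x0 Rint)
  have Imw: "Im w = Im x0" by (simp add: w_def)
  have min: "Im x = 0" if x: "x \<in> R" "0 \<le> Im x" "Im x < Im w" for x
  proof (rule ccontr)
    assume "Im x \<noteq> 0"
    then have p: "Im x > 0" using x by simp
    obtain m where m: "4 * (Im x)\<^sup>2 = of_nat m" using RIm[OF x(1)] by blast
    have "(Im x)\<^sup>2 < (Im x0)\<^sup>2" using x Imw by (intro power_strict_mono) auto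
    then have "real m < real n" using m x0 by linarith
    then show False using n(2)[of m] x p m by auto
  qed
  have Rw: "R = quad_ints w"
  proof (intro set_eqI iffI)
    fix x assume x: "x \<in> R"
    define k where "k = \<lfloor>Im x / Im w\<rfloor>"
    define u where "u = x + - (of_int k * w)"
    have u: "u \<in> R" unfolding u_def by (intro Radd Rneg Rmul x wR)
    have w0: "Im w > 0" using Imw x0 by simp
    have "of_int k \<le> Im x / Im w" "Im x / Im w < of_int k + 1" unfolding k_def by linarith+
    then have "0 \<le> Im u" "Im u < Im w" using w0 by (simp_all add: u_def field_simps)
    then have "Im u = 0" using min u by blast
    then obtain m where "u = of_int m" using Rreal u by blast
    then have "x = of_int m + of_int k * w" by (simp add: u_def algebra_simps)
    then show "x \<in> quad_ints w" by (auto simp: quad_ints_def)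
  next
    fix x assume "x \<in> quad_ints w"
    then show "x \<in> R" using Radd Rmul Rint wR by (auto simp: quad_ints_def)
  qed
  have "quad_ring w"
  proof
    show "Im w > 0" using Imw x0 by simp
    show "0 \<le> Re w" "Re w < 1" unfolding w_def by simp_all linarith+
    show "2 * Re w \<in> \<int>" "(cmod w)\<^sup>2 \<in> \<int>" using wR by (auto simp: R)
    fix u and n :: int
    assume u: "u \<in> quad_ints w" "n > 0" "2 * Re (u / of_int n) \<in> \<int>" "(cmod (u / of_int n))\<^sup>2 \<in> \<int>"
    have "u / of_int n \<in> F" using u(1) Fmul[OF _ Finv[OF Fint[of n]], of u] by (simp add: Rw[symmetric] R divide_inverse)
    then show "u / of_int n \<in> quad_ints w" using u by (simp add: Rw[symmetric] R)
  qed
  then show ?thesis using that Rw by (simp add: R_def)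
qed

lemma quad_ints_iff: "x \<in> quad_ints w \<longleftrightarrow> (\<exists>a b. x = of_int a + of_int b * w)"
  by (auto simp: quad_ints_def)

lemma countable_quad_ints: "countable (quad_ints w)"
proof -
  have "quad_ints w = (\<lambda>(a, b). of_int a + of_int b * w) ` UNIV" by (auto simp: quad_ints_def)
  then show ?thesis by simp
qed

section \<open>Arithmetic and lattice points in the ring \<open>\<int> + \<int> w\<close>\<close>

context quad_ring
begin

abbreviation "\<O> \<equiv> quad_ints w"
abbreviation "y \<equiv> Im w"

lemma O_int [simp]: "of_int n \<in> \<O>" "0 \<in> \<O>" "1 \<in> \<O>" "w \<in> \<O>"
proof -
  show n: "of_int n \<in> \<O>" for n unfolding quad_ints_iff by (intro exI[of _ n] exI[of _ 0]) simp
  show "0 \<in> \<O>" "1 \<in> \<O>" using n[of 0] n[of 1] by simp_all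
  show "w \<in> \<O>" unfolding quad_ints_iff by (intro exI[of _ 0] exI[of _ 1]) simp
qed

lemma O_add: "x \<in> \<O> \<Longrightarrow> z \<in> \<O> \<Longrightarrow> x + z \<in> \<O>"
  unfolding quad_ints_iff
proof (elim exE)
  fix a b a' b' assume "x = of_int a + of_int b * w" "z = of_int a' + of_int b' * w"
  then have "x + z = of_int (a + a') + of_int (b + b') * w" by (simp add: algebra_simps)
  then show "\<exists>a b. x + z = of_int a + of_int b * w" by blast
qed

lemma O_minus: "x \<in> \<O> \<Longrightarrow> - x \<in> \<O>"
  unfolding quad_ints_iff
proof (elim exE)
  fix a b assume "x = of_int a + of_int b * w"
  then have "- x = of_int (- a) + of_int (- b) * w" by simp
  then show "\<exists>a b. - x = of_int a + of_int b * w" by blast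
qed

lemma O_diff: "x \<in> \<O> \<Longrightarrow> z \<in> \<O> \<Longrightarrow> x - z \<in> \<O>"
  using O_add[of x "- z"] O_minus[of z] by simp

lemma cnj_w: obtains \<tau> \<nu> where "cnj w = of_int \<tau> - w" "w * w = of_int \<tau> * w - of_int \<nu>"
    "2 * Re w = of_int \<tau>" "(cmod w)\<^sup>2 = of_int \<nu>"
proof -
  obtain \<tau> \<nu> where t: "2 * Re w = of_int \<tau>" "(cmod w)\<^sup>2 = of_int \<nu>" using tr_w nm_w by (auto elim!: Ints_cases)
  have c: "cnj w = of_int \<tau> - w" using t(1) by (simp add: complex_eq_iff)
  have "w * cnj w = of_int \<nu>" using t(2) by (metis complex_norm_square of_real_of_int_eq)
  then have "w * w = of_int \<tau> * w - of_int \<nu>" unfolding c by (simp add: algebra_simps)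
  then show ?thesis using that c t by blast
qed

lemma O_mult: "x \<in> \<O> \<Longrightarrow> z \<in> \<O> \<Longrightarrow> x * z \<in> \<O>"
  unfolding quad_ints_iff
proof (elim exE)
  obtain \<tau> \<nu> where ww: "w * w = of_int \<tau> * w - of_int \<nu>" using cnj_w by blast
  fix a b a' b' assume xz: "x = of_int a + of_int b * w" "z = of_int a' + of_int b' * w"
  have "x * z = of_int a * of_int a' + (of_int a * of_int b' + of_int b * of_int a') * w + of_int b * of_int b' * (w * w)"
    unfolding xz by (simp add: algebra_simps)
  also have "\<dots> = of_int (a * a' - b * b' * \<nu>) + of_int (a * b' + b * a' + b * b' * \<tau>) * w"
    unfolding ww by (simp add: algebra_simps)
  finally show "\<exists>a b. x * z = of_int a + of_int b * w" by blast
qed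

lemma O_cnj: "x \<in> \<O> \<Longrightarrow> cnj x \<in> \<O>"
proof -
  assume "x \<in> \<O>"
  then obtain a b where x: "x = of_int a + of_int b * w" by (auto simp: quad_ints_iff)
  obtain \<tau> where "cnj w = of_int \<tau> - w" using cnj_w by blast
  then have "cnj x = of_int a + of_int b * (of_int \<tau> - w)" unfolding x by simp
  then show ?thesis by (simp add: O_add O_mult O_diff)
qed

lemma O_real:
  assumes "x \<in> \<O>" "Im x = 0"
  obtains n where "x = of_int n"
proof -
  obtain a b where x: "x = of_int a + of_int b * w" using assms(1) by (auto simp: quad_ints_iff)
  then have "of_int b * Im w = 0" using assms(2) by simp
  then have "b = 0" using Im_w by simp
  then show ?thesis using that x by simp
qed

lemma O_norm:
  assumes "x \<in> \<O>"
  obtains n :: nat where "(cmod x)\<^sup>2 = of_nat n" "x * cnj x = of_nat n"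
proof -
  have "x * cnj x \<in> \<O>" using assms by (simp add: O_mult O_cnj)
  moreover have "Im (x * cnj x) = 0" by simp
  ultimately obtain n where n: "x * cnj x = of_int n" using O_real by blast
  then have "complex_of_real ((cmod x)\<^sup>2) = complex_of_real (of_int n)" by (simp add: complex_norm_square[symmetric])
  then have nn: "(cmod x)\<^sup>2 = of_int n" by (simp only: of_real_eq_iff)
  then have "n \<ge> 0" by (metis of_int_0_le_iff zero_le_power2)
  then have "(cmod x)\<^sup>2 = of_nat (nat n)" "x * cnj x = of_nat (nat n)" using n nn by simp_all
  then show ?thesis using that by blast
qed

lemma O_tr:
  assumes "x \<in> \<O>"
  obtains n :: int where "2 * Re x = of_int n" "x + cnj x = of_int n"
proof -
  have "x + cnj x \<in> \<O>" using assms by (simp add: O_add O_cnj)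
  moreover have "Im (x + cnj x) = 0" by simp
  ultimately obtain n where n: "x + cnj x = of_int n" using O_real by blast
  have "2 * Re x = of_int n" using arg_cong[OF n, of Re] by simp
  then show ?thesis using that n by blast
qed

lemma O_norm_ge1:
  assumes "x \<in> \<O>" "x \<noteq> 0"
  shows "cmod x \<ge> 1"
proof -
  obtain n :: nat where n: "(cmod x)\<^sup>2 = of_nat n" using O_norm[OF assms(1)] by blast
  have "n \<noteq> 0"
  proof
    assume "n = 0"
    then have "(cmod x)\<^sup>2 = 0" using n by simp
    then show False using assms(2) by simp
  qed
  then have "1 \<le> (cmod x)\<^sup>2" unfolding n by simp
  then show ?thesis by (metis norm_ge_zero one_le_power one_power2 power2_le_imp_le)
qed

text \<open>\<open>4 y\<^sup>2\<close> is the absolute discriminant, a positive integer that is 0 or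
  3 modulo 4; the Eisenstein integers attain 3.\<close>

lemma y_sq: "y\<^sup>2 \<ge> 3 / 4"
proof -
  obtain \<tau> \<nu> where t: "2 * Re w = of_int \<tau>" "(cmod w)\<^sup>2 = of_int \<nu>" using cnj_w by blast
  have "0 \<le> \<tau>" "\<tau> < 2" using t(1) Re_w by linarith+
  then have tau: "\<tau> = 0 \<or> \<tau> = 1" by auto
  have "4 * y\<^sup>2 = 4 * (cmod w)\<^sup>2 - (2 * Re w)\<^sup>2" by (simp add: cmod_power2)
  also have "\<dots> = of_int (4 * \<nu> - \<tau>\<^sup>2)" unfolding t by simp
  finally have e: "4 * y\<^sup>2 = of_int (4 * \<nu> - \<tau>\<^sup>2)" .
  have "0 < 4 * y\<^sup>2" using Im_w by simp
  then have "4 * \<nu> - \<tau>\<^sup>2 > 0" unfolding e by (simp only: of_int_0_less_iff)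
  then have "4 * \<nu> - \<tau>\<^sup>2 \<ge> 3"
    using tau by (elim disjE; hypsubst; simp only: power2_eq_square mult_zero_left mult_1; presburger)
  then have "4 * y\<^sup>2 \<ge> 3" unfolding e by linarith
  then show ?thesis by simp
qed

lemma y_ge: "y \<ge> 4 / 5"
proof (rule power2_le_imp_le)
  show "(4 / 5)\<^sup>2 \<le> y\<^sup>2" using y_sq by (simp add: power2_eq_square)
qed (use Im_w in simp)

lemma cmod_w: "cmod w \<le> 3 * y"
proof -
  have "cmod w \<le> \<bar>Re w\<bar> + \<bar>Im w\<bar>" by (rule cmod_le)
  then show ?thesis using Re_w Im_w y_ge by linarith
qed

lemma coord_bounds:
  assumes "x = of_int a + of_int b * w" "cmod x \<le> r"
  shows "\<bar>of_int b\<bar> \<le> r / y" "\<bar>of_int a\<bar> \<le> r + r / y * cmod w"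
proof -
  have "\<bar>Im x\<bar> \<le> r" using abs_Im_le_cmod[of x] assms(2) by linarith
  then have "\<bar>of_int b\<bar> * y \<le> r" using Im_w assms(1) by (simp add: abs_mult)
  then show b: "\<bar>of_int b\<bar> \<le> r / y" using Im_w by (simp add: field_simps)
  have "of_int a = x - of_int b * w" using assms(1) by simp
  then have "\<bar>of_int a\<bar> \<le> cmod x + cmod (of_int b * w)" by (metis norm_triangle_ineq4 norm_of_int)
  also have "cmod (of_int b * w) = \<bar>of_int b\<bar> * cmod w" by (simp add: norm_mult)
  also have "cmod x + \<dots> \<le> r + r / y * cmod w" using b assms(2) by (intro add_mono mult_right_mono) auto
  finally show "\<bar>of_int a\<bar> \<le> r + r / y * cmod w" .
qed

lemma finite_O_ball: "finite {x \<in> \<O>. cmod x \<le> r}"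
proof -
  define N where "N = \<lceil>r + r / y * cmod w\<rceil> + \<lceil>r / y\<rceil>"
  have "{x \<in> \<O>. cmod x \<le> r} \<subseteq> (\<lambda>(a, b). of_int a + of_int b * w) ` ({- \<lceil>r + r / y * cmod w\<rceil>..\<lceil>r + r / y * cmod w\<rceil>} \<times> {- \<lceil>r / y\<rceil>..\<lceil>r / y\<rceil>})"
  proof
    fix x assume x: "x \<in> {x \<in> \<O>. cmod x \<le> r}"
    then obtain a b where ab: "x = of_int a + of_int b * w" by (auto simp: quad_ints_iff)
    have "\<bar>of_int b\<bar> \<le> r / y" "\<bar>of_int a\<bar> \<le> r + r / y * cmod w" using coord_bounds[OF ab, of r] x by auto
    then have "\<bar>b\<bar> \<le> \<lceil>r / y\<rceil>" "\<bar>a\<bar> \<le> \<lceil>r + r / y * cmod w\<rceil>" by linarith+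
    then show "x \<in> (\<lambda>(a, b). of_int a + of_int b * w) ` ({- \<lceil>r + r / y * cmod w\<rceil>..\<lceil>r + r / y * cmod w\<rceil>} \<times> {- \<lceil>r / y\<rceil>..\<lceil>r / y\<rceil>})"
      using ab by (intro image_eqI[of _ _ "(a, b)"]) auto
  qed
  then show ?thesis by (rule finite_subset) simp
qed

text \<open>Each horizontal line meets a circle in at most two points.\<close>

lemma card_O_circle:
  assumes "r \<ge> 0"
  shows "real (card {x \<in> \<O>. cmod x = r}) \<le> 4 * r / y + 2"
proof -
  define M where "M = \<lfloor>r / y\<rfloor>"
  have M: "M \<ge> 0" unfolding M_def using assms Im_w by simp
  define f where "f = (\<lambda>(b :: int, s :: real). Complex (s * sqrt (r\<^sup>2 - (of_int b * y)\<^sup>2)) (of_int b * y))"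
  have "{x \<in> \<O>. cmod x = r} \<subseteq> f ` ({- M..M} \<times> {1, - 1})"
  proof
    fix x assume x: "x \<in> {x \<in> \<O>. cmod x = r}"
    then obtain a b where ab: "x = of_int a + of_int b * w" by (auto simp: quad_ints_iff)
    have "\<bar>of_int b\<bar> \<le> r / y" using coord_bounds(1)[OF ab, of r] x by auto
    then have b: "\<bar>b\<bar> \<le> M" unfolding M_def by linarith
    have Ix: "Im x = of_int b * y" using ab by simp
    have "(Re x)\<^sup>2 + (Im x)\<^sup>2 = r\<^sup>2" using x by (simp add: cmod_power2[symmetric])
    then have "r\<^sup>2 - (of_int b * y)\<^sup>2 = (Re x)\<^sup>2" unfolding Ix by simp
    then have s: "sqrt (r\<^sup>2 - (of_int b * y)\<^sup>2) = \<bar>Re x\<bar>" by simp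
    have "x = f (b, if Re x \<ge> 0 then 1 else - 1)" unfolding f_def split s using Ix by (simp add: complex_eq_iff)
    then show "x \<in> f ` ({- M..M} \<times> {1, - 1})" using b by (intro image_eqI[of _ _ "(b, if Re x \<ge> 0 then 1 else - 1)"]) auto
  qed
  then have "card {x \<in> \<O>. cmod x = r} \<le> card ({- M..M} \<times> {1, - 1 :: real})"
    by (intro surj_card_le) auto
  also have "\<dots> = nat (2 * M + 1) * 2" by (simp add: card_cartesian_product)
  finally have "real (card {x \<in> \<O>. cmod x = r}) \<le> (2 * of_int M + 1) * 2" using M by (simp add: nat_add_distrib nat_mult_distrib)
  also have "\<dots> \<le> (2 * (r / y) + 1) * 2" unfolding M_def by (intro mult_right_mono add_mono mult_left_mono of_int_floor_le) simp_all
  finally show ?thesis by simp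
qed

lemma finite_hq_le:
  assumes p: "p \<in> H3"
  shows "finite {(c, d). c \<in> \<O> \<and> d \<in> \<O> \<and> hq p c d \<le> r}"
proof -
  define z t where zt: "z = fst p" "t = snd p"
  have t: "t > 0" using p by (simp add: zt mem_H3)
  define C where "C = sqrt (\<bar>r\<bar> * t) / t"
  define E where "E = sqrt (\<bar>r\<bar> * t) + C * cmod z"
  have "{(c, d). c \<in> \<O> \<and> d \<in> \<O> \<and> hq p c d \<le> r} \<subseteq> {x \<in> \<O>. cmod x \<le> C} \<times> {x \<in> \<O>. cmod x \<le> E}"
  proof (clarsimp)
    fix c d assume "c \<in> \<O>" "d \<in> \<O>" "hq p c d \<le> r"
    then have h: "(cmod (c * z + d))\<^sup>2 + (cmod c * t)\<^sup>2 \<le> \<bar>r\<bar> * t"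
      using t by (simp add: hq_def zt[symmetric] divide_le_eq power_mult_distrib) (smt (verit) mult_right_mono)
    have "cmod c * t \<le> sqrt (\<bar>r\<bar> * t)" using h by (intro real_le_rsqrt) (smt (verit) zero_le_power2)
    then have c: "cmod c \<le> C" using t by (simp add: C_def field_simps)
    have "cmod (c * z + d) \<le> sqrt (\<bar>r\<bar> * t)" using h by (intro real_le_rsqrt) (smt (verit) zero_le_power2)
    moreover have "cmod d \<le> cmod (c * z + d) + cmod (c * z)"
      by (metis add_diff_cancel_left' norm_triangle_ineq4)
    moreover have "cmod (c * z) \<le> C * cmod z" using c by (simp add: norm_mult mult_right_mono)
    ultimately have "cmod d \<le> E" by (simp add: E_def)
    with c show "cmod c \<le> C \<and> cmod d \<le> E" by simp
  qed
  then show ?thesis by (rule finite_subset) (intro finite_cartesian_product finite_O_ball)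
qed

section \<open>The group as a discrete group\<close>

definition "\<Gamma> = SL2 \<O>"

lemma \<Gamma>_iff: "A \<in> \<Gamma> \<longleftrightarrow> A $ 1 $ 1 \<in> \<O> \<and> A $ 1 $ 2 \<in> \<O> \<and> A $ 2 $ 1 \<in> \<O> \<and> A $ 2 $ 2 \<in> \<O> \<and> det A = 1"
  by (auto simp: \<Gamma>_def SL2_def forall_2)

lemma inj_entries: "inj_on (\<lambda>A :: complex ^ 2 ^ 2. ((A $ 1 $ 1, A $ 1 $ 2), (A $ 2 $ 1, A $ 2 $ 2))) X"
  by (rule inj_onI) (auto simp: mat2_eq_iff)

sublocale discrete_group \<Gamma>
proof
  show "det A = 1" if "A \<in> \<Gamma>" for A using that by (simp add: \<Gamma>_iff)
  show "mat 1 \<in> \<Gamma>" by (simp add: \<Gamma>_iff mat_def det2)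
  show "A ** B \<in> \<Gamma>" if "A \<in> \<Gamma>" "B \<in> \<Gamma>" for A B
    using that by (simp add: \<Gamma>_iff matrix_mult_2 O_add O_mult det_mul)
  show "adj2 A \<in> \<Gamma>" if "A \<in> \<Gamma>" for A using that by (simp add: \<Gamma>_iff O_minus)
  have "(\<lambda>A :: complex ^ 2 ^ 2. ((A $ 1 $ 1, A $ 1 $ 2), (A $ 2 $ 1, A $ 2 $ 2))) ` \<Gamma> \<subseteq> (\<O> \<times> \<O>) \<times> (\<O> \<times> \<O>)"
    by (auto simp: \<Gamma>_iff)
  moreover have "countable ((\<O> \<times> \<O>) \<times> (\<O> \<times> \<O>))" using countable_quad_ints by (intro countable_SIGMA) auto
  ultimately show "countable \<Gamma>"
    by (intro countable_image_inj_on[OF _ inj_entries]) (rule countable_subset)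
  show "finite {A \<in> \<Gamma>. height_sum (hyp_act A p) \<le> r}" if p: "p \<in> H3" for p r
  proof -
    let ?S = "{(c, d). c \<in> \<O> \<and> d \<in> \<O> \<and> hq p c d \<le> r}"
    have "(\<lambda>A :: complex ^ 2 ^ 2. ((A $ 1 $ 1, A $ 1 $ 2), (A $ 2 $ 1, A $ 2 $ 2))) ` {A \<in> \<Gamma>. height_sum (hyp_act A p) \<le> r} \<subseteq> ?S \<times> ?S"
    proof (rule image_subsetI)
      fix A assume A: "A \<in> {A \<in> \<Gamma>. height_sum (hyp_act A p) \<le> r}"
      have nn: "hq p c d \<ge> 0" for c d using p by (simp add: hq_def mem_H3)
      have "height_sum (hyp_act A p) = hq p (A $ 1 $ 1) (A $ 1 $ 2) + hq p (A $ 2 $ 1) (A $ 2 $ 2)"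
        using A p by (simp add: height_sum_def hq_hyp_act \<Gamma>_iff)
      then have "hq p (A $ 1 $ 1) (A $ 1 $ 2) \<le> r" "hq p (A $ 2 $ 1) (A $ 2 $ 2) \<le> r"
        using A nn[of "A $ 1 $ 1" "A $ 1 $ 2"] nn[of "A $ 2 $ 1" "A $ 2 $ 2"] by auto
      then show "((A $ 1 $ 1, A $ 1 $ 2), (A $ 2 $ 1, A $ 2 $ 2)) \<in> ?S \<times> ?S"
        using A by (auto simp: \<Gamma>_iff)
    qed
    moreover have "finite (?S \<times> ?S)" using finite_hq_le[OF p] by simp
    ultimately show ?thesis by (metis (no_types, lifting) finite_imageD finite_subset inj_entries)
  qed
qed

end

section \<open>The lower bound for the volume\<close>

lemma emeasure_lborel_complex_cbox:
  assumes "a \<le> b" "c \<le> d"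
  shows "emeasure lborel (cbox (Complex a c) (Complex b d)) = ennreal ((b - a) * (d - c))"
  using assms by (simp add: emeasure_lborel_cbox_eq Basis_complex_def inner_complex_def)

lemma mem_cbox_complex: "z \<in> cbox (Complex a c) (Complex b d) \<longleftrightarrow> a \<le> Re z \<and> Re z \<le> b \<and> c \<le> Im z \<and> Im z \<le> d"
  by (simp add: in_cbox_complex_iff)

context quad_ring
begin

lemma card_units: "finite {x \<in> \<O>. cmod x = 1}" "card {x \<in> \<O>. cmod x = 1} \<le> 7"
proof -
  show "finite {x \<in> \<O>. cmod x = 1}" using finite_O_ball[of 1] by (rule finite_subset[rotated]) auto
  have "1 / y \<le> 5 / 4" using y_ge Im_w by (simp add: field_simps)
  then have "4 * 1 / y + 2 \<le> 7" by simp
  then have "real (card {x \<in> \<O>. cmod x = 1}) \<le> 7" using card_O_circle[of 1] by linarith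
  then show "card {x \<in> \<O>. cmod x = 1} \<le> 7" by linarith
qed

lemma O_unit:
  assumes "x \<in> \<O>" "z \<in> \<O>" "x * z = 1"
  shows "cmod x = 1"
proof -
  have "cmod x * cmod z = 1" using assms(3) by (metis norm_mult norm_one)
  moreover have "x \<noteq> 0" "z \<noteq> 0" using assms(3) by auto
  then have "cmod x \<ge> 1" "cmod z \<ge> 1" using assms O_norm_ge1 by blast+
  ultimately show ?thesis by (smt (verit) mult_le_cancel_left1)
qed

text \<open>Above a point of \<open>good\<close>, an element of \<open>\<Gamma>\<close> that maps a point of height between \<open>48 / y\<close> and \<open>96 / y\<close>
  to one of height at least \<open>48 / y\<close> must fix infinity: its lower left entry would be a rational integer \<open>k\<close>
  with \<open>k z\<close> close to the ring.\<close>

definition rect :: "complex set" where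
  "rect = {z. 0 \<le> Re z \<and> Re z < 1 \<and> 0 \<le> Im z \<and> Im z < y}"

definition good :: "complex set" where
  "good = {z \<in> rect. \<forall>k::nat. 1 \<le> k \<and> real k \<le> y / 24 \<longrightarrow> (\<forall>j::int. \<bar>real k * Im z - of_int j * y\<bar> > 3 / 2)}"

lemma rect_borel [measurable]: "rect \<in> sets borel"
  unfolding rect_def by measurable

lemma good_borel [measurable]: "good \<in> sets borel"
  unfolding good_def by measurable

lemma rect_measure: "ennreal y \<le> emeasure lborel rect"
proof -
  have "emeasure lborel (box 0 (Complex 1 y)) = ennreal y"
    using Im_w by (simp add: emeasure_lborel_box_eq Basis_complex_def inner_complex_def)
  moreover have "box 0 (Complex 1 y) \<subseteq> rect" by (auto simp: in_box_complex_iff rect_def)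
  ultimately show ?thesis by (metis emeasure_mono rect_borel sets_lborel)
qed

lemma good_measure: "ennreal (y / 2) \<le> emeasure lborel good" and good_measure_finite: "emeasure lborel good \<noteq> \<infinity>"
proof -
  define n where "n = nat \<lfloor>y / 24\<rfloor>"
  have n: "real n \<le> y / 24" unfolding n_def using of_int_floor_le[of "y / 24"] Im_w by simp
  define S where "S k j = cbox (Complex 0 ((of_int j * y - 3 / 2) / real k)) (Complex 1 ((of_int j * y + 3 / 2) / real k))" for k :: nat and j :: int
  have S: "emeasure lborel (S k j) = ennreal (3 / real k)" if "k \<ge> 1" for k j
  proof -
    have "(of_int j * y - 3 / 2) / real k \<le> (of_int j * y + 3 / 2) / real k" by (rule divide_right_mono) auto
    then have "emeasure lborel (S k j) = ennreal ((of_int j * y + 3 / 2) / real k - (of_int j * y - 3 / 2) / real k)"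
      unfolding S_def by (subst emeasure_lborel_complex_cbox) auto
    also have "(of_int j * y + 3 / 2) / real k - (of_int j * y - 3 / 2) / real k = 3 / real k"
      unfolding diff_divide_distrib[symmetric] by simp
    finally show ?thesis .
  qed
  have cov: "rect \<subseteq> good \<union> (\<Union>k\<in>{1..n}. \<Union>j\<in>{- 1..int k + 1}. S k j)"
  proof
    fix z assume z: "z \<in> rect"
    show "z \<in> good \<union> (\<Union>k\<in>{1..n}. \<Union>j\<in>{- 1..int k + 1}. S k j)"
    proof (cases "z \<in> good")
      case False
      then obtain k :: nat and j :: int where kj: "1 \<le> k" "real k \<le> y / 24" "\<bar>real k * Im z - of_int j * y\<bar> \<le> 3 / 2"
        using z by (force simp: good_def not_less)
      have kn: "k \<le> n" unfolding n_def using kj(2) by (simp add: le_nat_floor)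
      \<comment> \<open>A bad \<open>k \<ge> 1\<close> exists only for large \<open>y\<close>; then
        3/2 is small against \<open>y\<close>, which confines \<open>j\<close> to the range from -1
        to \<open>k + 1\<close>.\<close>
      have y24: "y \<ge> 24" using kj by linarith
      have a: "0 \<le> real k * Im z" "real k * Im z \<le> real k * y" using z by (auto simp: rect_def intro!: mult_left_mono)
      have "(- 2) * y < of_int j * y" using kj(3) a y24 by linarith
      then have "- 2 < real_of_int j" by (simp only: mult_less_cancel_right_pos[OF Im_w])
      then have j1: "- 1 \<le> j" by linarith
      have "of_int j * y < (real k + 2) * y" using kj(3) a y24 unfolding ring_distribs by linarith
      then have "of_int j < real k + 2" by (simp only: mult_less_cancel_right_pos[OF Im_w])
      then have j2: "j \<le> int k + 1" by linarith
      have "z \<in> S k j"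
      proof -
        have "of_int j * y - 3 / 2 \<le> Im z * real k" "Im z * real k \<le> of_int j * y + 3 / 2"
          using kj(3) unfolding mult.commute[of "Im z"] by linarith+
        then show ?thesis using z kj(1)
          unfolding S_def mem_cbox_complex by (auto simp: rect_def pos_divide_le_eq pos_le_divide_eq)
      qed
      then show ?thesis using kn j1 j2 kj(1) by auto
    qed auto
  qed
  have Sb [measurable]: "S k j \<in> sets borel" for k j unfolding S_def by simp
  have "emeasure lborel (\<Union>k\<in>{1..n}. \<Union>j\<in>{- 1..int k + 1}. S k j) \<le> (\<Sum>k\<in>{1..n}. emeasure lborel (\<Union>j\<in>{- 1..int k + 1}. S k j))"
    by (intro emeasure_subadditive_finite) auto
  also have "\<dots> \<le> (\<Sum>k\<in>{1..n}. \<Sum>j\<in>{- 1..int k + 1}. emeasure lborel (S k j))"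
    by (intro sum_mono emeasure_subadditive_finite) auto
  also have "\<dots> = (\<Sum>k\<in>{1..n}. ennreal (real (k + 3) * (3 / real k)))"
  proof (intro sum.cong refl)
    fix k assume k: "k \<in> {1..n}"
    have "(\<Sum>j\<in>{- 1..int k + 1}. emeasure lborel (S k j)) = (\<Sum>j\<in>{- 1..int k + 1}. ennreal (3 / real k))"
      using S k by (intro sum.cong) auto
    also have "\<dots> = of_nat (k + 3) * ennreal (3 / real k)" by (simp add: nat_add_distrib add.commute)
    also have "\<dots> = ennreal (real (k + 3) * (3 / real k))"
      by (subst ennreal_mult) (auto simp: ennreal_of_nat_eq_real_of_nat)
    finally show "(\<Sum>j\<in>{- 1..int k + 1}. emeasure lborel (S k j)) = ennreal (real (k + 3) * (3 / real k))" .
  qed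
  \<comment> \<open>For each \<open>k\<close> there are \<open>k + 3\<close> strips of height
    \<open>3 / k\<close>, of total area at most 12. Over \<open>k \<le> y / 24\<close> this removes
    at most half of the rectangle, which fixes the constant 24.\<close>
  also have "\<dots> \<le> (\<Sum>k\<in>{1..n}. ennreal 12)"
    by (intro sum_mono ennreal_leI) (auto simp: field_simps)
  also have "\<dots> = ennreal (real n * 12)" by (simp add: ennreal_mult ennreal_of_nat_eq_real_of_nat)
  also have "\<dots> \<le> ennreal (y / 2)" using n by (intro ennreal_leI) simp
  finally have bad: "emeasure lborel (\<Union>k\<in>{1..n}. \<Union>j\<in>{- 1..int k + 1}. S k j) \<le> ennreal (y / 2)" .
  have "emeasure lborel rect \<le> emeasure lborel (good \<union> (\<Union>k\<in>{1..n}. \<Union>j\<in>{- 1..int k + 1}. S k j))"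
    by (intro emeasure_mono cov) auto
  also have "\<dots> \<le> emeasure lborel good + emeasure lborel (\<Union>k\<in>{1..n}. \<Union>j\<in>{- 1..int k + 1}. S k j)"
    by (intro emeasure_subadditive) auto
  also have "\<dots> \<le> emeasure lborel good + ennreal (y / 2)" using bad by (intro add_left_mono)
  finally have "ennreal y \<le> emeasure lborel good + ennreal (y / 2)" using rect_measure by (rule order_trans[rotated])
  moreover have "ennreal y = ennreal (y / 2) + ennreal (y / 2)" using Im_w by (simp add: ennreal_plus[symmetric] del: ennreal_plus)
  ultimately show "ennreal (y / 2) \<le> emeasure lborel good" by (simp add: add.commute ennreal_add_left_cancel_le)
  have "good \<subseteq> cbox 0 (Complex 1 y)" by (auto simp: good_def rect_def in_cbox_complex_iff)
  then have "emeasure lborel good \<le> emeasure lborel (cbox 0 (Complex 1 y))" by (intro emeasure_mono) auto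
  also have "\<dots> < \<infinity>" by (simp add: emeasure_lborel_cbox_eq)
  finally show "emeasure lborel good \<noteq> \<infinity>" by simp
qed

lemma volume_lower_bound: "ennreal (y ^ 3 / 100000) \<le> emeasure hyp_volume fd"
proof -
  \<comment> \<open>For two heights between \<open>t0\<close> and \<open>2 t0\<close>, the lower
    left entry has modulus at most \<open>(3 / 2) / t0 = y / 32\<close>. This is too small for a
    \<open>w\<close>-component and lies within the range \<open>k \<le> y / 24\<close> excluded by
    \<open>good\<close>.\<close>
  define t0 where "t0 = 48 / y"
  have t0: "t0 > 0" using Im_w by (simp add: t0_def)
  define U where "U = {p. fst p \<in> good \<and> t0 \<le> snd p \<and> snd p \<le> 2 * t0}"
  have Ub: "U \<in> sets borel" unfolding U_def by measurable
  have UH: "U \<subseteq> H3" using t0 by (auto simp: U_def mem_H3)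
  have U: "U \<in> sets hyp_volume" using Ub UH by (simp add: sets_hyp_volume)
  have K: "finite {A \<in> \<Gamma>. hyp_act A p \<in> U} \<and> card {A \<in> \<Gamma>. hyp_act A p \<in> U} \<le> 7" if p: "p \<in> U" for p
  proof -
    have pH: "p \<in> H3" using p UH by auto
    have lower: "A $ 2 $ 1 = 0" if A: "A \<in> \<Gamma>" "hyp_act A p \<in> U" for A
    proof -
      define c d where cd: "c = A $ 2 $ 1" "d = A $ 2 $ 2"
      have O: "c \<in> \<O>" "d \<in> \<O>" using A by (auto simp: \<Gamma>_iff cd)
      define t where "t = snd p"
      have t: "t0 \<le> t" "t \<le> 2 * t0" using p by (auto simp: U_def t_def)
      have "t0 \<le> snd (hyp_act A p)" using A by (simp add: U_def)
      then have "t0 \<le> 1 / hq p c d" by (simp add: snd_hyp_act[OF pH] cd)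
      moreover have "hq p c d > 0"
        using A pH by (intro hq_pos) (auto simp: mem_H3 \<Gamma>_iff cd det2)
      ultimately have "hq p c d * t0 \<le> 1" using t0 by (simp add: field_simps)
      then have "((cmod (c * fst p + d))\<^sup>2 + (cmod c)\<^sup>2 * t\<^sup>2) * t0 \<le> t"
        using t t0 by (simp add: hq_def t_def field_simps)
      also have "\<dots> \<le> 2 * t0" using t by simp
      finally have N: "(cmod (c * fst p + d))\<^sup>2 + (cmod c * t)\<^sup>2 \<le> 2" using t0 by (simp add: power_mult_distrib)
      have sq: "(3 / 2)\<^sup>2 = (9 / 4 :: real)" by (simp add: power2_eq_square)
      have "(cmod c * t)\<^sup>2 \<le> (3 / 2)\<^sup>2" unfolding sq using N zero_le_power2[of "cmod (c * fst p + d)"] by linarith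
      then have "cmod c * t \<le> 3 / 2" by (rule power2_le_imp_le) simp
      then have "cmod c * t0 \<le> 3 / 2" using t by (smt (verit) mult_left_mono norm_ge_zero)
      then have c: "cmod c \<le> y / 32" using Im_w by (simp add: t0_def field_simps)
      obtain a b where ab: "c = of_int a + of_int b * w" using O by (auto simp: quad_ints_iff)
      have "\<bar>of_int b\<bar> \<le> y / 32 / y" using coord_bounds(1)[OF ab c] .
      then have "b = 0" using Im_w by simp
      then have ca: "c = of_int a" using ab by simp
      have "(cmod (c * fst p + d))\<^sup>2 \<le> (3 / 2)\<^sup>2" unfolding sq using N zero_le_power2[of "cmod c * t"] by linarith
      then have "cmod (c * fst p + d) \<le> 3 / 2" by (rule power2_le_imp_le) simp
      then have Im32: "\<bar>Im (c * fst p + d)\<bar> \<le> 3 / 2" using abs_Im_le_cmod[of "c * fst p + d"] by linarith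
      obtain a' b' where d: "d = of_int a' + of_int b' * w" using O by (auto simp: quad_ints_iff)
      have Im: "\<bar>of_int a * Im (fst p) + of_int b' * y\<bar> \<le> 3 / 2" using Im32 by (simp add: ca d)
      show "A $ 2 $ 1 = 0"
      proof (rule ccontr)
        assume "A $ 2 $ 1 \<noteq> 0"
        then have a0: "a \<noteq> 0" using ca cd by auto
        define k where "k = nat \<bar>a\<bar>"
        have k: "1 \<le> k" "real k \<le> y / 24" using a0 c ca by (auto simp: k_def)
        have e: "\<bar>real k * Im (fst p) - of_int (- sgn a * b') * y\<bar> = \<bar>of_int a * Im (fst p) + of_int b' * y\<bar>"
          using a0 by (cases "a > 0") (auto simp: k_def)
        have "fst p \<in> good" using p by (simp add: U_def)
        then have "3 / 2 < \<bar>real k * Im (fst p) - of_int (- sgn a * b') * y\<bar>" using k unfolding good_def by blast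
        then show False using e Im by linarith
      qed
    qed
    let ?f = "\<lambda>A :: complex ^ 2 ^ 2. A $ 1 $ 1"
    \<comment> \<open>Two such elements with the same unit \<open>A $ 1 $ 1\<close> differ by a
      translation by a ring element, which vanishes as both images lie above \<open>rect\<close>. So
      at most 7 elements occur, by the crude count of units.\<close>
    have inj: "inj_on ?f {A \<in> \<Gamma>. hyp_act A p \<in> U}"
    proof (rule inj_onI)
      fix A B assume A: "A \<in> {A \<in> \<Gamma>. hyp_act A p \<in> U}" and B: "B \<in> {A \<in> \<Gamma>. hyp_act A p \<in> U}" and eq: "A $ 1 $ 1 = B $ 1 $ 1"
      have c: "A $ 2 $ 1 = 0" "B $ 2 $ 1 = 0" using lower A B by auto
      define a where "a = A $ 1 $ 1"
      have det: "a * A $ 2 $ 2 = 1" "a * B $ 2 $ 2 = 1" using A B c eq by (auto simp: \<Gamma>_iff det2 a_def)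
      then have a0: "a \<noteq> 0" by auto
      then have d: "A $ 2 $ 2 = B $ 2 $ 2" using det by (metis mult_cancel_left)
      define u where "u = a * (A $ 1 $ 2 - B $ 1 $ 2)"
      have uO: "u \<in> \<O>" unfolding u_def a_def using A B by (intro O_mult O_diff) (auto simp: \<Gamma>_iff)
      have "fst (hyp_act A p) = a * (a * fst p + A $ 1 $ 2)" "fst (hyp_act B p) = a * (a * fst p + B $ 1 $ 2)"
        using A B c eq pH by (auto simp: hyp_act_upper \<Gamma>_iff a_def)
      then have u: "u = fst (hyp_act A p) - fst (hyp_act B p)" by (simp add: u_def algebra_simps)
      have "fst (hyp_act A p) \<in> rect" "fst (hyp_act B p) \<in> rect" using A B by (auto simp: U_def good_def)
      then have ub: "\<bar>Re u\<bar> < 1" "\<bar>Im u\<bar> < y" unfolding u by (auto simp: rect_def)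
      obtain m n where mn: "u = of_int m + of_int n * w" using uO by (auto simp: quad_ints_iff)
      have "\<bar>of_int n\<bar> * y < 1 * y" using ub(2) Im_w by (simp add: mn abs_mult)
      then have "\<bar>of_int n :: real\<bar> < 1" using Im_w by (simp only: mult_less_cancel_right_pos)
      then have "n = 0" by simp
      then have "u = 0" using ub(1) by (simp add: mn)
      then have "A $ 1 $ 2 = B $ 1 $ 2" using a0 by (simp add: u_def)
      then show "A = B" using c d eq by (simp add: mat2_eq_iff)
    qed
    have sub: "?f ` {A \<in> \<Gamma>. hyp_act A p \<in> U} \<subseteq> {x \<in> \<O>. cmod x = 1}"
    proof (rule image_subsetI)
      fix A assume A: "A \<in> {A \<in> \<Gamma>. hyp_act A p \<in> U}"
      then have AG: "A \<in> \<Gamma>" and c: "A $ 2 $ 1 = 0" using lower by blast+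
      have "A $ 1 $ 1 * A $ 2 $ 2 = 1" using det1[OF AG] c by (simp add: det2)
      then show "A $ 1 $ 1 \<in> {x \<in> \<O>. cmod x = 1}" using AG O_unit[of "A $ 1 $ 1" "A $ 2 $ 2"] by (simp add: \<Gamma>_iff)
    qed
    have "card {A \<in> \<Gamma>. hyp_act A p \<in> U} \<le> card {x \<in> \<O>. cmod x = 1}"
      by (rule card_inj_on_le[OF inj sub card_units(1)])
    then show ?thesis using inj_on_finite[OF inj sub card_units(1)] card_units(2) by simp
  qed
  have le: "emeasure hyp_volume U \<le> of_nat 7 * emeasure hyp_volume fd"
    by (rule volume_ge_multiplicity[OF U]) (use K in blast)
  define \<mu> where "\<mu> = measure lborel good"
  have mu: "emeasure lborel good = ennreal \<mu>" "\<mu> \<ge> 0"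
    using good_measure_finite by (auto simp: \<mu>_def emeasure_eq_ennreal_measure)
  have mu2: "y / 2 \<le> \<mu>" using good_measure mu Im_w by (simp add: ennreal_le_iff)
  \<comment> \<open>The slab \<open>U\<close> is the region above \<open>t0\<close> without that
    above \<open>2 t0\<close>, three quarters of the volume of the former. It is obtained by
    subadditivity, to avoid a subtraction in \<open>ennreal\<close>.\<close>
  have "ennreal (\<mu> / (2 * t0\<^sup>2)) = emeasure hyp_volume {p. fst p \<in> good \<and> t0 \<le> snd p}"
    using t0 mu by (subst hyp_volume_cusp(2)) (auto simp: ennreal_mult'[symmetric])
  also have "\<dots> \<le> emeasure hyp_volume (U \<union> {p. fst p \<in> good \<and> 2 * t0 \<le> snd p})"
    using U hyp_volume_cusp(1)[of good "2 * t0"] t0 by (intro emeasure_mono) (auto simp: U_def)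
  also have "\<dots> \<le> emeasure hyp_volume U + emeasure hyp_volume {p. fst p \<in> good \<and> 2 * t0 \<le> snd p}"
    using U hyp_volume_cusp(1)[of good "2 * t0"] t0 by (intro emeasure_subadditive) auto
  also have "emeasure hyp_volume {p. fst p \<in> good \<and> 2 * t0 \<le> snd p} = ennreal (\<mu> / (8 * t0\<^sup>2))"
    using t0 mu by (subst hyp_volume_cusp(2)) (auto simp: ennreal_mult'[symmetric] power2_eq_square)
  finally have "ennreal (\<mu> / (2 * t0\<^sup>2)) \<le> emeasure hyp_volume U + ennreal (\<mu> / (8 * t0\<^sup>2))" .
  moreover have "ennreal (\<mu> / (2 * t0\<^sup>2)) = ennreal (3 * \<mu> / (8 * t0\<^sup>2)) + ennreal (\<mu> / (8 * t0\<^sup>2))"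
    using mu t0 by (simp add: ennreal_plus[symmetric] field_simps del: ennreal_plus)
  ultimately have "ennreal (3 * \<mu> / (8 * t0\<^sup>2)) \<le> emeasure hyp_volume U"
    by (simp add: add.commute[of _ "ennreal (\<mu> / (8 * t0\<^sup>2))"] ennreal_add_left_cancel_le)
  also note le
  finally have "ennreal (3 * \<mu> / (8 * t0\<^sup>2)) \<le> 7 * emeasure hyp_volume fd" by simp
  \<comment> \<open>With \<open>\<mu> \<ge> y / 2\<close> and \<open>t0 = 48 / y\<close> the
    right-hand side is at least \<open>y ^ 3 / 12288\<close>, and 7 * 12288 = 86016 is rounded
    up.\<close>
  moreover have "7 * (y ^ 3 / 100000) \<le> 3 * \<mu> / (8 * t0\<^sup>2)"
  proof -
    have e: "3 * \<mu> / (8 * t0\<^sup>2) = 3 * (\<mu> * y\<^sup>2) / 18432" using Im_w by (simp add: t0_def power_divide)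
    have "y / 2 * y\<^sup>2 \<le> \<mu> * y\<^sup>2" using mu2 by (intro mult_right_mono) auto
    moreover have "y / 2 * y\<^sup>2 = y ^ 3 / 2" by (simp add: power2_eq_square power3_eq_cube)
    moreover have "y ^ 3 \<ge> 0" using Im_w by simp
    ultimately show ?thesis unfolding e by linarith
  qed
  ultimately have "ennreal (7 * (y ^ 3 / 100000)) \<le> 7 * emeasure hyp_volume fd"
    by (meson ennreal_leI order_trans)
  moreover have "ennreal (7 * (y ^ 3 / 100000)) = 7 * ennreal (y ^ 3 / 100000)"
    using Im_w by (subst ennreal_mult) auto
  ultimately show ?thesis by (simp add: ennreal_mult_le_mult_iff)
qed

end

section \<open>Short vectors and ideals\<close>

context quad_ring
begin

text \<open>Box principle for the multiples \<open>c z\<close> modulo the ring, in the coordinates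
  of the basis \<open>1\<close>, \<open>w\<close>: two numbers \<open>c\<close> whose multiples
  share a box differ by the first component, and the integral parts give \<open>d\<close>.\<close>

lemma short_vector:
  assumes p: "p \<in> H3"
  shows "\<exists>c d. c \<in> \<O> \<and> d \<in> \<O> \<and> (c \<noteq> 0 \<or> d \<noteq> 0) \<and> hq p c d \<le> 80 * y"
proof -
  define z t where zt: "z = fst p" "t = snd p"
  have t: "t > 0" using p by (simp add: zt mem_H3)
  show ?thesis
  proof (cases "t > y")
    case True
    have "3 / 4 \<le> y * y" using y_sq by (simp add: power2_eq_square)
    also have "\<dots> \<le> y * t" using True Im_w by (intro mult_left_mono) auto
    finally have "1 \<le> 80 * y * t" by simp
    then have "hq p 0 1 \<le> 80 * y" using t by (simp add: hq_def zt[symmetric] divide_le_eq)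
    then show ?thesis by (intro exI[of _ 0] exI[of _ 1]) simp
  next
    case False
    \<comment> \<open>This size of \<open>c\<close> balances the form: with \<open>|c|\<close> of
      order \<open>X\<close> and \<open>|c z + d|\<close> of order \<open>y / X\<close>, both terms
      of \<open>hq\<close> are of order \<open>y\<close>. The final 80 is 64 + 16.\<close>
    define X where "X = sqrt (y / t)"
    have X1: "X \<ge> 1" using False t by (simp add: X_def)
    have X2: "X\<^sup>2 = y / t" using t Im_w by (simp add: X_def)
    define N1 N2 where N: "N1 = nat \<lfloor>X\<rfloor>" "N2 = nat \<lfloor>X / y\<rfloor>"
    have Xy: "X / y \<ge> 0" using X1 Im_w by simp
    have N1: "N1 \<ge> 1" "real N1 \<le> X" "X < real N1 + 1" using X1 unfolding N by linarith+
    have N2: "real N2 \<le> X / y" "X / y < real N2 + 1" using Xy unfolding N by linarith+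
    \<comment> \<open>\<open>N2\<close> vanishes when \<open>X < y\<close>, so one box is kept in
      this direction; still \<open>M1 N1 < (N1 + 1) (N2 + 1)\<close>.\<close>
    define M1 where "M1 = max 1 N2"
    have M1: "M1 \<ge> 1" by (simp add: M1_def)
    have M1b: "1 / real M1 \<le> 2 * (y / X)"
    proof (cases "N2 = 0")
      case True
      then have "X / y < 1" using N2 by simp
      then have "X < y" using Im_w by (simp add: field_simps)
      then have "1 \<le> y / X" using X1 by (simp add: field_simps)
      then have "1 \<le> 2 * (y / X)" by linarith
      then show ?thesis using True by (simp add: M1_def)
    next
      case False
      then have m: "M1 = N2" "N2 \<ge> 1" by (auto simp: M1_def)
      have "X / y \<le> 2 * real N2" using N2 m by linarith
      then show ?thesis unfolding m using m X1 Im_w by (simp add: field_simps)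
    qed
    have N1b: "1 / real N1 \<le> 2 / X"
    proof -
      have "X \<le> 2 * real N1" using N1 by linarith
      then have "2 / (2 * real N1) \<le> 2 / X" using X1 by (intro divide_left_mono) auto
      then show ?thesis by simp
    qed
    define cc where "cc kl = of_nat (fst kl) + of_nat (snd kl) * w" for kl :: "nat \<times> nat"
    define Q where "Q kl = Im (cc kl * z) / y" for kl
    define P where "P kl = Re (cc kl * z) - Q kl * Re w" for kl
    have PQ: "cc kl * z = of_real (P kl) + of_real (Q kl) * w" for kl
      using Im_w by (simp add: complex_eq_iff P_def Q_def)
    define f where "f kl = (\<lfloor>real M1 * frac (P kl)\<rfloor>, \<lfloor>real N1 * frac (Q kl)\<rfloor>)" for kl
    have fl: "\<lfloor>real M * frac x\<rfloor> \<in> {0..<int M}" if "M \<ge> 1" for M x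
    proof -
      have "0 \<le> real M * frac x" by simp
      moreover have "real M * frac x < real M * 1" using that frac_lt_1[of x] by (intro mult_strict_left_mono) auto
      ultimately have "0 \<le> \<lfloor>real M * frac x\<rfloor>" "\<lfloor>real M * frac x\<rfloor> < int M" by (simp, linarith)
      then show ?thesis by simp
    qed
    have "f ` ({..N1} \<times> {..N2}) \<subseteq> {0..<int M1} \<times> {0..<int N1}"
      unfolding f_def using fl M1 N1 by auto
    then have "card (f ` ({..N1} \<times> {..N2})) \<le> card ({0..<int M1} \<times> {0..<int N1})"
      by (intro card_mono) auto
    also have "\<dots> = M1 * N1" by (simp add: card_cartesian_product)
    also have "\<dots> < (N1 + 1) * (N2 + 1)" using N1 by (simp add: M1_def algebra_simps max_def)
    also have "\<dots> = card ({..N1} \<times> {..N2})" by (simp add: card_cartesian_product)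
    finally have "\<not> inj_on f ({..N1} \<times> {..N2})" by (rule pigeonhole)
    then obtain u v where uv: "u \<in> {..N1} \<times> {..N2}" "v \<in> {..N1} \<times> {..N2}" "u \<noteq> v" "f u = f v"
      by (auto simp: inj_on_def)
    have fr: "\<bar>frac x - frac x'\<bar> \<le> 1 / real M" if "M \<ge> 1" "\<lfloor>real M * frac x\<rfloor> = \<lfloor>real M * frac x'\<rfloor>" for M and x x' :: real
    proof -
      have "\<bar>real M * frac x - real M * frac x'\<bar> < 1" using that(2) by linarith
      then have "real M * \<bar>frac x - frac x'\<bar> < 1" by (simp add: right_diff_distrib[symmetric] abs_mult)
      then show ?thesis using that(1) by (simp add: field_simps)
    qed
    have fp: "\<bar>frac (P u) - frac (P v)\<bar> \<le> 1 / real M1" "\<bar>frac (Q u) - frac (Q v)\<bar> \<le> 1 / real N1"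
      using uv(4) fr M1 N1(1) unfolding f_def by auto
    define c where "c = cc u - cc v"
    define d where "d = - (of_int (\<lfloor>P u\<rfloor> - \<lfloor>P v\<rfloor>) + of_int (\<lfloor>Q u\<rfloor> - \<lfloor>Q v\<rfloor>) * w)"
    have ceq: "c = of_int (int (fst u) - int (fst v)) + of_int (int (snd u) - int (snd v)) * w"
      by (simp add: c_def cc_def algebra_simps)
    have cO: "c \<in> \<O>" unfolding ceq quad_ints_iff by blast
    have dO: "d \<in> \<O>" unfolding d_def by (intro O_minus O_add O_mult O_int)
    have c0: "c \<noteq> 0"
    proof
      assume c: "c = 0"
      then have "Im c = 0" by simp
      then have "int (snd u) = int (snd v)" using Im_w unfolding ceq by simp
      moreover from this c have "int (fst u) = int (fst v)" unfolding ceq by simp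
      ultimately show False using uv(3) by (simp add: prod_eq_iff)
    qed
    have "c * z + d = of_real (frac (P u) - frac (P v)) + of_real (frac (Q u) - frac (Q v)) * w"
      unfolding c_def d_def left_diff_distrib PQ by (simp add: frac_def algebra_simps)
    then have "cmod (c * z + d) \<le> \<bar>frac (P u) - frac (P v)\<bar> + \<bar>frac (Q u) - frac (Q v)\<bar> * cmod w"
      by (metis norm_mult norm_of_real norm_triangle_ineq)
    also have "\<dots> \<le> 2 * (y / X) + 2 / X * (3 * y)"
      using fp M1b N1b cmod_w X1 by (intro add_mono mult_mono) auto
    finally have 1: "cmod (c * z + d) \<le> 8 * (y / X)" by (simp add: field_simps)
    have ab: "\<bar>real (fst u) - real (fst v)\<bar> \<le> X" "\<bar>real (snd u) - real (snd v)\<bar> \<le> X / y"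
      using uv(1,2) N1 N2 by auto
    have "cmod c \<le> \<bar>real (fst u) - real (fst v)\<bar> + \<bar>real (snd u) - real (snd v)\<bar> * cmod w"
      unfolding ceq by (rule order_trans[OF norm_triangle_ineq], simp only: norm_mult norm_of_int) simp
    also have "\<dots> \<le> X + X / y * (3 * y)" using ab cmod_w Xy by (intro add_mono mult_mono) auto
    finally have 2: "cmod c \<le> 4 * X" using Im_w by simp
    have "(cmod (c * z + d))\<^sup>2 \<le> (8 * (y / X))\<^sup>2" using 1 by (intro power_mono) auto
    also have "\<dots> = 64 * (y * t)" using Im_w t by (simp add: power_mult_distrib power_divide X2) (simp add: power2_eq_square)
    finally have 3: "(cmod (c * z + d))\<^sup>2 \<le> 64 * (y * t)" .
    have "(cmod c)\<^sup>2 * t\<^sup>2 \<le> (4 * X)\<^sup>2 * t\<^sup>2" using 2 by (intro mult_right_mono power_mono) auto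
    also have "\<dots> = 16 * (y * t)" unfolding power_mult_distrib X2 using t by (simp add: power2_eq_square)
    finally have "(cmod (c * z + d))\<^sup>2 + (cmod c)\<^sup>2 * t\<^sup>2 \<le> 80 * y * t" using 3 by simp
    then have "hq p c d \<le> 80 * y" using t by (simp add: hq_def zt[symmetric] divide_le_eq)
    then show ?thesis using cO dO c0 by blast
  qed
qed

lemma shortest_vector:
  assumes p: "p \<in> H3"
  obtains c d where "c \<in> \<O>" "d \<in> \<O>" "c \<noteq> 0 \<or> d \<noteq> 0" "hq p c d \<le> 80 * y"
    "\<And>c' d'. c' \<in> \<O> \<Longrightarrow> d' \<in> \<O> \<Longrightarrow> c' \<noteq> 0 \<or> d' \<noteq> 0 \<Longrightarrow> hq p c d \<le> hq p c' d'"
proof -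
  define S where "S = {(c, d). c \<in> \<O> \<and> d \<in> \<O> \<and> hq p c d \<le> 80 * y} - {(0, 0)}"
  have fin: "finite S" unfolding S_def using finite_hq_le[OF p] by simp
  have "S \<noteq> {}" using short_vector[OF p] by (auto simp: S_def)
  then have "\<exists>m\<in>S. \<forall>x\<in>S. hq p (fst m) (snd m) \<le> hq p (fst x) (snd x)"
    by (intro finite_total_least fin) auto
  then obtain c d where cd: "(c, d) \<in> S" "\<And>x. x \<in> S \<Longrightarrow> hq p c d \<le> hq p (fst x) (snd x)" by force
  have "hq p c d \<le> hq p c' d'" if "c' \<in> \<O>" "d' \<in> \<O>" "c' \<noteq> 0 \<or> d' \<noteq> 0" for c' d'
  proof (cases "hq p c' d' \<le> 80 * y")
    case True
    then show ?thesis using cd(2)[of "(c', d')"] that by (simp add: S_def)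
  next
    case False
    then show ?thesis using cd(1) by (simp add: S_def)
  qed
  then show ?thesis using that[of c d] cd(1) by (auto simp: S_def)
qed

text \<open>The fractional ideal inverse to the ideal generated by \<open>c\<close> and \<open>d\<close>.\<close>

definition inv_ideal :: "complex \<Rightarrow> complex \<Rightarrow> complex set" where
  "inv_ideal c d = {\<alpha>. \<alpha> * c \<in> \<O> \<and> \<alpha> * d \<in> \<O>}"

definition lat :: "complex \<Rightarrow> complex set" where
  "lat \<eta> = {of_int m + of_int n * \<eta> | m n. True}"

lemma inv_ideal_add: "x \<in> inv_ideal c d \<Longrightarrow> z \<in> inv_ideal c d \<Longrightarrow> x + z \<in> inv_ideal c d"
  by (simp add: inv_ideal_def ring_distribs O_add)

lemma inv_ideal_mult: "x \<in> \<O> \<Longrightarrow> z \<in> inv_ideal c d \<Longrightarrow> x * z \<in> inv_ideal c d"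
  by (simp add: inv_ideal_def mult.assoc O_mult)

lemma inv_ideal_minus: "x \<in> inv_ideal c d \<Longrightarrow> - x \<in> inv_ideal c d"
  by (simp add: inv_ideal_def O_minus)

text \<open>By \<open>min\<close>, 1 is a shortest element of the inverse ideal, so its real
  elements are the integers and it is \<open>\<int> + \<int> h\<close> with \<open>Im h > 0\<close>
  least. As it contains \<open>w = k + a h\<close>, its second generator may be taken as
  \<open>(s + w) / a\<close>.\<close>

lemma lat_structure:
  assumes cd: "c \<in> \<O>" "d \<in> \<O>" "c \<noteq> 0 \<or> d \<noteq> 0"
    and min: "\<And>\<alpha>. \<alpha> \<in> inv_ideal c d \<Longrightarrow> \<alpha> \<noteq> 0 \<Longrightarrow> cmod \<alpha> \<ge> 1"
  obtains s a C :: int where "1 \<le> a" "0 \<le> s" "s < a" "of_int a \<le> 2 * y" "(cmod (of_int s + w))\<^sup>2 = of_int (a * C)"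
    "inv_ideal c d = lat ((of_int s + w) / of_int a)"
proof -
  define J where "J = inv_ideal c d"
  have J1: "1 \<in> J" using cd by (simp add: J_def inv_ideal_def)
  have Jint: "of_int n \<in> J" for n using inv_ideal_mult[of "of_int n" 1 c d] J1 by (simp add: J_def)
  have Jadd: "x + z \<in> J" if "x \<in> J" "z \<in> J" for x z using that inv_ideal_add by (simp add: J_def)
  have Jmul: "x * z \<in> J" if "x \<in> \<O>" "z \<in> J" for x z using that inv_ideal_mult by (simp add: J_def)
  have Jsub: "x - of_int n * z \<in> J" if "x \<in> J" "z \<in> J" for x z n
    using Jadd[OF that(1) Jmul[OF O_int(1)[of "- n"] that(2)]] by simp
  have Jreal: "\<exists>n. \<alpha> = of_int n" if a: "\<alpha> \<in> J" "Im \<alpha> = 0" for \<alpha>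
  proof -
    define \<beta> where "\<beta> = \<alpha> - of_int \<lfloor>Re \<alpha>\<rfloor> * 1"
    have "\<beta> \<in> J" unfolding \<beta>_def by (rule Jsub[OF a(1) J1])
    moreover have b: "\<beta> = of_real (frac (Re \<alpha>))" using a(2) by (simp add: \<beta>_def complex_eq_iff frac_def)
    then have "cmod \<beta> < 1" by (simp add: frac_lt_1)
    ultimately have "\<beta> = 0" using min[of \<beta>] by (force simp: J_def)
    then have "\<alpha> = of_int \<lfloor>Re \<alpha>\<rfloor>" by (simp add: \<beta>_def)
    then show ?thesis by blast
  qed
  \<comment> \<open>Multiplication by a nonzero one of \<open>c\<close>, \<open>d\<close> embeds the
    fractional ideal in the ring, where balls are finite.\<close>
  obtain e where e: "e \<noteq> 0" "\<And>\<alpha>. \<alpha> \<in> J \<Longrightarrow> \<alpha> * e \<in> \<O>" using cd(3) by (auto simp: J_def inv_ideal_def)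
  define S where "S = {\<alpha> \<in> J. 0 < Im \<alpha> \<and> Im \<alpha> \<le> y \<and> 0 \<le> Re \<alpha> \<and> Re \<alpha> < 1}"
  have "(\<lambda>\<alpha>. \<alpha> * e) ` S \<subseteq> {x \<in> \<O>. cmod x \<le> (1 + y) * cmod e}"
  proof (rule image_subsetI)
    fix \<alpha> assume a: "\<alpha> \<in> S"
    have "cmod \<alpha> \<le> \<bar>Re \<alpha>\<bar> + \<bar>Im \<alpha>\<bar>" by (rule cmod_le)
    also have "\<dots> \<le> 1 + y" using a by (simp add: S_def)
    finally show "\<alpha> * e \<in> {x \<in> \<O>. cmod x \<le> (1 + y) * cmod e}"
      using a e(2) by (simp add: S_def norm_mult mult_right_mono)
  qed
  moreover have "inj_on (\<lambda>\<alpha>. \<alpha> * e) S" using e(1) by (simp add: inj_on_def)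
  ultimately have fin: "finite S" using finite_O_ball by (metis finite_imageD finite_subset)
  have wS: "w \<in> S" using Jmul[OF O_int(4) J1] Im_w Re_w by (simp add: S_def)
  then have "\<exists>m\<in>S. \<forall>x\<in>S. Im m \<le> Im x" by (intro finite_total_least fin) auto
  then obtain h where h: "h \<in> S" "\<And>x. x \<in> S \<Longrightarrow> Im h \<le> Im x" by blast
  have hJ: "h \<in> J" and hI: "Im h > 0" "Im h \<le> y" using h(1) by (auto simp: S_def)
  have rep: "\<exists>m n. \<alpha> = of_int m + of_int n * h" if a: "\<alpha> \<in> J" for \<alpha>
  proof -
    define n where "n = \<lfloor>Im \<alpha> / Im h\<rfloor>"
    define \<beta> where "\<beta> = \<alpha> - of_int n * h"
    have bJ: "\<beta> \<in> J" unfolding \<beta>_def by (rule Jsub[OF a hJ])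
    have "of_int n \<le> Im \<alpha> / Im h" "Im \<alpha> / Im h < of_int n + 1" unfolding n_def by linarith+
    then have b: "0 \<le> Im \<beta>" "Im \<beta> < Im h" using hI by (simp_all add: \<beta>_def field_simps)
    have "Im \<beta> = 0"
    proof (rule ccontr)
      assume "Im \<beta> \<noteq> 0"
      then have "\<beta> - of_int \<lfloor>Re \<beta>\<rfloor> * 1 \<in> S"
        using Jsub[OF bJ J1, of "\<lfloor>Re \<beta>\<rfloor>"] b hI unfolding S_def by simp linarith
      then show False using h(2) b by force
    qed
    then obtain m where "\<beta> = of_int m" using Jreal bJ by blast
    then have "\<alpha> = of_int m + of_int n * h" by (simp add: \<beta>_def algebra_simps)
    then show ?thesis by blast
  qed
  obtain k a where ka: "w = of_int k + of_int a * h" using rep[of w] wS by (auto simp: S_def)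
  have ya: "y = of_int a * Im h" using arg_cong[OF ka, of Im] by simp
  then have "of_int a > (0 :: real)" using Im_w hI by (simp add: zero_less_mult_iff)
  then have a1: "1 \<le> a" by simp
  define s where "s = (- k) mod a"
  define q where "q = (- k) div a"
  have sk: "- k = a * q + s" by (simp add: s_def q_def)
  have s: "0 \<le> s" "s < a" using a1 by (auto simp: s_def)
  define \<eta> where "\<eta> = (of_int s + w) / of_int a"
  have a0: "complex_of_int a \<noteq> 0" using a1 by simp
  have kk: "k = - (a * q + s)" using sk by simp
  have "of_int a * h = w - of_int k" using ka by simp
  also have "\<dots> = of_int a * (\<eta> + of_int q)" using a0 by (simp add: kk \<eta>_def field_simps)
  finally have hq: "h = \<eta> + of_int q" using a0 by simp
  have eJ: "\<eta> \<in> J" using Jsub[OF hJ J1, of q] hq by simp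
  have Jlat: "J = lat \<eta>"
  proof (intro set_eqI iffI)
    fix \<alpha> assume "\<alpha> \<in> J"
    then obtain m n where "\<alpha> = of_int m + of_int n * h" using rep by blast
    then have "\<alpha> = of_int (m + n * q) + of_int n * \<eta>" by (simp add: hq algebra_simps)
    then show "\<alpha> \<in> lat \<eta>" unfolding lat_def by blast
  next
    fix \<alpha> assume "\<alpha> \<in> lat \<eta>"
    then show "\<alpha> \<in> J" unfolding lat_def using Jadd Jmul Jint eJ by auto
  qed
  have Ie: "Im \<eta> = y / of_int a" using Im_divide_of_real[of "of_int s + w" "of_int a"] by (simp add: \<eta>_def)
  \<comment> \<open>Otherwise \<open>\<eta>\<close> minus the nearest integer to its real part has
    real part at most 1/2 and imaginary part below 1/2, hence modulus below 1.\<close>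
  have a2y: "of_int a \<le> 2 * y"
  proof (rule ccontr)
    assume n: "\<not> ?thesis"
    define m where "m = round (Re \<eta>)"
    define \<beta> where "\<beta> = \<eta> - of_int m * 1"
    have bJ: "\<beta> \<in> J" unfolding \<beta>_def by (rule Jsub[OF eJ J1])
    have "\<bar>Re \<beta>\<bar> \<le> 1 / 2" using of_int_round_abs_le[of "Re \<eta>"] by (simp add: \<beta>_def m_def abs_minus_commute)
    moreover have Ib: "Im \<beta> = y / of_int a" using Ie by (simp add: \<beta>_def)
    have "0 < Im \<beta>" "Im \<beta> < 1 / 2" unfolding Ib using n a1 Im_w by (auto simp: divide_simps)
    moreover have "cmod \<beta> \<le> \<bar>Re \<beta>\<bar> + \<bar>Im \<beta>\<bar>" by (rule cmod_le)
    ultimately have "cmod \<beta> < 1" "\<beta> \<noteq> 0" by auto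
    then show False using min[of \<beta>] bJ by (simp add: J_def)
  qed
  define N where "N = (cmod (of_int s + w))\<^sup>2"
  obtain B where B: "(of_int s + w) + cnj (of_int s + w) = of_int B" using O_tr[OF O_add[OF O_int(1) O_int(4)], of s] by blast
  have Nc: "complex_of_real N = (of_int s + w) * cnj (of_int s + w)" unfolding N_def by (rule complex_norm_square)
  have ae: "of_int a * \<eta> = of_int s + w" using a0 by (simp add: \<eta>_def)
  \<comment> \<open>The ideal absorbs multiplication by \<open>cnj (s + w)\<close>, which turns
    \<open>\<eta>\<close> into the real number \<open>N / a\<close>; real elements being integers,
    \<open>a\<close> divides the norm.\<close>
  have "of_int B * \<eta> - (of_int s + w) * \<eta> = cnj (of_int s + w) * \<eta>" unfolding B[symmetric] by (simp add: algebra_simps)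
  also have "\<dots> = complex_of_real (N / of_int a)" using a0 by (simp add: Nc \<eta>_def)
  finally have e1: "complex_of_real (N / of_int a) = of_int B * \<eta> - (of_int s + w) * \<eta>" by simp
  have "of_int B * \<eta> + - ((of_int s + w) * \<eta>) \<in> J"
    using Jmul[of "of_int B" \<eta>] Jmul[of "- (of_int s + w)" \<eta>] eJ O_minus[of "of_int s + w"] O_add[of "of_int s" w]
    by (intro Jadd) (auto simp: algebra_simps)
  then have "complex_of_real (N / of_int a) \<in> J" using e1 by simp
  then obtain C where "complex_of_real (N / of_int a) = of_int C" using Jreal by (metis Im_complex_of_real)
  then have "N / of_int a = of_int C" by (metis of_real_eq_iff of_real_of_int_eq)
  then have "N = of_int (a * C)" using a1 by (simp add: field_simps)
  then show ?thesis using that[of a s C] a1 s a2y Jlat unfolding N_def J_def \<eta>_def by blast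
qed

text \<open>Invertibility of the ideal: \<open>c cnj d / g\<close> is integral for the content \<open>g\<close> of the norm form
  \<open>|c X + d Y|\<^sup>2\<close>, by Gauss's lemma for a product of two linear forms.\<close>

lemma inv_ideal_bezout:
  assumes c: "c \<in> \<O>" and d: "d \<in> \<O>" and nz: "c \<noteq> 0 \<or> d \<noteq> 0"
  obtains p q where "p \<in> inv_ideal c d" "q \<in> inv_ideal c d" "p * d - q * c = 1"
proof -
  obtain n1 n3 :: nat where n: "(cmod c)\<^sup>2 = of_nat n1" "c * cnj c = of_nat n1" "(cmod d)\<^sup>2 = of_nat n3" "d * cnj d = of_nat n3"
    using O_norm[OF c] O_norm[OF d] by metis
  have cdO: "c * cnj d \<in> \<O>" using c d by (simp add: O_mult O_cnj)
  obtain n2 :: int where n2: "2 * Re (c * cnj d) = of_int n2" "c * cnj d + cnj (c * cnj d) = of_int n2" using O_tr[OF cdO] by blast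
  define g where "g = gcd (gcd (int n1) n2) (int n3)"
  have "n1 \<noteq> 0 \<or> n3 \<noteq> 0"
  proof (rule ccontr)
    assume "\<not> ?thesis"
    then have "(cmod c)\<^sup>2 = 0" "(cmod d)\<^sup>2 = 0" unfolding n by simp_all
    then show False using nz by simp
  qed
  then have g: "g > 0" unfolding g_def by (auto simp: gcd_pos_int)
  have dvd: "g dvd int n1" "g dvd n2" "g dvd int n3" unfolding g_def by (meson dvd_trans gcd_dvd1 gcd_dvd2)+
  obtain m1 m2 m3 where m: "int n1 = g * m1" "n2 = g * m2" "int n3 = g * m3" using dvd by (auto elim!: dvdE)
  have g0: "complex_of_int g \<noteq> 0" using g by simp
  have n1': "c * cnj c = of_int g * of_int m1" using n(2) m(1) by (metis of_int_mult of_int_of_nat_eq)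
  have n3': "d * cnj d = of_int g * of_int m3" using n(4) m(3) by (metis of_int_mult of_int_of_nat_eq)
  define x where "x = c * cnj d / of_int g"
  have xO: "x \<in> \<O>" unfolding x_def
  proof (rule int_closed[OF cdO g])
    have "2 * Re (c * cnj d / of_int g) = 2 * Re (c * cnj d) / of_int g" by (metis Re_divide_of_real of_real_of_int_eq times_divide_eq_right)
    also have "\<dots> = of_int m2" unfolding n2(1) m(2) using g by simp
    finally show "2 * Re (c * cnj d / of_int g) \<in> \<int>" by simp
    have "(cmod (c * cnj d / of_int g))\<^sup>2 = (cmod c)\<^sup>2 * (cmod d)\<^sup>2 / (of_int g)\<^sup>2" by (simp add: norm_mult norm_divide power_mult_distrib power_divide)
    also have "\<dots> = (of_int (int n1) * of_int (int n3)) / (of_int g)\<^sup>2" using n by simp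
    also have "\<dots> = of_int (m1 * m3)" unfolding m using g by (simp add: power2_eq_square)
    finally show "(cmod (c * cnj d / of_int g))\<^sup>2 \<in> \<int>" by (simp only: Ints_of_int)
  qed
  have cx: "cnj x \<in> \<O>" using xO by (rule O_cnj)
  have gx: "c * cnj d = of_int g * x" "cnj c * d = of_int g * cnj x" using g0 by (simp_all add: x_def)
  obtain u v where uv: "u * gcd (int n1) n2 + v * int n3 = g" unfolding g_def by (metis bezout_int)
  obtain u1 u2 where u12: "u1 * int n1 + u2 * n2 = gcd (int n1) n2" by (metis bezout_int)
  define r s t where rst: "r = u * u1" "s = u * u2" "t = v"
  have gr: "g = r * int n1 + s * n2 + t * int n3" using uv u12 by (simp add: rst algebra_simps flip: u12)
  have "g * 1 = g * (r * m1 + s * m2 + t * m3)" using gr unfolding m by (simp add: algebra_simps)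
  then have one: "r * m1 + s * m2 + t * m3 = 1" using g by (metis mult_cancel_left less_irrefl)
  \<comment> \<open>As \<open>n2 = c cnj d + d cnj c\<close>, the relation
    \<open>r n1 + s n2 + t n3 = g\<close> reads
    \<open>(r cnj c + s cnj d) c + (s cnj c + t cnj d) d = g\<close>.\<close>
  define p' q' where pq: "p' = (of_int r * cnj c + of_int s * cnj d) / of_int g" "q' = (of_int s * cnj c + of_int t * cnj d) / of_int g"
  have gp: "of_int g * p' = of_int r * cnj c + of_int s * cnj d" "of_int g * q' = of_int s * cnj c + of_int t * cnj d"
    using g0 by (simp_all add: pq)
  have e1: "p' * c = of_int r * of_int m1 + of_int s * x"
  proof -
    have "of_int g * (p' * c) = of_int r * (c * cnj c) + of_int s * (c * cnj d)" unfolding mult.assoc[symmetric] gp by (simp add: algebra_simps)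
    also have "\<dots> = of_int g * (of_int r * of_int m1 + of_int s * x)" unfolding n1' gx by (simp add: algebra_simps)
    finally show ?thesis using g0 by simp
  qed
  have e2: "p' * d = of_int r * cnj x + of_int s * of_int m3"
  proof -
    have "of_int g * (p' * d) = of_int r * (cnj c * d) + of_int s * (d * cnj d)" unfolding mult.assoc[symmetric] gp by (simp add: algebra_simps)
    also have "\<dots> = of_int g * (of_int r * cnj x + of_int s * of_int m3)" unfolding n3' gx by (simp add: algebra_simps)
    finally show ?thesis using g0 by simp
  qed
  have e3: "q' * c = of_int s * of_int m1 + of_int t * x"
  proof -
    have "of_int g * (q' * c) = of_int s * (c * cnj c) + of_int t * (c * cnj d)" unfolding mult.assoc[symmetric] gp by (simp add: algebra_simps)
    also have "\<dots> = of_int g * (of_int s * of_int m1 + of_int t * x)" unfolding n1' gx by (simp add: algebra_simps)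
    finally show ?thesis using g0 by simp
  qed
  have e4: "q' * d = of_int s * cnj x + of_int t * of_int m3"
  proof -
    have "of_int g * (q' * d) = of_int s * (cnj c * d) + of_int t * (d * cnj d)" unfolding mult.assoc[symmetric] gp by (simp add: algebra_simps)
    also have "\<dots> = of_int g * (of_int s * cnj x + of_int t * of_int m3)" unfolding n3' gx by (simp add: algebra_simps)
    finally show ?thesis using g0 by simp
  qed
  have pJ: "p' \<in> inv_ideal c d" "q' \<in> inv_ideal c d"
    unfolding inv_ideal_def using xO cx by (simp_all add: e1 e2 e3 e4 O_add O_mult)
  have "x + cnj x = of_int m2"
  proof -
    have "of_int g * (x + cnj x) = of_int g * of_int m2" using n2(2) m(2) gx by (simp add: ring_distribs)
    then show ?thesis using g0 by simp
  qed
  note e5 = this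
  have "p' * c + q' * d = of_int r * of_int m1 + of_int s * (x + cnj x) + of_int t * of_int m3"
    unfolding e1 e4 by (simp add: algebra_simps)
  then have "p' * c + q' * d = of_int (r * m1 + s * m2 + t * m3)" unfolding e5 by simp
  then have "q' * d - (- p') * c = 1" unfolding one by (simp add: add.commute)
  then show ?thesis using that[of q' "- p'"] pJ inv_ideal_minus by blast
qed

end

section \<open>Cusps\<close>

lemma Im_mult_of_int: "Im (of_int n * x) = of_int n * Im x"
  by simp

context quad_ring
begin

text \<open>A frame \<open>G\<close> maps a cusp to infinity. It need not lie in \<open>\<Gamma>\<close>: its lower row generates an ideal whose inverse
  is the lattice \<open>\<int> + \<int> (s + w) / a\<close>, which represents the ideal class of the cusp.\<close>

definition cusp_frame :: "int \<Rightarrow> int \<Rightarrow> int \<Rightarrow> complex ^ 2 ^ 2 \<Rightarrow> bool" where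
  "cusp_frame s a C G \<longleftrightarrow> 1 \<le> a \<and> 0 \<le> s \<and> s < a \<and> of_int a \<le> 2 * y \<and> (cmod (of_int s + w))\<^sup>2 = of_int (a * C) \<and>
     det G = 1 \<and> G $ 2 $ 1 \<in> \<O> \<and> G $ 2 $ 2 \<in> \<O> \<and>
     inv_ideal (G $ 2 $ 1) (G $ 2 $ 2) = lat ((of_int s + w) / of_int a) \<and>
     G $ 1 $ 1 \<in> lat ((of_int s + w) / of_int a) \<and> G $ 1 $ 2 \<in> lat ((of_int s + w) / of_int a)"

text \<open>A shortest vector at \<open>p\<close> serves as lower row, so the height is at least
  \<open>1 / (80 y)\<close>. Comparing it with its multiples by elements of the inverse ideal gives
  the minimality required by \<open>lat_structure\<close>, and \<open>inv_ideal_bezout\<close>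
  supplies the upper row.\<close>

lemma cusp_frame_exists:
  assumes p: "p \<in> H3"
  obtains s a C G where "cusp_frame s a C G" "snd (hyp_act G p) \<ge> 1 / (80 * y)"
proof -
  obtain c d where cd: "c \<in> \<O>" "d \<in> \<O>" "c \<noteq> 0 \<or> d \<noteq> 0" "hq p c d \<le> 80 * y"
    and min: "\<And>c' d'. c' \<in> \<O> \<Longrightarrow> d' \<in> \<O> \<Longrightarrow> c' \<noteq> 0 \<or> d' \<noteq> 0 \<Longrightarrow> hq p c d \<le> hq p c' d'"
    using shortest_vector[OF p] by blast
  have pos: "hq p c d > 0" using cd(3) p by (intro hq_pos) (auto simp: mem_H3)
  have ge1: "cmod \<alpha> \<ge> 1" if a: "\<alpha> \<in> inv_ideal c d" "\<alpha> \<noteq> 0" for \<alpha>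
  proof -
    have "hq p c d \<le> hq p (\<alpha> * c) (\<alpha> * d)" using a cd(3) by (intro min) (auto simp: inv_ideal_def)
    also have "\<dots> = (cmod \<alpha>)\<^sup>2 * hq p c d"
    proof -
      have "\<alpha> * c * fst p + \<alpha> * d = \<alpha> * (c * fst p + d)" by (simp add: algebra_simps)
      then show ?thesis unfolding hq_def by (simp only: norm_mult power_mult_distrib) (simp add: algebra_simps)
    qed
    finally have "1 * hq p c d \<le> (cmod \<alpha>)\<^sup>2 * hq p c d" by simp
    then have "1 \<le> (cmod \<alpha>)\<^sup>2" using pos by (simp only: mult_le_cancel_right_pos)
    then show ?thesis by (metis norm_ge_zero one_power2 power2_le_imp_le)
  qed
  obtain s a C :: int where sa: "1 \<le> a" "0 \<le> s" "s < a" "of_int a \<le> 2 * y" "(cmod (of_int s + w))\<^sup>2 = of_int (a * C)"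
    "inv_ideal c d = lat ((of_int s + w) / of_int a)"
    by (rule lat_structure[OF cd(1-3) ge1])
  obtain u v where uv: "u \<in> inv_ideal c d" "v \<in> inv_ideal c d" "u * d - v * c = 1"
    by (rule inv_ideal_bezout[OF cd(1-3)])
  define G :: "complex ^ 2 ^ 2" where "G = vector [vector [u, v], vector [c, d]]"
  have G: "G $ 1 $ 1 = u" "G $ 1 $ 2 = v" "G $ 2 $ 1 = c" "G $ 2 $ 2 = d" by (simp_all add: G_def)
  have "cusp_frame s a C G" unfolding cusp_frame_def G det2 using sa cd uv by auto
  moreover have "snd (hyp_act G p) \<ge> 1 / (80 * y)"
    unfolding snd_hyp_act[OF p] G using cd(4) pos Im_w by (intro divide_left_mono) auto
  ultimately show ?thesis using that by blast
qed

text \<open>The upper row of either frame lies in the inverse ideal of the lower row of the other,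
  so all cross products are integral. Hence the cusps can be indexed, and counted, by the pairs
  \<open>(s, a)\<close>.\<close>

lemma cusp_frame_unique:
  assumes "cusp_frame s a C G" "cusp_frame s a C' G'"
  shows "adj2 G ** G' \<in> \<Gamma>"
proof -
  have J: "inv_ideal (G $ 2 $ 1) (G $ 2 $ 2) = inv_ideal (G' $ 2 $ 1) (G' $ 2 $ 2)" and det: "det G = 1" "det G' = 1"
    and m: "G $ 1 $ 1 \<in> inv_ideal (G $ 2 $ 1) (G $ 2 $ 2)" "G $ 1 $ 2 \<in> inv_ideal (G $ 2 $ 1) (G $ 2 $ 2)"
    "G' $ 1 $ 1 \<in> inv_ideal (G' $ 2 $ 1) (G' $ 2 $ 2)" "G' $ 1 $ 2 \<in> inv_ideal (G' $ 2 $ 1) (G' $ 2 $ 2)"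
    using assms unfolding cusp_frame_def by auto
  have "G' $ 1 $ 1 * G $ 2 $ 1 \<in> \<O>" "G' $ 1 $ 1 * G $ 2 $ 2 \<in> \<O>" "G' $ 1 $ 2 * G $ 2 $ 1 \<in> \<O>" "G' $ 1 $ 2 * G $ 2 $ 2 \<in> \<O>"
    using m(3,4) unfolding J[symmetric] unfolding inv_ideal_def by auto
  moreover have "G $ 1 $ 1 * G' $ 2 $ 1 \<in> \<O>" "G $ 1 $ 1 * G' $ 2 $ 2 \<in> \<O>" "G $ 1 $ 2 * G' $ 2 $ 1 \<in> \<O>" "G $ 1 $ 2 * G' $ 2 $ 2 \<in> \<O>"
    using m(1,2) unfolding J unfolding inv_ideal_def by auto
  moreover have "(adj2 G ** G') $ 1 $ 1 = G' $ 1 $ 1 * G $ 2 $ 2 - G $ 1 $ 2 * G' $ 2 $ 1"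
    "(adj2 G ** G') $ 1 $ 2 = G' $ 1 $ 2 * G $ 2 $ 2 - G $ 1 $ 2 * G' $ 2 $ 2"
    "(adj2 G ** G') $ 2 $ 1 = G $ 1 $ 1 * G' $ 2 $ 1 - G' $ 1 $ 1 * G $ 2 $ 1"
    "(adj2 G ** G') $ 2 $ 2 = G $ 1 $ 1 * G' $ 2 $ 2 - G' $ 1 $ 2 * G $ 2 $ 1"
    by (simp_all add: matrix_mult_2 algebra_simps)
  ultimately show ?thesis
    using det by (simp add: \<Gamma>_iff det_mul O_diff)
qed

section \<open>Translations at a cusp\<close>

definition unip :: "complex \<Rightarrow> complex ^ 2 ^ 2" where
  "unip l = vector [vector [1, l], vector [0, 1]]"

lemma unip_nth [simp]: "unip l $ 1 $ 1 = 1" "unip l $ 1 $ 2 = l" "unip l $ 2 $ 1 = 0" "unip l $ 2 $ 2 = 1"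
  by (simp_all add: unip_def)

lemma det_unip [simp]: "det (unip l) = 1"
  by (simp add: det2)

lemma hyp_act_unip: "p \<in> H3 \<Longrightarrow> hyp_act (unip l) p = (fst p + l, snd p)"
  by (simp add: prod_eq_iff hyp_act_upper)

text \<open>The translations that lie in the conjugate of \<open>\<Gamma>\<close> by a frame \<open>G\<close>.\<close>

definition trans_lat :: "complex ^ 2 ^ 2 \<Rightarrow> complex set" where
  "trans_lat G = {l. l * (G $ 2 $ 1 * G $ 2 $ 1) \<in> \<O> \<and> l * (G $ 2 $ 1 * G $ 2 $ 2) \<in> \<O> \<and> l * (G $ 2 $ 2 * G $ 2 $ 2) \<in> \<O>}"

lemma trans_lat_add: "l \<in> trans_lat G \<Longrightarrow> l' \<in> trans_lat G \<Longrightarrow> l + l' \<in> trans_lat G"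
  by (simp add: trans_lat_def ring_distribs O_add)

lemma trans_lat_mult: "x \<in> \<O> \<Longrightarrow> l \<in> trans_lat G \<Longrightarrow> x * l \<in> trans_lat G"
  by (simp add: trans_lat_def mult.assoc O_mult)

lemma trans_lat_of_int: "l \<in> trans_lat G \<Longrightarrow> of_int n * l \<in> trans_lat G"
  by (rule trans_lat_mult) simp_all

lemma unip_conj_mem:
  assumes l: "l \<in> trans_lat G" and det: "det G = 1"
  shows "adj2 G ** (unip l ** G) \<in> \<Gamma>"
proof -
  define p q c d where e: "p = G $ 1 $ 1" "q = G $ 1 $ 2" "c = G $ 2 $ 1" "d = G $ 2 $ 2"
  have pd: "p * d - q * c = 1" using det by (simp add: det2 e)
  have L: "l * (c * c) \<in> \<O>" "l * (c * d) \<in> \<O>" "l * (d * d) \<in> \<O>" using l by (auto simp: trans_lat_def e)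
  have "(adj2 G ** (unip l ** G)) $ 1 $ 1 = (p * d - q * c) + l * (c * d)"
    "(adj2 G ** (unip l ** G)) $ 1 $ 2 = l * (d * d)"
    "(adj2 G ** (unip l ** G)) $ 2 $ 1 = - (l * (c * c))"
    "(adj2 G ** (unip l ** G)) $ 2 $ 2 = (p * d - q * c) - l * (c * d)"
    by (simp_all add: matrix_mult_2 e algebra_simps)
  then show ?thesis
    unfolding \<Gamma>_iff using L det by (simp add: pd O_add O_diff O_minus det_mul)
qed

lemma frame_product:
  assumes "cusp_frame s a C G" "x \<in> lat ((of_int s + w) / of_int a)" "z \<in> lat ((of_int s + w) / of_int a)"
  shows "x * z \<in> trans_lat G"
proof -
  have "x \<in> inv_ideal (G $ 2 $ 1) (G $ 2 $ 2)" "z \<in> inv_ideal (G $ 2 $ 1) (G $ 2 $ 2)"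
    using assms unfolding cusp_frame_def by auto
  then have "(x * G $ 2 $ 1) * (z * G $ 2 $ 1) \<in> \<O>" "(x * G $ 2 $ 1) * (z * G $ 2 $ 2) \<in> \<O>" "(x * G $ 2 $ 2) * (z * G $ 2 $ 2) \<in> \<O>"
    unfolding inv_ideal_def by (auto intro!: O_mult[of "_ * _" "_ * _"])
  then show ?thesis by (simp add: trans_lat_def mult_ac)
qed

lemma lat_mem: "\<eta> \<in> lat \<eta>" "1 \<in> lat \<eta>"
proof -
  have "\<eta> = of_int 0 + of_int 1 * \<eta>" "1 = of_int 1 + of_int 0 * \<eta>" by simp_all
  then show "\<eta> \<in> lat \<eta>" "1 \<in> lat \<eta>" unfolding lat_def by blast+
qed

text \<open>The translation lattice is the square of the inverse ideal; as the form \<open>a X\<^sup>2 - B X + C\<close> vanishing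
  at \<open>\<eta>\<close> is primitive, its covolume is that of the ring divided by \<open>a\<^sup>2\<close>.\<close>

lemma trans_lat_basis:
  assumes f: "cusp_frame s a C G"
  obtains r \<xi> where "r > 0" "of_real r \<in> trans_lat G" "\<xi> \<in> trans_lat G" "Im \<xi> > 0" "r * Im \<xi> = y / (of_int a)\<^sup>2"
proof -
  define \<eta> where "\<eta> = (of_int s + w) / of_int a"
  have a1: "1 \<le> a" and N: "(cmod (of_int s + w))\<^sup>2 = of_int (a * C)" using f by (auto simp: cusp_frame_def)
  have a0: "complex_of_int a \<noteq> 0" using a1 by simp
  have swO: "of_int s + w \<in> \<O>" by (intro O_add O_int)
  obtain B where B: "2 * Re (of_int s + w) = of_int B" "(of_int s + w) + cnj (of_int s + w) = of_int B" using O_tr[OF swO] by blast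
  have Nc: "(of_int s + w) * cnj (of_int s + w) = of_int (a * C)"
    using N complex_norm_square[of "of_int s + w"] by (metis of_real_of_int_eq)
  have fp: "x * z \<in> trans_lat G" if "x \<in> lat \<eta>" "z \<in> lat \<eta>" for x z
    using frame_product[OF f] that unfolding \<eta>_def by blast
  have prod: "1 * 1 \<in> trans_lat G" "1 * \<eta> \<in> trans_lat G" "\<eta> * \<eta> \<in> trans_lat G"
    by (intro fp lat_mem)+
  have cn: "cnj (of_int s + w) = of_int B - (of_int s + w)" using B(2) by (simp add: algebra_simps)
  have sw: "of_int s + w = of_int a * \<eta>" using a0 by (simp add: \<eta>_def)
  have "(of_int s + w) * (of_int B - (of_int s + w)) = of_int a * of_int C" using Nc unfolding cn of_int_mult .
  then have "of_int a * (of_int B * \<eta> - of_int a * (\<eta> * \<eta>)) = of_int a * of_int C" unfolding sw by (simp add: algebra_simps)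
  then have quad: "of_int B * \<eta> - of_int a * (\<eta> * \<eta>) = of_int C" using a0 by (simp only: mult_cancel_left) simp
  define h where "h = gcd a B"
  have h: "h > 0" using a1 by (simp add: h_def gcd_pos_int)
  obtain a' B' where ab: "a = h * a'" "B = h * B'" unfolding h_def by (metis dvdE gcd_dvd1 gcd_dvd2)
  have h0: "complex_of_int h \<noteq> 0" using h by simp
  \<comment> \<open>Primitivity: a common divisor \<open>e\<close> of \<open>a\<close>,
    \<open>B\<close> and \<open>C\<close> makes \<open>(s + w) / e\<close> integral, and its
    \<open>w\<close>-coordinate \<open>1 / e\<close> must be an integer.\<close>
  have cop: "gcd h C = 1"
  proof -
    define e where "e = gcd h C"
    have e: "e > 0" using h by (simp add: e_def gcd_pos_int)
    obtain h' C' where hc: "h = e * h'" "C = e * C'" unfolding e_def by (metis dvdE gcd_dvd1 gcd_dvd2)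
    have "(of_int s + w) / of_int e \<in> \<O>"
    proof (rule int_closed[OF swO e])
      have "2 * Re ((of_int s + w) / of_int e) = 2 * Re (of_int s + w) / of_int e"
        by (metis Re_divide_of_real of_real_of_int_eq times_divide_eq_right)
      also have "\<dots> = of_int (h' * B')" unfolding B(1) ab(2) using e by (simp add: hc)
      finally show "2 * Re ((of_int s + w) / of_int e) \<in> \<int>" by (simp only: Ints_of_int)
      have "(cmod ((of_int s + w) / of_int e))\<^sup>2 = of_int (a * C) / (of_int e)\<^sup>2" unfolding N[symmetric] by (simp add: norm_divide power_divide)
      also have "\<dots> = of_int (h' * a' * C')" unfolding ab(1) hc(2) using e by (simp add: hc(1) power2_eq_square)
      finally show "(cmod ((of_int s + w) / of_int e))\<^sup>2 \<in> \<int>" by (simp only: Ints_of_int)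
    qed
    then obtain m n where mn: "(of_int s + w) / of_int e = of_int m + of_int n * w" by (auto simp: quad_ints_iff)
    have "Im ((of_int s + w) / of_int e) = y / of_int e" using Im_divide_of_real[of "of_int s + w" "of_int e"] by simp
    then have "1 / of_int e * y = of_int n * y" using mn by simp
    then have "1 / of_int e = (of_int n :: real)" by (rule mult_right_cancel[THEN iffD1, rotated]) (use Im_w in simp)
    then have "of_int (n * e) = (of_int 1 :: real)" using e by (simp add: field_simps)
    then have "n * e = 1" by (simp only: of_int_eq_iff)
    then have "e = 1" using e by (metis mult.commute pos_zmult_eq_1_iff)
    then show ?thesis by (simp add: e_def)
  qed
  have Ch: "of_int C / of_int h \<in> trans_lat G"
  proof -
    have "of_int h * (of_int C / of_int h) = of_int h * (of_int B' * (1 * \<eta>) + of_int (- a') * (\<eta> * \<eta>))"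
      using h0 quad[symmetric] unfolding ab by (simp add: algebra_simps)
    then have "of_int C / of_int h = of_int B' * (1 * \<eta>) + of_int (- a') * (\<eta> * \<eta>)" using h0 by (simp only: mult_cancel_left) simp
    then show ?thesis using trans_lat_add[OF trans_lat_of_int[OF prod(2)] trans_lat_of_int[OF prod(3)]] by metis
  qed
  obtain k l where kl: "k * h + l * C = 1" using cop bezout_int[of h C] by metis
  have "of_int 1 / of_int h = of_int l * (of_int C / of_int h) + of_int k * (1 * 1 :: complex)"
    unfolding kl[symmetric] using h0 by (simp add: field_simps)
  then have r: "complex_of_real (1 / of_int h) \<in> trans_lat G"
    using trans_lat_add[OF trans_lat_of_int[OF Ch, of l] trans_lat_of_int[OF prod(1), of k]] by simp
  obtain u v where uv: "u * a + v * B = h" unfolding h_def by (metis bezout_int)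
  \<comment> \<open>With \<open>u a + v B = h\<close> the quadratic relation gives
    \<open>a \<xi> = h \<eta> - v C\<close>, so \<open>\<xi>\<close> has imaginary part
    \<open>h y / a\<^sup>2\<close>, which pairs with \<open>r = 1 / h\<close>.\<close>
  define \<xi> where "\<xi> = of_int u * (1 * \<eta>) + of_int v * (\<eta> * \<eta>)"
  have xi: "\<xi> \<in> trans_lat G" unfolding \<xi>_def by (intro trans_lat_add trans_lat_of_int prod)
  have Ie: "Im \<eta> = y / of_int a" using Im_divide_of_real[of "of_int s + w" "of_int a"] by (simp add: \<eta>_def)
  have "of_int a * \<xi> = of_int h * \<eta> - of_int (v * C)"
  proof -
    have "of_int a * \<xi> = of_int (u * a) * \<eta> + of_int v * (of_int a * (\<eta> * \<eta>))" by (simp add: \<xi>_def algebra_simps)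
    also have "of_int a * (\<eta> * \<eta>) = of_int B * \<eta> - of_int C" using quad by (simp add: algebra_simps)
    finally show ?thesis unfolding uv[symmetric] by (simp add: algebra_simps)
  qed
  then have "Im (of_int a * \<xi>) = Im (of_int h * \<eta> - of_int (v * C))" by (rule arg_cong)
  then have "of_int a * Im \<xi> = of_int h * (y / of_int a)" unfolding minus_complex.sel Im_mult_of_int Ie by simp
  then have Ix: "Im \<xi> = of_int h * y / (of_int a)\<^sup>2" using a1 by (simp add: field_simps power2_eq_square)
  show ?thesis
  proof (rule that[of "1 / of_int h" \<xi>])
    show "Im \<xi> > 0" unfolding Ix using h a1 Im_w by simp
    show "1 / of_int h * Im \<xi> = y / (of_int a)\<^sup>2" unfolding Ix using h by simp
  qed (use h r xi in auto)
qed

text \<open>The inverse ideal has norm \<open>1 / a\<close>: by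
  \<open>\<eta> cnj \<eta> = C / a\<close>, the products of its elements with conjugates of its
  elements have denominator \<open>a\<close>.\<close>

lemma frame_norm_form:
  assumes f: "cusp_frame s a C G" and xz: "x \<in> lat ((of_int s + w) / of_int a)" "z \<in> lat ((of_int s + w) / of_int a)"
  shows "of_int a * (x * cnj z) \<in> \<O>"
proof -
  define \<eta> where "\<eta> = (of_int s + w) / of_int a"
  have a1: "1 \<le> a" and N: "(cmod (of_int s + w))\<^sup>2 = of_int (a * C)" using f by (auto simp: cusp_frame_def)
  have a0: "complex_of_int a \<noteq> 0" using a1 by simp
  have Nc: "(of_int s + w) * cnj (of_int s + w) = of_int (a * C)"
    using N complex_norm_square[of "of_int s + w"] by (metis of_real_of_int_eq)
  have sw: "of_int a * \<eta> = of_int s + w" using a0 by (simp add: \<eta>_def)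
  have csw: "of_int a * cnj \<eta> = cnj (of_int s + w)" unfolding sw[symmetric] by simp
  have "of_int a * (of_int a * (\<eta> * cnj \<eta>)) = (of_int a * \<eta>) * (of_int a * cnj \<eta>)" by (simp add: mult_ac)
  also have "\<dots> = of_int a * of_int C" unfolding sw csw Nc by simp
  finally have ee: "of_int a * (\<eta> * cnj \<eta>) = of_int C" using a0 by (simp only: mult_cancel_left) simp
  obtain m n m' n' where mn: "x = of_int m + of_int n * \<eta>" "z = of_int m' + of_int n' * \<eta>"
    using xz unfolding lat_def \<eta>_def[symmetric] by auto
  have "of_int a * (x * cnj z) = of_int (a * m * m') + of_int (m * n') * (of_int a * cnj \<eta>) + of_int (n * m') * (of_int a * \<eta>) + of_int (n * n') * (of_int a * (\<eta> * cnj \<eta>))"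
    unfolding mn by (simp add: algebra_simps)
  also have "\<dots> \<in> \<O>" unfolding sw csw ee by (intro O_add O_mult O_int O_cnj)
  finally show ?thesis .
qed

text \<open>Conjugation by a frame keeps the diagonal in the ring, puts the upper right entry in the
  square of the inverse ideal and the lower left one in the dual role. The integer in the last claim
  bounds translations from below and later provides the cofactor in the divisor condition.\<close>

lemma frame_conj_entries:
  assumes f: "cusp_frame s a C G" and A: "A \<in> \<Gamma>"
  defines "M \<equiv> G ** (A ** adj2 G)"
  shows "M $ 1 $ 1 \<in> \<O>" "M $ 2 $ 2 \<in> \<O>" "\<And>l. l \<in> trans_lat G \<Longrightarrow> M $ 2 $ 1 * l \<in> \<O>"
    "\<exists>n::nat. (of_int a)\<^sup>2 * (cmod (M $ 1 $ 2))\<^sup>2 = of_nat n"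
proof -
  define p q c d where e: "p = G $ 1 $ 1" "q = G $ 1 $ 2" "c = G $ 2 $ 1" "d = G $ 2 $ 2"
  define A1 A2 A3 A4 where Ae: "A1 = A $ 1 $ 1" "A2 = A $ 1 $ 2" "A3 = A $ 2 $ 1" "A4 = A $ 2 $ 2"
  have AO: "A1 \<in> \<O>" "A2 \<in> \<O>" "A3 \<in> \<O>" "A4 \<in> \<O>" using A by (auto simp: \<Gamma>_iff Ae)
  define L where "L = lat ((of_int s + w) / of_int a)"
  have pqL: "p \<in> L" "q \<in> L" and J: "inv_ideal c d = L" using f by (auto simp: cusp_frame_def e L_def)
  have pc: "p * c \<in> \<O>" "p * d \<in> \<O>" "q * c \<in> \<O>" "q * d \<in> \<O>"
    using pqL unfolding J[symmetric] inv_ideal_def by auto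
  have "M $ 1 $ 1 = A1 * (p * d) + A3 * (q * d) - A2 * (p * c) - A4 * (q * c)"
    by (simp add: M_def matrix_mult_2 e Ae algebra_simps)
  then show "M $ 1 $ 1 \<in> \<O>" using AO pc by (simp only: O_add O_diff O_mult)
  have "M $ 2 $ 2 = A2 * (p * c) + A4 * (p * d) - A1 * (q * c) - A3 * (q * d)"
    by (simp add: M_def matrix_mult_2 e Ae algebra_simps)
  then show "M $ 2 $ 2 \<in> \<O>" using AO pc by (simp only: O_add O_diff O_mult)
  show "M $ 2 $ 1 * l \<in> \<O>" if l: "l \<in> trans_lat G" for l
  proof -
    have L: "l * (c * c) \<in> \<O>" "l * (c * d) \<in> \<O>" "l * (d * d) \<in> \<O>" using l by (auto simp: trans_lat_def e)
    have "M $ 2 $ 1 * l = A1 * (l * (c * d)) + A3 * (l * (d * d)) - A2 * (l * (c * c)) - A4 * (l * (c * d))"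
      by (simp add: M_def matrix_mult_2 e Ae algebra_simps)
    then show ?thesis using AO L by (simp only: O_add O_diff O_mult)
  qed
  define \<beta> where "\<beta> = M $ 1 $ 2"
  have be: "\<beta> = A2 * (p * p) + A4 * (p * q) - A1 * (p * q) - A3 * (q * q)"
    by (simp add: \<beta>_def M_def matrix_mult_2 e Ae algebra_simps)
  \<comment> \<open>\<open>T\<close> contains the products of two elements of the ideal, hence
    \<open>\<beta>\<close>. As \<open>cnj \<beta>\<close> is a ring combination of conjugates of
    such products, membership in \<open>T\<close> makes \<open>a\<^sup>2 \<beta> cnj \<beta>\<close>
    integral.\<close>
  define T where "T = {u. \<forall>x\<in>L. \<forall>z\<in>L. (of_int a)\<^sup>2 * (u * cnj x * cnj z) \<in> \<O>}"
  have T: "u * v \<in> T" if "u \<in> L" "v \<in> L" for u v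
  proof -
    have "(of_int a * (u * cnj x)) * (of_int a * (v * cnj z)) \<in> \<O>" if "x \<in> L" "z \<in> L" for x z
      by (rule O_mult; rule frame_norm_form[OF f]) (use that \<open>u \<in> L\<close> \<open>v \<in> L\<close> in \<open>simp_all only: L_def\<close>)
    then show ?thesis unfolding T_def by (simp add: power2_eq_square mult_ac)
  qed
  have Tc: "o1 * u + o2 * v - o3 * v - o4 * x \<in> T" if "u \<in> T" "v \<in> T" "x \<in> T" "o1 \<in> \<O>" "o2 \<in> \<O>" "o3 \<in> \<O>" "o4 \<in> \<O>" for o1 o2 o3 o4 u v x
  proof -
    have "(of_int a)\<^sup>2 * ((o1 * u + o2 * v - o3 * v - o4 * x) * cnj r * cnj z) =
       o1 * ((of_int a)\<^sup>2 * (u * cnj r * cnj z)) + o2 * ((of_int a)\<^sup>2 * (v * cnj r * cnj z)) -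
       o3 * ((of_int a)\<^sup>2 * (v * cnj r * cnj z)) - o4 * ((of_int a)\<^sup>2 * (x * cnj r * cnj z))" for r z
      by (simp add: algebra_simps)
    then show ?thesis using that unfolding T_def by (simp add: O_add O_diff O_mult)
  qed
  have bT: "\<beta> \<in> T" unfolding be using pqL AO by (intro Tc T)
  have cb: "cnj \<beta> = cnj A2 * (cnj p * cnj p) + cnj A4 * (cnj p * cnj q) - cnj A1 * (cnj p * cnj q) - cnj A3 * (cnj q * cnj q)"
    unfolding be by simp
  have "(of_int a)\<^sup>2 * (\<beta> * cnj \<beta>) = cnj A2 * ((of_int a)\<^sup>2 * (\<beta> * cnj p * cnj p)) + cnj A4 * ((of_int a)\<^sup>2 * (\<beta> * cnj p * cnj q)) -
      cnj A1 * ((of_int a)\<^sup>2 * (\<beta> * cnj p * cnj q)) - cnj A3 * ((of_int a)\<^sup>2 * (\<beta> * cnj q * cnj q))"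
    unfolding cb by (simp add: algebra_simps)
  also have "\<dots> \<in> \<O>" using bT pqL AO unfolding T_def by (simp add: O_add O_diff O_mult O_cnj)
  finally have O: "(of_int a)\<^sup>2 * (\<beta> * cnj \<beta>) \<in> \<O>" .
  have re: "(of_int a)\<^sup>2 * (\<beta> * cnj \<beta>) = complex_of_real ((of_int a)\<^sup>2 * (cmod \<beta>)\<^sup>2)"
    unfolding of_real_mult complex_norm_square by simp
  obtain n where n: "complex_of_real ((of_int a)\<^sup>2 * (cmod \<beta>)\<^sup>2) = of_int n" using O_real[OF O[unfolded re]] by auto
  then have n': "(of_int a)\<^sup>2 * (cmod \<beta>)\<^sup>2 = of_int n" by (metis of_real_eq_iff of_real_of_int_eq)
  then have "n \<ge> 0" by (metis of_int_0_le_iff zero_le_power2 mult_nonneg_nonneg)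
  then have "(of_int a)\<^sup>2 * (cmod \<beta>)\<^sup>2 = of_nat (nat n)" using n' by simp
  then show "\<exists>n::nat. (of_int a)\<^sup>2 * (cmod (M $ 1 $ 2))\<^sup>2 = of_nat n" unfolding \<beta>_def by blast
qed

text \<open>Hermite normal form of the sublattice \<open>\<kappa> \<Lambda>\<close> of the ring, of index \<open>N = e n\<close>.\<close>

lemma trans_lat_reduce:
  assumes f: "cusp_frame s a C G" and k0: "\<kappa> \<noteq> 0" and kl: "\<And>l. l \<in> trans_lat G \<Longrightarrow> \<kappa> * l \<in> \<O>" and al: "\<alpha> \<in> \<O>"
  obtains l i j N :: nat and l' where "l' \<in> trans_lat G" "\<alpha> + \<kappa> * l' = of_nat j + of_nat i * w"
    "(cmod \<kappa>)\<^sup>2 = (of_int a)\<^sup>2 * real N" "(i + 1) * (j + 1) \<le> N"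
proof -
  have a1: "1 \<le> a" using f by (auto simp: cusp_frame_def)
  obtain r \<xi> where rx: "r > 0" "of_real r \<in> trans_lat G" "\<xi> \<in> trans_lat G" "Im \<xi> > 0" "r * Im \<xi> = y / (of_int a)\<^sup>2"
    using trans_lat_basis[OF f] .
  obtain x1 y1 where 1: "\<kappa> * of_real r = of_int x1 + of_int y1 * w" using kl[OF rx(2)] by (auto simp: quad_ints_iff)
  obtain x2 y2 where 2: "\<kappa> * \<xi> = of_int x2 + of_int y2 * w" using kl[OF rx(3)] by (auto simp: quad_ints_iff)
  \<comment> \<open>The index of \<open>\<kappa> \<Lambda>\<close>, that is, the determinant of
    \<open>\<kappa> r\<close> and \<open>\<kappa> \<xi>\<close> in the basis \<open>1\<close>,
    \<open>w\<close>; comparing areas identifies it as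
    \<open>|\<kappa>|\<^sup>2 / a\<^sup>2\<close>.\<close>
  define \<Delta> where "\<Delta> = x1 * y2 - x2 * y1"
  have "cnj (\<kappa> * of_real r) * (\<kappa> * \<xi>) = of_real ((cmod \<kappa>)\<^sup>2 * r) * \<xi>"
    unfolding of_real_mult complex_norm_square by (simp add: mult_ac)
  then have "Im (cnj (\<kappa> * of_real r) * (\<kappa> * \<xi>)) = Im (complex_of_real ((cmod \<kappa>)\<^sup>2 * r) * \<xi>)" by (rule arg_cong)
  also have "\<dots> = (cmod \<kappa>)\<^sup>2 * r * Im \<xi>" by (simp only: times_complex.sel Re_complex_of_real Im_complex_of_real)
  finally have "Im (cnj (\<kappa> * of_real r) * (\<kappa> * \<xi>)) = (cmod \<kappa>)\<^sup>2 * r * Im \<xi>" .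
  moreover have "Im (cnj (\<kappa> * of_real r) * (\<kappa> * \<xi>)) = of_int \<Delta> * y"
    unfolding 1 2 by (simp add: \<Delta>_def algebra_simps)
  ultimately have "of_int \<Delta> * y = (cmod \<kappa>)\<^sup>2 / (of_int a)\<^sup>2 * y" using rx(5) by (simp add: mult.assoc)
  then have D: "of_int \<Delta> = (cmod \<kappa>)\<^sup>2 / (of_int a)\<^sup>2"
    by (rule mult_right_cancel[THEN iffD1, rotated]) (use Im_w in simp)
  moreover have "(cmod \<kappa>)\<^sup>2 / (of_int a)\<^sup>2 > 0" using k0 a1 by simp
  ultimately have Dp: "\<Delta> > 0" by (metis of_int_0_less_iff)
  define e where "e = gcd y1 y2"
  have "y1 \<noteq> 0 \<or> y2 \<noteq> 0" using Dp by (auto simp: \<Delta>_def)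
  then have e: "e > 0" by (auto simp: e_def gcd_pos_int)
  obtain y1' y2' where y': "y1 = e * y1'" "y2 = e * y2'" unfolding e_def by (metis dvdE gcd_dvd1 gcd_dvd2)
  define n where "n = x1 * y2' - x2 * y1'"
  have Den: "\<Delta> = e * n" unfolding \<Delta>_def n_def y' by (simp add: algebra_simps)
  have n: "n > 0" using Dp e unfolding Den by (simp add: zero_less_mult_iff)
  obtain u v where uv: "u * y1 + v * y2 = e" unfolding e_def by (metis bezout_int)
  \<comment> \<open>\<open>l1\<close> cancels the \<open>w\<close>-coordinates and \<open>l2\<close>
    combines them to their gcd: the triangular generators \<open>n\<close> and
    \<open>g + e w\<close>. Reduction first modulo \<open>e\<close>, then modulo \<open>n\<close>,
    gives \<open>i < e\<close> and \<open>j < n\<close>.\<close>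
  define l1 where "l1 = of_int y2' * of_real r + of_int (- y1') * \<xi>"
  define l2 where "l2 = of_int u * of_real r + of_int v * \<xi>"
  have lm: "l1 \<in> trans_lat G" "l2 \<in> trans_lat G" unfolding l1_def l2_def by (intro trans_lat_add trans_lat_of_int rx)+
  have k1: "\<kappa> * l1 = of_int n"
  proof -
    have "\<kappa> * l1 = of_int y2' * (\<kappa> * of_real r) - of_int y1' * (\<kappa> * \<xi>)" by (simp add: l1_def algebra_simps)
    also have "\<dots> = of_int n" unfolding 1 2 y' by (simp add: n_def algebra_simps)
    finally show ?thesis .
  qed
  define g where "g = u * x1 + v * x2"
  have k2: "\<kappa> * l2 = of_int g + of_int e * w"
  proof -
    have "\<kappa> * l2 = of_int u * (\<kappa> * of_real r) + of_int v * (\<kappa> * \<xi>)" by (simp add: l2_def algebra_simps)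
    also have "\<dots> = of_int g + of_int (u * y1 + v * y2) * w" unfolding 1 2 by (simp add: g_def algebra_simps)
    finally show ?thesis unfolding uv .
  qed
  obtain A B where AB: "\<alpha> = of_int A + of_int B * w" using al by (auto simp: quad_ints_iff)
  define m where "m = B div e"
  define A' where "A' = A - m * g"
  define m' where "m' = A' div n"
  define l' where "l' = of_int (- m) * l2 + of_int (- m') * l1"
  have l': "l' \<in> trans_lat G" unfolding l'_def by (intro trans_lat_add trans_lat_of_int lm)
  have "\<alpha> + \<kappa> * l' = \<alpha> - of_int m * (\<kappa> * l2) - of_int m' * (\<kappa> * l1)" by (simp add: l'_def algebra_simps)
  also have "\<dots> = of_int (A' - n * m') + of_int (B - e * m) * w" unfolding k1 k2 AB by (simp add: A'_def algebra_simps)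
  also have "A' - n * m' = A' mod n" by (simp add: m'_def minus_mult_div_eq_mod)
  also have "B - e * m = B mod e" by (simp add: m_def minus_mult_div_eq_mod)
  finally have red: "\<alpha> + \<kappa> * l' = of_int (A' mod n) + of_int (B mod e) * w" .
  define i j where "i = nat (B mod e)" "j = nat (A' mod n)"
  have ij: "int i = B mod e" "int j = A' mod n" using e n by (auto simp: i_j_def)
  have ijb: "int i + 1 \<le> e" "int j + 1 \<le> n" unfolding ij using pos_mod_bound[OF e, of B] pos_mod_bound[OF n, of A'] by simp_all
  have "(int i + 1) * (int j + 1) \<le> e * n" using ijb e by (intro mult_mono) auto
  then have P: "(i + 1) * (j + 1) \<le> nat \<Delta>" unfolding Den[symmetric] by (metis (no_types, lifting) nat_int nat_mono of_nat_1 of_nat_add of_nat_mult)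
  show ?thesis
  proof (rule that[OF l' _ _ P])
    show "\<alpha> + \<kappa> * l' = of_nat j + of_nat i * w" unfolding red ij[symmetric] by simp
    show "(cmod \<kappa>)\<^sup>2 = (of_int a)\<^sup>2 * real (nat \<Delta>)" using D Dp a1 by (simp add: field_simps)
  qed
qed

lemma trans_lat_cover:
  assumes "r > 0" "of_real r \<in> trans_lat G" "\<xi> \<in> trans_lat G" "Im \<xi> > 0"
  obtains l where "l \<in> trans_lat G" "0 \<le> Re (z + l)" "Re (z + l) \<le> r" "0 \<le> Im (z + l)" "Im (z + l) \<le> Im \<xi>"
proof -
  define m where "m = \<lfloor>Im z / Im \<xi>\<rfloor>"
  define z' where "z' = z - of_int m * \<xi>"
  define n where "n = \<lfloor>Re z' / r\<rfloor>"
  define l where "l = of_int (- m) * \<xi> + of_int (- n) * of_real r"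
  have zl: "z + l = z' - of_int n * of_real r" by (simp add: l_def z'_def)
  have "of_int m \<le> Im z / Im \<xi>" "Im z / Im \<xi> < of_int m + 1" unfolding m_def by linarith+
  then have "0 \<le> Im z'" "Im z' \<le> Im \<xi>" using assms(4) by (simp_all add: z'_def field_simps)
  moreover have "of_int n \<le> Re z' / r" "Re z' / r < of_int n + 1" unfolding n_def by linarith+
  then have "0 \<le> Re z' - of_int n * r" "Re z' - of_int n * r \<le> r" using assms(1) by (simp_all add: field_simps)
  moreover have "l \<in> trans_lat G" unfolding l_def by (intro trans_lat_add trans_lat_of_int assms)
  ultimately show ?thesis using that[of l] unfolding zl by simp
qed

end

section \<open>Covering the thin part\<close>

lemma adj2_mult_rev: "adj2 (A ** B) = adj2 B ** adj2 A"
  by (simp add: mat2_eq_iff matrix_mult_2 algebra_simps)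

lemma adj2_adj2 [simp]: "adj2 (adj2 A) = A"
  by (simp add: mat2_eq_iff)

definition conj2 :: "complex ^ 2 ^ 2 \<Rightarrow> complex ^ 2 ^ 2 \<Rightarrow> complex ^ 2 ^ 2" where
  "conj2 g A = g ** (A ** adj2 g)"

lemma det_conj2: "det g = 1 \<Longrightarrow> det A = 1 \<Longrightarrow> det (conj2 g A) = 1"
  by (simp add: conj2_def det_mul)

lemma hyp_act_conj2:
  assumes "det g = 1" "det A = 1" "x \<in> H3"
  shows "hyp_act (conj2 g A) (hyp_act g x) = hyp_act g (hyp_act A x)"
proof -
  have "hyp_act (conj2 g A) (hyp_act g x) = hyp_act g (hyp_act A (hyp_act (adj2 g) (hyp_act g x)))"
    unfolding conj2_def using assms by (simp add: hyp_act_mult[symmetric] det_mul hyp_act_H3)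
  then show ?thesis using assms by (simp add: hyp_act_adj2)
qed

lemma hyp_dist_conj2:
  assumes "det g = 1" "det A = 1" "x \<in> H3"
  shows "hyp_dist (hyp_act g x) (hyp_act (conj2 g A) (hyp_act g x)) = hyp_dist x (hyp_act A x)"
  using assms by (simp add: hyp_act_conj2 hyp_dist_isometry hyp_act_H3)

lemma acts_nontrivially_conj2:
  assumes "det g = 1" "det A = 1" "acts_nontrivially A"
  shows "acts_nontrivially (conj2 g A)"
proof -
  obtain x where x: "x \<in> H3" "hyp_act A x \<noteq> x" using assms(3) by (auto simp: acts_nontrivially_def)
  have "hyp_act (conj2 g A) (hyp_act g x) \<noteq> hyp_act g x"
  proof
    assume "hyp_act (conj2 g A) (hyp_act g x) = hyp_act g x"
    then have "hyp_act (adj2 g) (hyp_act g (hyp_act A x)) = hyp_act (adj2 g) (hyp_act g x)"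
      using assms x by (simp add: hyp_act_conj2)
    then show False using assms x by (simp add: hyp_act_adj2 hyp_act_H3)
  qed
  then show ?thesis using assms x hyp_act_H3 unfolding acts_nontrivially_def by blast
qed

context discrete_group
begin

lemma conj2_mem: "g \<in> \<Gamma> \<Longrightarrow> A \<in> \<Gamma> \<Longrightarrow> conj2 g A \<in> \<Gamma>"
  unfolding conj2_def by (intro mult_mem adj2_mem)

text \<open>The slack 1 yields an element even if the infimum is not attained, and
  \<open>\<sigma>\<close> leads from \<open>p\<close> to the lift that \<open>SOME\<close> selects
  in \<open>injectivity_radius\<close>.\<close>

lemma thin_part_displacement:
  assumes p: "p \<in> \<Union>(thin_part \<Gamma> R)"
  obtains \<sigma> A where "p \<in> H3" "\<sigma> \<in> \<Gamma>" "A \<in> \<Gamma>" "acts_nontrivially A"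
    "hyp_dist (hyp_act \<sigma> p) (hyp_act A (hyp_act \<sigma> p)) \<le> 2 * R + 1"
proof -
  obtain x where x: "p \<in> x" "x \<in> hyp_quotient \<Gamma>" "injectivity_radius \<Gamma> x \<le> ereal R"
    using p by (auto simp: thin_part_def)
  obtain p1 where p1: "p1 \<in> H3" "x = hyp_orbit \<Gamma> p1" using x(2) by (auto simp: hyp_quotient_def)
  define p0 where "p0 = (SOME p. p \<in> x)"
  have "p0 \<in> x" unfolding p0_def using x(1) by (rule someI)
  then obtain B0 where B0: "B0 \<in> \<Gamma>" "p0 = hyp_act B0 p1" using p1(2) by (auto simp: hyp_orbit_def)
  obtain B where B: "B \<in> \<Gamma>" "p = hyp_act B p1" using x(1) p1(2) by (auto simp: hyp_orbit_def)
  have pH: "p \<in> H3" using B p1 act_mem_H3 by simp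
  have e: "hyp_act (adj2 B) p = p1" using B p1 det1 by (simp add: hyp_act_adj2)
  have "hyp_act (B0 ** adj2 B) p = hyp_act B0 (hyp_act (adj2 B) p)"
    using B0(1) B(1) pH det1 by (intro hyp_act_mult[symmetric]) auto
  then have p0: "p0 = hyp_act (B0 ** adj2 B) p" unfolding e B0(2) by simp
  have "\<exists>A\<in>{A \<in> \<Gamma>. acts_nontrivially A}. hyp_dist p0 (hyp_act A p0) \<le> 2 * R + 1"
  proof (rule ccontr)
    assume n: "\<not> ?thesis"
    let ?I = "INF A\<in>{A \<in> \<Gamma>. acts_nontrivially A}. ereal (hyp_dist p0 (hyp_act A p0))"
    have "ereal (2 * R + 1) \<le> ?I" using n by (intro INF_greatest) auto
    then have "ereal (2 * R + 1) / 2 \<le> ?I / 2" by (intro ereal_divide_right_mono) auto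
    also have "\<dots> \<le> ereal R" using x(3) by (simp add: injectivity_radius_def p0_def Let_def)
    finally show False by simp
  qed
  then show ?thesis using that[of "B0 ** adj2 B"] pH p0 B0 B mult_mem adj2_mem by auto
qed

end

section \<open>Fixed frames and rectangles for all cusps\<close>

context quad_ring
begin

lemma frame_translate:
  assumes l: "l \<in> trans_lat G" and det: "det G = 1" and q: "q \<in> H3"
  defines "\<tau> \<equiv> adj2 G ** (unip l ** G)"
  shows "\<tau> \<in> \<Gamma>" "hyp_act G (hyp_act \<tau> q) = (fst (hyp_act G q) + l, snd (hyp_act G q))"
proof -
  show "\<tau> \<in> \<Gamma>" unfolding \<tau>_def by (rule unip_conj_mem[OF l det])
  have "hyp_act G (hyp_act \<tau> q) = hyp_act (unip l) (hyp_act G q)"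
    unfolding \<tau>_def using det q by (simp add: hyp_act_mult[symmetric] det_mul hyp_act_H3 hyp_act_adj2)
  then show "hyp_act G (hyp_act \<tau> q) = (fst (hyp_act G q) + l, snd (hyp_act G q))"
    using det q by (simp add: hyp_act_unip hyp_act_H3)
qed

lemma frame_translate_conj2:
  assumes det: "det G = 1"
  shows "conj2 G (conj2 (adj2 G ** (unip l ** G)) A) = conj2 (unip l) (conj2 G A)"
proof -
  have "conj2 G (conj2 (adj2 G ** (unip l ** G)) A) =
      (G ** adj2 G) ** (unip l ** (G ** (A ** (adj2 G ** (adj2 (unip l) ** (G ** adj2 G))))))"
    by (simp add: conj2_def adj2_mult_rev matrix_mul_assoc)
  also have "\<dots> = conj2 (unip l) (conj2 G A)"
    unfolding adj2_mult(2)[OF det] by (simp add: conj2_def matrix_mul_assoc)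
  finally show ?thesis .
qed

lemma conj2_unip_entries:
  "conj2 (unip l) M $ 1 $ 1 = M $ 1 $ 1 + M $ 2 $ 1 * l" "conj2 (unip l) M $ 2 $ 1 = M $ 2 $ 1"
  by (simp_all add: conj2_def matrix_mult_2 algebra_simps)

text \<open>Pairs stand for cusps up to \<open>\<Gamma>\<close>. Several pairs may stand for the
  same cusp, which is harmless in upper bounds.\<close>

definition cusps :: "(int \<times> int) set" where
  "cusps = {(s, a). \<exists>C G. cusp_frame s a C G}"

definition frame :: "int \<times> int \<Rightarrow> complex ^ 2 ^ 2" where
  "frame x = (SOME G. \<exists>C. cusp_frame (fst x) (snd x) C G)"

lemma frame:
  assumes "x \<in> cusps"
  shows "\<exists>C. cusp_frame (fst x) (snd x) C (frame x)"
proof -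
  have "\<exists>G C. cusp_frame (fst x) (snd x) C G" using assms unfolding cusps_def by (cases x) auto
  then show ?thesis unfolding frame_def by (rule someI_ex)
qed

lemma cusps_bounds:
  assumes "(s, a) \<in> cusps"
  shows "1 \<le> a" "0 \<le> s" "s < a" "of_int a \<le> 2 * y" "\<exists>C. (cmod (of_int s + w))\<^sup>2 = of_int (a * C)"
  using assms by (auto simp: cusps_def cusp_frame_def)

lemma finite_cusps: "finite cusps"
proof (rule finite_subset)
  show "cusps \<subseteq> {0..\<lceil>2 * y\<rceil>} \<times> {0..\<lceil>2 * y\<rceil>}"
  proof
    fix x assume x: "x \<in> cusps"
    obtain s a where sa: "x = (s, a)" by (cases x)
    have b: "1 \<le> a" "0 \<le> s" "s < a" "of_int a \<le> 2 * y" using cusps_bounds x sa by auto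
    then have "a \<le> \<lceil>2 * y\<rceil>" by linarith
    then show "x \<in> {0..\<lceil>2 * y\<rceil>} \<times> {0..\<lceil>2 * y\<rceil>}" using b sa by auto
  qed
qed simp

lemma det_frame: "x \<in> cusps \<Longrightarrow> det (frame x) = 1"
  using frame unfolding cusp_frame_def by blast

text \<open>The frame found for \<open>p\<close> is replaced by the one fixed for its pair:
  \<open>C\<close> is determined by \<open>s\<close> and \<open>a\<close>, and
  \<open>cusp_frame_unique\<close> places the difference in \<open>\<Gamma>\<close>.\<close>

lemma reach_cusp:
  assumes p: "p \<in> H3"
  obtains x \<sigma> where "x \<in> cusps" "\<sigma> \<in> \<Gamma>" "snd (hyp_act (frame x) (hyp_act \<sigma> p)) \<ge> 1 / (80 * y)"
proof -
  obtain s a C G where G: "cusp_frame s a C G" "snd (hyp_act G p) \<ge> 1 / (80 * y)" using cusp_frame_exists[OF p] .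
  have x: "(s, a) \<in> cusps" using G by (auto simp: cusps_def)
  obtain C' where C': "cusp_frame s a C' (frame (s, a))" using frame[OF x] by auto
  have "of_int (a * C) = (of_int (a * C') :: real)" "1 \<le> a" using G(1) C' unfolding cusp_frame_def by auto
  then have "C' = C" by (simp only: of_int_eq_iff) simp
  then have m: "adj2 (frame (s, a)) ** G \<in> \<Gamma>" using cusp_frame_unique[OF _ G(1)] C' by blast
  have d: "det (frame (s, a)) = 1" "det G = 1" using C' G(1) by (auto simp: cusp_frame_def)
  have "hyp_act (frame (s, a)) (hyp_act (adj2 (frame (s, a)) ** G) p) = hyp_act G p"
    using d p by (simp add: hyp_act_mult[symmetric] hyp_act_H3 hyp_act_adj2)
  then show ?thesis using that[OF x m] G(2) by simp
qed

definition cusp_r :: "int \<times> int \<Rightarrow> real" where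
  "cusp_r x = (SOME r. \<exists>\<xi>. r > 0 \<and> of_real r \<in> trans_lat (frame x) \<and> \<xi> \<in> trans_lat (frame x) \<and> Im \<xi> > 0 \<and> r * Im \<xi> = y / (of_int (snd x))\<^sup>2)"

text \<open>Meant as the rectangle with sides \<open>r\<close> and \<open>Im \<xi>\<close> from
  \<open>trans_lat_basis\<close>; the second side is recovered from the area, since
  \<open>\<xi>\<close> is not fixed along with \<open>r\<close>.\<close>

definition cusp_rect :: "int \<times> int \<Rightarrow> complex set" where
  "cusp_rect x = cbox 0 (Complex (cusp_r x) (y / (of_int (snd x))\<^sup>2 / cusp_r x))"

lemma cusp_rect:
  assumes x: "x \<in> cusps"
  shows "\<exists>l\<in>trans_lat (frame x). z + l \<in> cusp_rect x" "emeasure lborel (cusp_rect x) = ennreal (y / (of_int (snd x))\<^sup>2)"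
proof -
  have "\<exists>r \<xi>. r > 0 \<and> of_real r \<in> trans_lat (frame x) \<and> \<xi> \<in> trans_lat (frame x) \<and> Im \<xi> > 0 \<and> r * Im \<xi> = y / (of_int (snd x))\<^sup>2"
  proof -
    obtain C where f: "cusp_frame (fst x) (snd x) C (frame x)" using frame[OF x] by blast
    show ?thesis by (rule trans_lat_basis[OF f]) blast
  qed
  then have "\<exists>\<xi>. cusp_r x > 0 \<and> of_real (cusp_r x) \<in> trans_lat (frame x) \<and> \<xi> \<in> trans_lat (frame x) \<and> Im \<xi> > 0 \<and> cusp_r x * Im \<xi> = y / (of_int (snd x))\<^sup>2"
    unfolding cusp_r_def by (rule someI_ex)
  then obtain \<xi> where xi: "cusp_r x > 0" "of_real (cusp_r x) \<in> trans_lat (frame x)" "\<xi> \<in> trans_lat (frame x)" "Im \<xi> > 0" "cusp_r x * Im \<xi> = y / (of_int (snd x))\<^sup>2"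
    by blast
  have e: "y / (of_int (snd x))\<^sup>2 / cusp_r x = Im \<xi>" unfolding xi(5)[symmetric] using xi(1) by simp
  obtain l where l: "l \<in> trans_lat (frame x)" "0 \<le> Re (z + l)" "Re (z + l) \<le> cusp_r x" "0 \<le> Im (z + l)" "Im (z + l) \<le> Im \<xi>"
    using trans_lat_cover[OF xi(1-4)] .
  then have "z + l \<in> cusp_rect x" unfolding cusp_rect_def e by (simp add: in_cbox_complex_iff)
  then show "\<exists>l\<in>trans_lat (frame x). z + l \<in> cusp_rect x" using l(1) by blast
  have "emeasure lborel (cusp_rect x) = ennreal (cusp_r x * Im \<xi>)"
    unfolding cusp_rect_def e using xi by (simp add: emeasure_lborel_cbox_eq Basis_complex_def inner_complex_def)
  then show "emeasure lborel (cusp_rect x) = ennreal (y / (of_int (snd x))\<^sup>2)" using xi(5) by simp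
qed

lemma cusp_rect_borel [measurable]: "cusp_rect x \<in> sets borel"
  by (simp add: cusp_rect_def)

definition cusp_nbhd :: "int \<times> int \<Rightarrow> real \<Rightarrow> (complex \<times> real) set" where
  "cusp_nbhd x t = {p. fst p \<in> cusp_rect x \<and> t \<le> snd p}"

lemma cusp_nbhd:
  assumes "x \<in> cusps" "t > 0"
  shows "cusp_nbhd x t \<in> sets hyp_volume" "emeasure hyp_volume (cusp_nbhd x t) = ennreal (y / (2 * (of_int (snd x))\<^sup>2 * t\<^sup>2))"
proof -
  show "cusp_nbhd x t \<in> sets hyp_volume" unfolding cusp_nbhd_def by (rule hyp_volume_cusp(1)) (use assms in simp_all)
  have "emeasure hyp_volume (cusp_nbhd x t) = ennreal (y / (of_int (snd x))\<^sup>2) * ennreal (1 / (2 * t\<^sup>2))"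
    unfolding cusp_nbhd_def using assms by (simp add: hyp_volume_cusp(2) cusp_rect(2))
  also have "\<dots> = ennreal (y / (2 * (of_int (snd x))\<^sup>2 * t\<^sup>2))"
    using Im_w by (simp add: ennreal_mult'[symmetric] mult_ac)
  finally show "emeasure hyp_volume (cusp_nbhd x t) = ennreal (y / (2 * (of_int (snd x))\<^sup>2 * t\<^sup>2))" .
qed

lemma frame_vimage:
  assumes "x \<in> cusps" "S \<in> sets hyp_volume"
  shows "{p \<in> H3. hyp_act (frame x) p \<in> S} \<in> sets hyp_volume"
    "emeasure hyp_volume {p \<in> H3. hyp_act (frame x) p \<in> S} = emeasure hyp_volume S"
  using hyp_act_vimage[OF det_frame[OF assms(1)] assms(2)] .

text \<open>By \<open>reach_cusp\<close> and translation, neighbourhoods of height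
  \<open>1 / (80 y)\<close> cover; \<open>3200 = 80\<^sup>2 / 2\<close>. The bound serves for small
  \<open>y\<close> and for finiteness, which matters because \<open>enn2real\<close> sends infinity
  to 0.\<close>

lemma volume_upper_bound: "emeasure hyp_volume fd \<le> (\<Sum>x\<in>cusps. ennreal (3200 * y ^ 3 / (of_int (snd x))\<^sup>2))"
proof -
  define t0 where "t0 = 1 / (80 * y)"
  have t0: "t0 > 0" using Im_w by (simp add: t0_def)
  define E where "E = (\<Union>x\<in>cusps. {p \<in> H3. hyp_act (frame x) p \<in> cusp_nbhd x t0})"
  have Es: "E \<in> sets hyp_volume" unfolding E_def
    using finite_cusps frame_vimage(1) cusp_nbhd(1) t0 by (intro sets.finite_UN) auto
  have cov: "\<exists>A\<in>\<Gamma>. hyp_act A p \<in> E" if p: "p \<in> H3" for p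
  proof -
    obtain x \<sigma> where x: "x \<in> cusps" "\<sigma> \<in> \<Gamma>" "snd (hyp_act (frame x) (hyp_act \<sigma> p)) \<ge> 1 / (80 * y)" using reach_cusp[OF p] .
    define q where "q = hyp_act \<sigma> p"
    have q: "q \<in> H3" unfolding q_def using act_mem_H3 x p by blast
    obtain l where l: "l \<in> trans_lat (frame x)" "fst (hyp_act (frame x) q) + l \<in> cusp_rect x" using cusp_rect(1)[OF x(1)] by blast
    define \<tau> where "\<tau> = adj2 (frame x) ** (unip l ** frame x)"
    have t: "\<tau> \<in> \<Gamma>" "hyp_act (frame x) (hyp_act \<tau> q) = (fst (hyp_act (frame x) q) + l, snd (hyp_act (frame x) q))"
      unfolding \<tau>_def using frame_translate[OF l(1) det_frame[OF x(1)] q] by auto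
    have "hyp_act \<tau> q \<in> E"
      unfolding E_def
      by (rule UN_I[OF x(1)]) (use x(3) l(2) act_mem_H3[OF t(1) q] in \<open>simp add: cusp_nbhd_def t0_def t(2) flip: q_def\<close>)
    moreover have "hyp_act \<tau> q = hyp_act (\<tau> ** \<sigma>) p" unfolding q_def using t x p det1 by (simp add: hyp_act_mult)
    ultimately show ?thesis using mult_mem t(1) x(2) by metis
  qed
  have "emeasure hyp_volume fd = emeasure hyp_volume (fd \<inter> H3)" using fd_sub by (simp add: Int_absorb2)
  also have "\<dots> \<le> emeasure hyp_volume E" by (rule volume_le_cover[OF Es]) (use cov in auto)
  also have "\<dots> \<le> (\<Sum>x\<in>cusps. emeasure hyp_volume {p \<in> H3. hyp_act (frame x) p \<in> cusp_nbhd x t0})"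
    unfolding E_def using finite_cusps frame_vimage(1) cusp_nbhd(1) t0 by (intro emeasure_subadditive_finite) auto
  also have "\<dots> = (\<Sum>x\<in>cusps. ennreal (3200 * y ^ 3 / (of_int (snd x))\<^sup>2))"
  proof (rule sum.cong[OF refl])
    fix x assume x: "x \<in> cusps"
    have "y / (2 * (of_int (snd x))\<^sup>2 * t0\<^sup>2) = 3200 * y ^ 3 / (of_int (snd x))\<^sup>2"
      using Im_w by (simp add: t0_def power_divide power_mult_distrib power2_eq_square power3_eq_cube)
    then show "emeasure hyp_volume {p \<in> H3. hyp_act (frame x) p \<in> cusp_nbhd x t0} = ennreal (3200 * y ^ 3 / (of_int (snd x))\<^sup>2)"
      using frame_vimage(2)[OF x cusp_nbhd(1)[OF x t0]] cusp_nbhd(2)[OF x t0] by simp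
  qed
  finally show ?thesis .
qed

text \<open>\<open>\<kappa>\<close> is a lower left entry, \<open>\<alpha> = j + i w\<close> a
  reduced upper left entry, \<open>m\<close> the trace and \<open>N\<close> the index of
  \<open>\<kappa> \<Lambda>\<close>. The last condition is the norm of
  \<open>\<alpha> \<delta> - 1 = \<beta> \<kappa>\<close> with
  \<open>\<delta> = m - \<alpha>\<close>, where
  \<open>b = a\<^sup>2 |\<beta>|\<^sup>2\<close>.\<close>

definition thin_index :: "real \<Rightarrow> int \<Rightarrow> (nat \<times> nat \<times> complex) set" where
  "thin_index K a = {(i, j, \<kappa>). \<kappa> \<in> \<O> \<and> \<kappa> \<noteq> 0 \<and> cmod \<kappa> \<le> 80 * K * y \<and>
     (\<exists>N::nat. (cmod \<kappa>)\<^sup>2 = (of_int a)\<^sup>2 * real N \<and> (i + 1) * (j + 1) \<le> N \<and>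
       (\<exists>m\<in>\<O>. cmod m \<le> 2 * K \<and> (\<exists>b::nat. (cmod ((of_nat j + of_nat i * w) * (m - (of_nat j + of_nat i * w)) - 1))\<^sup>2 = real (N * b))))}"

text \<open>A square circumscribed about the disc of radius \<open>K / |\<kappa>|\<close> with
  centre \<open>\<alpha> / \<kappa>\<close>, above the height that \<open>reach_cusp\<close>
  guarantees.\<close>

definition thin_box :: "real \<Rightarrow> nat \<times> nat \<times> complex \<Rightarrow> (complex \<times> real) set" where
  "thin_box K = (\<lambda>(i, j, \<kappa>). let c = (of_nat j + of_nat i * w) / \<kappa>; \<rho> = K / cmod \<kappa> in
     {p. fst p \<in> cbox (Complex (Re c - \<rho>) (Im c - \<rho>)) (Complex (Re c + \<rho>) (Im c + \<rho>)) \<and> 1 / (80 * y) \<le> snd p})"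

lemma thin_box:
  assumes "K > 0" "\<kappa> \<noteq> 0"
  shows "thin_box K (i, j, \<kappa>) \<in> sets hyp_volume"
    "emeasure hyp_volume (thin_box K (i, j, \<kappa>)) = ennreal (12800 * K\<^sup>2 * y\<^sup>2 / (cmod \<kappa>)\<^sup>2)"
proof -
  define t0 where "t0 = 1 / (80 * y)"
  have t0: "t0 > 0" using Im_w by (simp add: t0_def)
  define c where "c = (of_nat j + of_nat i * w) / \<kappa>"
  define \<rho> where "\<rho> = K / cmod \<kappa>"
  have r: "\<rho> > 0" using assms by (simp add: \<rho>_def)
  define Z where "Z = cbox (Complex (Re c - \<rho>) (Im c - \<rho>)) (Complex (Re c + \<rho>) (Im c + \<rho>))"
  have Zb: "Z \<in> sets borel" by (simp add: Z_def)
  have eq: "thin_box K (i, j, \<kappa>) = {p. fst p \<in> Z \<and> t0 \<le> snd p}"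
    unfolding thin_box_def split Let_def c_def[symmetric] \<rho>_def[symmetric] Z_def t0_def ..
  show "thin_box K (i, j, \<kappa>) \<in> sets hyp_volume" unfolding eq by (rule hyp_volume_cusp(1)[OF Zb t0])
  have "emeasure lborel Z = ennreal ((2 * \<rho>) * (2 * \<rho>))"
    unfolding Z_def using r by (subst emeasure_lborel_complex_cbox) auto
  then have "emeasure hyp_volume (thin_box K (i, j, \<kappa>)) = ennreal ((2 * \<rho>) * (2 * \<rho>)) * ennreal (1 / (2 * t0\<^sup>2))"
    unfolding eq by (simp add: hyp_volume_cusp(2)[OF Zb t0])
  also have "\<dots> = ennreal ((2 * \<rho>) * (2 * \<rho>) * (1 / (2 * t0\<^sup>2)))" by (simp add: ennreal_mult'[symmetric])
  also have "(2 * \<rho>) * (2 * \<rho>) * (1 / (2 * t0\<^sup>2)) = 12800 * K\<^sup>2 * y\<^sup>2 / (cmod \<kappa>)\<^sup>2"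
    by (simp add: \<rho>_def t0_def power_divide power_mult_distrib power2_eq_square)
  finally show "emeasure hyp_volume (thin_box K (i, j, \<kappa>)) = ennreal (12800 * K\<^sup>2 * y\<^sup>2 / (cmod \<kappa>)\<^sup>2)" .
qed

text \<open>Up to the translations of its cusp, a point moved a bounded distance by the element with entries
  \<open>\<alpha>, \<beta>, \<kappa>, \<delta>\<close> lies above a bounded multiple of \<open>1 / |\<kappa>|\<close> around \<open>\<alpha> / \<kappa>\<close> if \<open>\<kappa> \<noteq> 0\<close>; if \<open>\<kappa> = 0\<close>
  the element is a translation by \<open>\<plusminus>\<beta>\<close> and the point is high in the cusp.\<close>

lemma thin_cover:
  assumes p: "p \<in> H3" and A: "A \<in> \<Gamma>" "acts_nontrivially A" and dist: "hyp_dist p (hyp_act A p) \<le> \<rho>" and y1: "y > 1"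
  defines "K \<equiv> 2 * cosh \<rho>"
  shows "\<exists>x\<in>cusps. \<exists>\<omega>\<in>\<Gamma>. hyp_act (frame x) (hyp_act \<omega> p) \<in> cusp_nbhd x (1 / (of_int (snd x) * K)) \<union> (\<Union>u\<in>thin_index K (snd x). thin_box K u)"
proof -
  define t0 where "t0 = 1 / (80 * y)"
  have t0: "t0 > 0" using Im_w by (simp add: t0_def)
  have K: "K \<ge> 1" unfolding K_def using cosh_real_ge_1[of \<rho>] by linarith
  obtain x \<sigma> where x: "x \<in> cusps" "\<sigma> \<in> \<Gamma>" "snd (hyp_act (frame x) (hyp_act \<sigma> p)) \<ge> 1 / (80 * y)" using reach_cusp[OF p] .
  obtain C where f: "cusp_frame (fst x) (snd x) C (frame x)" using frame[OF x(1)] by blast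
  define a where "a = snd x"
  define G where "G = frame x"
  have f: "cusp_frame (fst x) a C G" using f by (simp add: a_def G_def)
  have a1: "1 \<le> a" using f by (simp add: cusp_frame_def)
  have dG: "det G = 1" using det_frame[OF x(1)] by (simp add: G_def)
  define q where "q = hyp_act \<sigma> p"
  have q: "q \<in> H3" unfolding q_def using act_mem_H3 x p by blast
  define A1 where "A1 = conj2 \<sigma> A"
  have A1: "A1 \<in> \<Gamma>" unfolding A1_def by (rule conj2_mem) (use x A in auto)
  have dist1: "hyp_dist q (hyp_act A1 q) \<le> \<rho>"
    unfolding A1_def q_def using hyp_dist_conj2[of \<sigma> A p] det1 x A p dist by simp
  define P where "P = hyp_act G q"
  have P: "P \<in> H3" unfolding P_def using dG q hyp_act_H3 by blast
  have Pt: "t0 \<le> snd P" using x(3) by (simp add: P_def q_def G_def t0_def)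
  define M where "M = conj2 G A1"
  have dM: "det M = 1" unfolding M_def using det_conj2 dG det1[OF A1] by blast
  have distM: "hyp_dist P (hyp_act M P) \<le> \<rho>"
    unfolding M_def P_def using hyp_dist_conj2[of G A1 q] det1[OF A1] dG q dist1 by simp
  have Mnt: "acts_nontrivially M"
    unfolding M_def A1_def using A x dG det1 by (intro acts_nontrivially_conj2) (auto intro: det_conj2)
  note ent = frame_conj_entries[OF f A1, folded conj2_def, folded M_def]
  note bd = displacement_bounds[OF dM P distM, folded K_def]
  show ?thesis
  proof (cases "M $ 2 $ 1 = 0")
    case True
    have ad: "M $ 1 $ 1 * M $ 2 $ 2 = 1" using dM True by (simp add: det2)
    then have u: "cmod (M $ 1 $ 1) = 1" using O_unit ent(1,2) by blast
    \<comment> \<open>By \<open>y > 1\<close> a unit has no \<open>w\<close>-component, so the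
      diagonal is \<open>1, 1\<close> or \<open>-1, -1\<close> and no rotation about the cusp
      occurs.\<close>
    obtain k v where kv: "M $ 1 $ 1 = of_int k + of_int v * w" using ent(1) by (auto simp: quad_ints_iff)
    have "\<bar>of_int v\<bar> \<le> 1 / y" using coord_bounds(1)[OF kv, of 1] u by simp
    also have "\<dots> < 1" using y1 by simp
    finally have "v = 0" by simp
    then have "M $ 1 $ 1 = of_int k" using kv by simp
    moreover from this have "\<bar>real_of_int k\<bar> = 1" using u by simp
    then have "k = 1 \<or> k = - 1" by linarith
    ultimately have al: "M $ 1 $ 1 * M $ 1 $ 1 = 1" by auto
    have de: "M $ 2 $ 2 = M $ 1 $ 1"
    proof -
      have "M $ 2 $ 2 = M $ 1 $ 1 * (M $ 1 $ 1 * M $ 2 $ 2)" unfolding mult.assoc[symmetric] al by simp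
      then show ?thesis using ad by simp
    qed
    have b0: "M $ 1 $ 2 \<noteq> 0"
    proof
      assume b: "M $ 1 $ 2 = 0"
      have "hyp_act M u = u" if "u \<in> H3" for u
      proof -
        have "fst (hyp_act M u) = M $ 1 $ 1 * M $ 1 $ 1 * fst u" using hyp_act_upper(1)[OF dM True that] b by simp
        moreover have "snd (hyp_act M u) = snd u" using hyp_act_upper(2)[OF dM True that] \<open>cmod (M $ 1 $ 1) = 1\<close> by simp
        ultimately show ?thesis using al by (simp add: prod_eq_iff)
      qed
      then show False using Mnt by (auto simp: acts_nontrivially_def)
    qed
    \<comment> \<open>The translation length is at least \<open>1 / a\<close> by this integrality
      and at most \<open>K\<close> times the height, so the height is at least
      \<open>1 / (a K)\<close>.\<close>
    obtain n :: nat where n: "(of_int a)\<^sup>2 * (cmod (M $ 1 $ 2))\<^sup>2 = of_nat n" using ent(4) by blast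
    have "of_nat n > (0 :: real)" unfolding n[symmetric] using a1 b0 by simp
    then have "1 \<le> (of_int a * cmod (M $ 1 $ 2))\<^sup>2" unfolding power_mult_distrib n by simp
    then have "1 \<le> of_int a * cmod (M $ 1 $ 2)"
      using power2_le_imp_le[of 1 "of_int a * cmod (M $ 1 $ 2)"] a1 by simp
    also have "\<dots> \<le> of_int a * (K * snd P)"
      using bd(4) a1 by (intro mult_left_mono) (simp_all add: True de algebra_simps)
    finally have "1 \<le> of_int a * K * snd P" by (simp add: mult.assoc)
    moreover have "0 < of_int a * K" using a1 K by simp
    ultimately have tt: "1 / (of_int a * K) \<le> snd P" by (simp add: divide_le_eq mult.commute)
    obtain l where l: "l \<in> trans_lat (frame x)" "fst P + l \<in> cusp_rect x" using cusp_rect(1)[OF x(1)] by blast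
    define \<tau> where "\<tau> = adj2 G ** (unip l ** G)"
    have t: "\<tau> \<in> \<Gamma>" "hyp_act G (hyp_act \<tau> q) = (fst P + l, snd P)"
      unfolding \<tau>_def P_def using frame_translate[OF _ dG q] l(1) by (auto simp: G_def)
    have "hyp_act \<tau> q = hyp_act (\<tau> ** \<sigma>) p" unfolding q_def using t x p det1 by (simp add: hyp_act_mult)
    then have "hyp_act (frame x) (hyp_act (\<tau> ** \<sigma>) p) \<in> cusp_nbhd x (1 / (of_int (snd x) * K))"
      using t(2) l(2) tt by (simp add: cusp_nbhd_def G_def a_def)
    then show ?thesis using x(1) mult_mem[OF t(1) x(2)] by blast
  next
    case False
    define \<kappa> where "\<kappa> = M $ 2 $ 1"
    have k0: "\<kappa> \<noteq> 0" using False by (simp add: \<kappa>_def)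
    \<comment> \<open>Conjugation by the translation \<open>l\<close> adds \<open>\<kappa> l\<close>
      to the upper left entry and preserves \<open>\<kappa>\<close>, so the entry can be reduced to
      \<open>j + i w\<close>.\<close>
    obtain i j N l where l: "l \<in> trans_lat G" "M $ 1 $ 1 + \<kappa> * l = of_nat j + of_nat i * w"
      "(cmod \<kappa>)\<^sup>2 = (of_int a)\<^sup>2 * real N" "(i + 1) * (j + 1) \<le> N"
      using trans_lat_reduce[OF f k0 _ ent(1)] ent(3) unfolding \<kappa>_def by metis
    define \<tau> where "\<tau> = adj2 G ** (unip l ** G)"
    have t: "\<tau> \<in> \<Gamma>" "hyp_act G (hyp_act \<tau> q) = (fst P + l, snd P)"
      unfolding \<tau>_def P_def using frame_translate[OF l(1) dG q] by auto
    define q' where "q' = hyp_act \<tau> q"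
    have q': "q' \<in> H3" unfolding q'_def using act_mem_H3 t q by blast
    define A2 where "A2 = conj2 \<tau> A1"
    have A2: "A2 \<in> \<Gamma>" unfolding A2_def by (rule conj2_mem[OF t(1) A1])
    define M' where "M' = conj2 G A2"
    have M'e: "M' = conj2 (unip l) M" unfolding M'_def A2_def M_def \<tau>_def by (rule frame_translate_conj2[OF dG])
    define P' where "P' = hyp_act G q'"
    have P'e: "P' = (fst P + l, snd P)" unfolding P'_def q'_def by (rule t(2))
    have P': "P' \<in> H3" using P by (simp add: P'e mem_H3)
    have dM': "det M' = 1" unfolding M'_def using det_conj2 dG det1[OF A2] by blast
    have dist2: "hyp_dist q' (hyp_act A2 q') \<le> \<rho>"
      unfolding A2_def q'_def using hyp_dist_conj2[of \<tau> A1 q] det1 t(1) A1 q dist1 by simp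
    have distM': "hyp_dist P' (hyp_act M' P') \<le> \<rho>"
      unfolding M'_def P'_def using hyp_dist_conj2[of G A2 q'] det1[OF A2] dG q' dist2 by simp
    note ent' = frame_conj_entries[OF f A2, folded conj2_def, folded M'_def]
    note bd' = displacement_bounds[OF dM' P' distM', folded K_def]
    define \<alpha> where "\<alpha> = of_nat j + of_nat i * w"
    have al: "M' $ 1 $ 1 = \<alpha>" unfolding M'e conj2_unip_entries \<alpha>_def using l(2) by (simp add: \<kappa>_def)
    have ka: "M' $ 2 $ 1 = \<kappa>" unfolding M'e conj2_unip_entries \<kappa>_def ..
    define \<delta> \<beta> where db: "\<delta> = M' $ 2 $ 2" "\<beta> = M' $ 1 $ 2"
    define m where "m = \<alpha> + \<delta>"
    have mO: "m \<in> \<O>" unfolding m_def using ent'(1,2) by (simp add: al db O_add)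
    have "m = (\<alpha> - \<kappa> * fst P') + (\<kappa> * fst P' + \<delta>)" by (simp add: m_def)
    then have "cmod m \<le> cmod (\<alpha> - \<kappa> * fst P') + cmod (\<kappa> * fst P' + \<delta>)" by (metis norm_triangle_ineq)
    then have mK: "cmod m \<le> 2 * K" using bd'(2,3) by (simp add: al ka db)
    \<comment> \<open>Determinant 1 with \<open>\<delta> = m - \<alpha>\<close>. Taking norms makes
      \<open>N\<close> a divisor of a number depending on \<open>\<alpha>\<close> and
      \<open>m\<close> alone.\<close>
    have "\<alpha> * (m - \<alpha>) - 1 = \<beta> * \<kappa>" using dM' by (simp add: det2 al ka db m_def algebra_simps)
    then have "(cmod (\<alpha> * (m - \<alpha>) - 1))\<^sup>2 = real N * ((of_int a)\<^sup>2 * (cmod \<beta>)\<^sup>2)"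
      by (simp add: norm_mult power_mult_distrib l(3))
    moreover obtain b :: nat where "(of_int a)\<^sup>2 * (cmod \<beta>)\<^sup>2 = of_nat b" using ent'(4) by (auto simp: db)
    ultimately have Nb: "(cmod (\<alpha> * (m - \<alpha>) - 1))\<^sup>2 = real (N * b)" by simp
    have kt: "cmod \<kappa> * snd P \<le> K" using bd'(1) by (simp add: ka P'e)
    have "cmod \<kappa> * t0 \<le> cmod \<kappa> * snd P" using Pt by (intro mult_left_mono) auto
    then have "cmod \<kappa> * t0 \<le> K" using kt by linarith
    then have kK: "cmod \<kappa> \<le> 80 * K * y" using Im_w by (simp add: t0_def field_simps)
    have "\<kappa> \<in> \<O>"
    proof -
      have "1 * 1 \<in> trans_lat G" using frame_product[OF f lat_mem(2) lat_mem(2)] .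
      then show ?thesis using ent'(3)[of 1] by (simp add: ka)
    qed
    then have idx: "(i, j, \<kappa>) \<in> thin_index K a"
      unfolding thin_index_def using k0 kK l(3,4) mO mK Nb unfolding \<alpha>_def by blast
    have "cmod (fst P' - \<alpha> / \<kappa>) \<le> K / cmod \<kappa>"
    proof -
      have "cmod (fst P' - \<alpha> / \<kappa>) = cmod ((\<alpha> - \<kappa> * fst P') / \<kappa>)"
        using k0 by (simp add: diff_divide_distrib norm_minus_commute)
      also have "\<dots> \<le> K / cmod \<kappa>" unfolding norm_divide using bd'(3) by (intro divide_right_mono) (simp_all add: al ka)
      finally show ?thesis .
    qed
    then have "\<bar>Re (fst P' - \<alpha> / \<kappa>)\<bar> \<le> K / cmod \<kappa>" "\<bar>Im (fst P' - \<alpha> / \<kappa>)\<bar> \<le> K / cmod \<kappa>"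
      using abs_Re_le_cmod[of "fst P' - \<alpha> / \<kappa>"] abs_Im_le_cmod[of "fst P' - \<alpha> / \<kappa>"] by linarith+
    then have "\<bar>Re (fst P') - Re (\<alpha> / \<kappa>)\<bar> \<le> K / cmod \<kappa>" "\<bar>Im (fst P') - Im (\<alpha> / \<kappa>)\<bar> \<le> K / cmod \<kappa>"
      by (simp_all only: minus_complex.sel)
    then have "P' \<in> thin_box K (i, j, \<kappa>)"
      unfolding thin_box_def split Let_def \<alpha>_def[symmetric] mem_Collect_eq mem_cbox_complex
      using Pt by (auto simp: P'e t0_def)
    then have "hyp_act (frame x) (hyp_act \<tau> q) \<in> (\<Union>u\<in>thin_index K (snd x). thin_box K u)"
      using idx by (auto simp: P'_def q'_def G_def a_def)
    moreover have "hyp_act \<tau> q = hyp_act (\<tau> ** \<sigma>) p" unfolding q_def using t x p det1 by (simp add: hyp_act_mult)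
    ultimately show ?thesis using x(1) mult_mem[OF t(1) x(2)] by auto
  qed
qed

end

section \<open>Counting\<close>

text \<open>The logarithm is absorbed in a power, so that harmonic sums and divisor counts lose
  factors of the same kind.\<close>

lemma harm_le_powr:
  fixes X \<epsilon> :: real
  assumes e: "\<epsilon> > 0" and n: "real n \<le> X" and X: "X \<ge> 1"
  shows "(\<Sum>k=1..n. 1 / real k) \<le> (1 + 1 / \<epsilon>) * X powr \<epsilon>"
proof (cases n)
  case 0
  then show ?thesis using e by simp
next
  case (Suc m)
  have "(\<Sum>k=1..n. 1 / real k) = harm n" by (simp add: harm_def inverse_eq_divide)
  also have "harm n - ln (real n) \<le> harm (Suc 0) - ln (real (Suc 0))"
    using decseqD[OF decseq_harm_diff_ln, of 0 m] Suc by simp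
  then have "harm n \<le> 1 + ln (real n)" by (simp add: harm_def)
  also have "\<dots> \<le> 1 + ln X" using n Suc by simp
  also have "\<dots> \<le> X powr \<epsilon> + X powr \<epsilon> / \<epsilon>"
    using ln_powr_bound[OF X e] ge_one_powr_ge_zero[OF X, of \<epsilon>] e by (intro add_mono) auto
  also have "\<dots> = (1 + 1 / \<epsilon>) * X powr \<epsilon>" by (simp add: algebra_simps)
  finally show ?thesis .
qed

context quad_ring
begin

text \<open>Crude, but independent of the field: it counts the bounded traces
  \<open>m\<close>.\<close>

lemma card_O_ball:
  assumes "r \<ge> 0"
  shows "real (card {x \<in> \<O>. cmod x \<le> r}) \<le> (8 * r + 1)\<^sup>2"
proof -
  define N where "N = \<lfloor>4 * r\<rfloor>"
  have N: "N \<ge> 0" "of_int N \<le> 4 * r" using assms by (auto simp: N_def)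
  have "{x \<in> \<O>. cmod x \<le> r} \<subseteq> (\<lambda>(a, b). of_int a + of_int b * w) ` ({- N..N} \<times> {- N..N})"
  proof
    fix x assume x: "x \<in> {x \<in> \<O>. cmod x \<le> r}"
    then obtain a b where ab: "x = of_int a + of_int b * w" by (auto simp: quad_ints_iff)
    have c: "\<bar>of_int b\<bar> \<le> r / y" "\<bar>of_int a\<bar> \<le> r + r / y * cmod w" using coord_bounds[OF ab, of r] x by auto
    have "r / y \<le> r / (4 / 5)" using assms y_ge by (intro divide_left_mono) auto
    also have "\<dots> = 5 / 4 * r" by simp
    finally have "r / y \<le> 5 / 4 * r" .
    then have b: "\<bar>of_int b\<bar> \<le> 4 * r" using c(1) assms by linarith
    have "r / y * cmod w \<le> r / y * (3 * y)" using cmod_w assms Im_w by (intro mult_left_mono) auto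
    also have "\<dots> = 3 * r" using Im_w by simp
    finally have a: "\<bar>of_int a\<bar> \<le> 4 * r" using c(2) by linarith
    have "\<bar>a\<bar> \<le> N" "\<bar>b\<bar> \<le> N" using a b unfolding N_def by linarith+
    then show "x \<in> (\<lambda>(a, b). of_int a + of_int b * w) ` ({- N..N} \<times> {- N..N})"
      using ab by (intro image_eqI[of _ _ "(a, b)"]) auto
  qed
  then have "card {x \<in> \<O>. cmod x \<le> r} \<le> card ({- N..N} \<times> {- N..N})" by (intro surj_card_le) auto
  also have "\<dots> = nat (2 * N + 1) * nat (2 * N + 1)" by (simp add: card_cartesian_product)
  finally have "card {x \<in> \<O>. cmod x \<le> r} \<le> (nat (2 * N + 1))\<^sup>2" by (simp only: power2_eq_square)
  then have "real (card {x \<in> \<O>. cmod x \<le> r}) \<le> real ((nat (2 * N + 1))\<^sup>2)" by (simp only: of_nat_le_iff)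
  also have "\<dots> = (2 * of_int N + 1)\<^sup>2" using N by simp
  also have "\<dots> \<le> (8 * r + 1)\<^sup>2" using N by (intro power_mono) auto
  finally show ?thesis .
qed

text \<open>For given \<open>a\<close> there are at most \<open>a\<close> values of
  \<open>s\<close>, which leaves a harmonic sum over \<open>a \<le> 2 y\<close>.\<close>

lemma sum_cusps:
  assumes e: "\<epsilon> > 0" and y1: "y > 1"
  shows "(\<Sum>x\<in>cusps. 1 / (of_int (snd x))\<^sup>2) \<le> (1 + 1 / \<epsilon>) * (2 * y) powr \<epsilon>"
proof -
  define A where "A = nat \<lfloor>2 * y\<rfloor>"
  have A: "real A \<le> 2 * y" using y1 by (simp add: A_def)
  have "(\<Sum>x\<in>cusps. 1 / (of_int (snd x))\<^sup>2) \<le> (\<Sum>u\<in>Sigma {1..A} (\<lambda>a. {0..<a}). 1 / (real (fst u))\<^sup>2)"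
  proof (rule sum_le_included[where i = "\<lambda>u. (int (snd u), int (fst u))"])
    show "\<forall>x\<in>cusps. \<exists>u\<in>Sigma {1..A} (\<lambda>a. {0..<a}). (int (snd u), int (fst u)) = x \<and> 1 / (real_of_int (snd x))\<^sup>2 \<le> 1 / (real (fst u))\<^sup>2"
    proof
      fix x assume x: "x \<in> cusps"
      obtain s a where sa: "x = (s, a)" by (cases x)
      have b: "1 \<le> a" "0 \<le> s" "s < a" "of_int a \<le> 2 * y" using cusps_bounds x sa by auto
      have "nat a \<le> A" unfolding A_def using b by (simp add: le_floor_iff nat_mono)
      then have "(nat a, nat s) \<in> Sigma {1..A} (\<lambda>a. {0..<a})" using b by auto
      then show "\<exists>u\<in>Sigma {1..A} (\<lambda>a. {0..<a}). (int (snd u), int (fst u)) = x \<and> 1 / (real_of_int (snd x))\<^sup>2 \<le> 1 / (real (fst u))\<^sup>2"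
        using b by (intro bexI[of _ "(nat a, nat s)"]) (auto simp: sa)
    qed
  qed (simp_all add: finite_cusps)
  also have "\<dots> = (\<Sum>a\<in>{1..A}. \<Sum>s\<in>{0..<a}. 1 / (real a)\<^sup>2)" by (subst sum.Sigma) (auto simp: split_beta)
  also have "\<dots> = (\<Sum>a\<in>{1..A}. 1 / real a)" by (intro sum.cong) (auto simp: power2_eq_square)
  also have "\<dots> \<le> (1 + 1 / \<epsilon>) * (2 * y) powr \<epsilon>" using y1 by (intro harm_le_powr e A) auto
  finally show ?thesis .
qed

text \<open>Fix \<open>s < 2 y\<close> and count \<open>a\<close>: it divides the norm of
  \<open>s + w\<close>, which is at most \<open>(2 y + 3 y)\<^sup>2 = 25 y\<^sup>2\<close>.\<close>

lemma card_cusps: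
  assumes e: "\<epsilon> > 0" and y1: "y > 1" and D: "D \<ge> 0" "\<And>n::nat. n > 0 \<Longrightarrow> real (card {d. d dvd n}) \<le> D * real n powr \<epsilon>"
  shows "real (card cusps) \<le> 2 * y * (D * (25 * y\<^sup>2) powr \<epsilon>)"
proof -
  define A where "A = nat \<lfloor>2 * y\<rfloor>"
  have A: "real A \<le> 2 * y" using y1 by (simp add: A_def)
  define n where "n s = nat \<lfloor>(cmod (of_nat s + w))\<^sup>2\<rfloor>" for s :: nat
  have n: "real (n s) = (cmod (of_nat s + w))\<^sup>2" "n s > 0" for s
  proof -
    have "of_int (int s) + w \<in> \<O>" by (intro O_add O_int)
    then obtain m :: nat where m: "(cmod (of_nat s + w))\<^sup>2 = of_nat m" using O_norm[of "of_nat s + w"] by auto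
    then show 1: "real (n s) = (cmod (of_nat s + w))\<^sup>2" by (simp add: n_def)
    have "Im (of_nat s + w) > 0" using Im_w by simp
    then have "of_nat s + w \<noteq> 0" by (metis less_irrefl zero_complex.sel(2))
    then have "real (n s) > 0" unfolding 1 by simp
    then show "n s > 0" by simp
  qed
  have "(\<lambda>x. (nat (fst x), nat (snd x))) ` cusps \<subseteq> Sigma {0..<A} (\<lambda>s. {d. d dvd n s})"
  proof (rule image_subsetI)
    fix x assume x: "x \<in> cusps"
    obtain s a where sa: "x = (s, a)" by (cases x)
    have b: "1 \<le> a" "0 \<le> s" "s < a" "of_int a \<le> 2 * y" "\<exists>C. (cmod (of_int s + w))\<^sup>2 = of_int (a * C)" using cusps_bounds x sa by auto
    then obtain C where C: "(cmod (of_int s + w))\<^sup>2 = of_int (a * C)" by blast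
    have aA: "nat a \<le> A" unfolding A_def using b by (simp add: le_floor_iff nat_mono)
    have "real (n (nat s)) = of_int (a * C)" using C b unfolding n(1) by simp
    then have nn: "int (n (nat s)) = a * C" by (metis of_int_eq_iff of_int_of_nat_eq)
    then have "int (nat a) dvd int (n (nat s))" using b by simp
    then have "nat a dvd n (nat s)" by (simp only: int_dvd_int_iff)
    then show "(nat (fst x), nat (snd x)) \<in> Sigma {0..<A} (\<lambda>s. {d. d dvd n s})" using aA b by (auto simp: sa)
  qed
  moreover have "inj_on (\<lambda>x. (nat (fst x), nat (snd x))) cusps"
    by (rule inj_onI) (use cusps_bounds in \<open>force simp: prod_eq_iff eq_nat_nat_iff\<close>)
  moreover have fin: "finite (Sigma {0..<A} (\<lambda>s. {d. d dvd n s}))" using n(2) by (intro finite_SigmaI) auto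
  ultimately have "card cusps \<le> card (Sigma {0..<A} (\<lambda>s. {d. d dvd n s}))" by (metis card_inj_on_le)
  also have "\<dots> = (\<Sum>s\<in>{0..<A}. card {d. d dvd n s})" using n(2) by (intro card_SigmaI) auto
  finally have "real (card cusps) \<le> real (\<Sum>s\<in>{0..<A}. card {d. d dvd n s})" by (simp only: of_nat_le_iff)
  also have "\<dots> = (\<Sum>s\<in>{0..<A}. real (card {d. d dvd n s}))" by simp
  also have "\<dots> \<le> (\<Sum>s\<in>{0..<A}. D * (25 * y\<^sup>2) powr \<epsilon>)"
  proof (rule sum_mono)
    fix s assume s: "s \<in> {0..<A}"
    have "cmod (of_nat s + w) \<le> real s + cmod w" using norm_triangle_ineq[of "of_nat s" w] by simp
    also have "\<dots> \<le> 5 * y" using s A cmod_w by simp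
    finally have "(cmod (of_nat s + w))\<^sup>2 \<le> (5 * y)\<^sup>2" by (intro power_mono) auto
    then have nb: "real (n s) \<le> 25 * y\<^sup>2" unfolding n(1) by (simp add: power_mult_distrib)
    have "real (card {d. d dvd n s}) \<le> D * real (n s) powr \<epsilon>" by (rule D(2)[OF n(2)])
    also have "\<dots> \<le> D * (25 * y\<^sup>2) powr \<epsilon>" using nb e D(1) by (intro mult_left_mono powr_mono2) auto
    finally show "real (card {d. d dvd n s}) \<le> D * (25 * y\<^sup>2) powr \<epsilon>" .
  qed
  also have "\<dots> = real A * (D * (25 * y\<^sup>2) powr \<epsilon>)" by simp
  also have "\<dots> \<le> 2 * y * (D * (25 * y\<^sup>2) powr \<epsilon>)" using A D(1) by (intro mult_right_mono) auto
  finally show ?thesis .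
qed

text \<open>The sum is taken over \<open>i\<close>, \<open>j\<close>, then \<open>m\<close>, then
  \<open>N\<close>, then \<open>\<kappa>\<close> with
  \<open>|\<kappa>|\<^sup>2 = a\<^sup>2 N\<close>. Traces and circle points contribute constants.
  The sum of \<open>1 / N\<close> over divisors \<open>N \<ge> (i + 1) (j + 1)\<close> is at most
  their number over \<open>(i + 1) (j + 1)\<close>, leaving two harmonic sums.\<close>

lemma sum_thin_index:
  assumes e: "\<epsilon> > 0" and y1: "y > 1" and D: "D \<ge> 0" "\<And>n::nat. n > 0 \<Longrightarrow> real (card {d. d dvd n}) \<le> D * real n powr \<epsilon>"
    and K: "K \<ge> 1" and a: "a \<ge> 1"
  defines "X \<equiv> 9 * (25600 * K\<^sup>2 * y ^ 3) ^ 4" and "h \<equiv> 1 + 1 / \<epsilon>"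
  shows "finite (thin_index K a)"
    "(\<Sum>(i, j, \<kappa>)\<in>thin_index K a. 1 / (cmod \<kappa>)\<^sup>2) \<le>
       (h * X powr \<epsilon>)\<^sup>2 * ((16 * K + 1)\<^sup>2 * ((320 * K + 2) * (D + 2 * h) * X powr \<epsilon> / (of_int a)\<^sup>2))"
proof -
  \<comment> \<open>\<open>Z\<close> bounds \<open>|\<alpha>|\<close> and \<open>2 K\<close>, so the
    norm of \<open>\<alpha> (m - \<alpha>) - 1\<close> is at most
    \<open>(3 Z\<^sup>2)\<^sup>2 = X\<close>. It is \<open>4 y\<close> times the bound
    \<open>6400 K\<^sup>2 y\<^sup>2\<close> for \<open>N\<close>.\<close>
  define Z where "Z = 25600 * K\<^sup>2 * y ^ 3"
  have K2: "K \<le> K\<^sup>2" "1 \<le> K\<^sup>2" using K self_le_power[of K 2] one_le_power[of K 2] by auto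
  have y3: "1 \<le> y ^ 3" "y\<^sup>2 \<le> y ^ 3" using y1 by (auto intro: power_increasing)
  have Ky: "K \<le> K\<^sup>2 * y ^ 3" using mult_mono[OF K2(1) y3(1)] K by simp
  have Z1: "1 \<le> Z" "2 * K \<le> Z" using Ky K unfolding Z_def by linarith+
  have X: "X = 9 * Z ^ 4" by (simp add: X_def Z_def)
  have ZX: "Z \<le> X"
  proof -
    have "Z ^ 1 \<le> Z ^ 4" using Z1 by (intro power_increasing) auto
    then show ?thesis using X Z1 by simp
  qed
  have X1: "X \<ge> 1" using ZX Z1 by simp
  define B where "B = nat \<lfloor>6400 * K\<^sup>2 * y\<^sup>2\<rfloor>"
  have B: "real B \<le> 6400 * K\<^sup>2 * y\<^sup>2" by (simp add: B_def)
  have BZ: "real B * (4 * y) \<le> Z"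
  proof -
    have "real B * (4 * y) \<le> 6400 * K\<^sup>2 * y\<^sup>2 * (4 * y)" using B y1 by (intro mult_right_mono) auto
    also have "\<dots> = Z" by (simp add: Z_def power2_eq_square power3_eq_cube)
    finally show ?thesis .
  qed
  have BX: "real B \<le> X"
  proof -
    have "real B * 1 \<le> real B * (4 * y)" using y1 by (intro mult_left_mono) auto
    then show ?thesis using BZ ZX by simp
  qed
  define \<alpha> where "\<alpha> i j = of_nat j + of_nat i * w" for i j :: nat
  define nrm where "nrm i j m = nat \<lfloor>(cmod (\<alpha> i j * (m - \<alpha> i j) - 1))\<^sup>2\<rfloor>" for i j m
  have aO: "\<alpha> i j \<in> \<O>" for i j unfolding \<alpha>_def quad_ints_iff by (intro exI[of _ "int j"] exI[of _ "int i"]) simp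
  have nrm: "real (nrm i j m) = (cmod (\<alpha> i j * (m - \<alpha> i j) - 1))\<^sup>2" if "m \<in> \<O>" for i j m
  proof -
    have "\<alpha> i j * (m - \<alpha> i j) - 1 \<in> \<O>" using that aO by (intro O_diff O_mult O_int)
    then obtain k :: nat where "(cmod (\<alpha> i j * (m - \<alpha> i j) - 1))\<^sup>2 = of_nat k" using O_norm by blast
    then show ?thesis by (simp add: nrm_def)
  qed
  define Ms where "Ms = {m \<in> \<O>. cmod m \<le> 2 * K}"
  define Ns where "Ns i j m = {N \<in> {1..B}. (i + 1) * (j + 1) \<le> N \<and> (\<exists>b. nrm i j m = N * b)}" for i j m
  define Ks where "Ks N = {\<kappa> \<in> \<O>. cmod \<kappa> = of_int a * sqrt (real N) \<and> cmod \<kappa> \<le> 80 * K * y}" for N :: nat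
  define T where "T = Sigma ({..<B} \<times> {..<B}) (\<lambda>q. Sigma Ms (\<lambda>m. Sigma (Ns (fst q) (snd q) m) Ks))"
  have Ms: "finite Ms" unfolding Ms_def by (rule finite_O_ball)
  have Ns: "finite (Ns i j m)" for i j m by (simp add: Ns_def)
  have Ks: "finite (Ks N)" for N unfolding Ks_def by (rule finite_subset[OF _ finite_O_ball[of "80 * K * y"]]) auto
  have T: "finite T" unfolding T_def using Ms Ns Ks by (intro finite_SigmaI) (auto intro: finite_SigmaI)
  \<comment> \<open>Forgetting \<open>m\<close> and \<open>N\<close> maps the fibred set
    \<open>T\<close> onto a superset of the index set, whose existential conditions become summation
    variables.\<close>
  define f where "f = (\<lambda>((i :: nat, j :: nat), (m :: complex, (N :: nat, \<kappa> :: complex))). (i, j, \<kappa>))"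
  have sub: "\<exists>t\<in>T. f t = u" if u: "u \<in> thin_index K a" for u
  proof -
    obtain i j \<kappa> where ijk: "u = (i, j, \<kappa>)" by (cases u)
    obtain N m b where N: "\<kappa> \<in> \<O>" "\<kappa> \<noteq> 0" "cmod \<kappa> \<le> 80 * K * y" "(cmod \<kappa>)\<^sup>2 = (of_int a)\<^sup>2 * real N" "(i + 1) * (j + 1) \<le> N"
      "m \<in> \<O>" "cmod m \<le> 2 * K" "(cmod (\<alpha> i j * (m - \<alpha> i j) - 1))\<^sup>2 = real (N * b)"
      using u unfolding ijk thin_index_def \<alpha>_def by auto
    have "real (nrm i j m) = real (N * b)" using nrm[OF N(6), of i j] N(8) by simp
    then have "nrm i j m = N * b" by (simp only: of_nat_eq_iff)
    have "real N * 1 \<le> real N * (of_int a)\<^sup>2" using a by (intro mult_left_mono) auto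
    also have "\<dots> \<le> (80 * K * y)\<^sup>2" using N(3) unfolding mult.commute[of "real N"] N(4)[symmetric] by (intro power_mono) auto
    also have "\<dots> = 6400 * K\<^sup>2 * y\<^sup>2" by (simp add: power_mult_distrib)
    finally have NB: "N \<le> B" unfolding B_def by (simp add: le_nat_floor)
    have "i + 1 \<le> (i + 1) * (j + 1)" "j + 1 \<le> (i + 1) * (j + 1)" by simp_all
    then have ij: "i < B" "j < B" "1 \<le> N" using N(5) NB by linarith+
    have "cmod \<kappa> = of_int a * sqrt (real N)"
      using arg_cong[OF N(4), of sqrt] a by (simp add: real_sqrt_mult)
    then have "((i, j), (m, (N, \<kappa>))) \<in> T" unfolding T_def Ms_def Ns_def Ks_def using N NB ij \<open>nrm i j m = N * b\<close> by auto
    then show ?thesis unfolding ijk f_def by (intro bexI) auto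
  qed
  have "thin_index K a \<subseteq> f ` T" using sub by force
  then show fin: "finite (thin_index K a)" using T finite_surj by blast
  \<comment> \<open>The cut in height bounds \<open>|\<kappa>|\<close> by \<open>80 K y\<close>, so
    the circle of that radius meets boundedly many rows of the lattice, uniformly in
    \<open>y\<close>.\<close>
  have C3: "real (card (Ks N)) \<le> 320 * K + 2" for N
  proof (cases "of_int a * sqrt (real N) \<le> 80 * K * y")
    case True
    have "card (Ks N) \<le> card {\<kappa> \<in> \<O>. cmod \<kappa> = of_int a * sqrt (real N)}"
    proof (rule card_mono)
      show "finite {\<kappa> \<in> \<O>. cmod \<kappa> = of_int a * sqrt (real N)}"
        by (rule finite_subset[OF _ finite_O_ball[of "of_int a * sqrt (real N)"]]) auto
    qed (auto simp: Ks_def)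
    also have "real (card {\<kappa> \<in> \<O>. cmod \<kappa> = of_int a * sqrt (real N)}) \<le> 4 * (of_int a * sqrt (real N)) / y + 2"
      using a by (intro card_O_circle) auto
    also have "\<dots> \<le> 4 * (80 * K * y) / y + 2" using True Im_w by (intro add_mono divide_right_mono) auto
    also have "\<dots> = 320 * K + 2" using Im_w by simp
    finally show ?thesis by simp
  next
    case False
    then have "Ks N = {}" by (auto simp: Ks_def)
    then show ?thesis using K by simp
  qed
  define C3 where "C3 = 320 * K + 2"
  define C4 where "C4 = (D + 2 * h) * X powr \<epsilon>"
  have C30: "C3 \<ge> 0" using K by (simp add: C3_def)
  have h0: "h \<ge> 0" using e by (simp add: h_def)
  have harmB: "(\<Sum>N=1..B. 1 / real N) \<le> h * X powr \<epsilon>" unfolding h_def by (rule harm_le_powr[OF e BX X1])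
  have inner: "(\<Sum>N\<in>Ns i j m. 1 / real N) \<le> 1 / (real (i + 1) * real (j + 1)) * C4"
    if ij: "i < B" "j < B" and m: "m \<in> Ms" for i j m
  \<comment> \<open>A zero norm has every \<open>N\<close> as divisor. But then
    \<open>\<alpha>\<close> is a unit, so \<open>i = 0\<close> and \<open>j = 1\<close> because
    \<open>y > 1\<close>, and a harmonic sum over \<open>N\<close> replaces the divisor bound; the 2
    in \<open>2 * h\<close> offsets \<open>(i + 1) (j + 1) = 2\<close>.\<close>
  proof (cases "nrm i j m = 0")
    case True
    have mO: "m \<in> \<O>" using m by (simp add: Ms_def)
    have "(cmod (\<alpha> i j * (m - \<alpha> i j) - 1))\<^sup>2 = 0" using nrm[OF mO, of i j] True by simp
    then have "\<alpha> i j * (m - \<alpha> i j) = 1" by simp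
    then have u: "cmod (\<alpha> i j) = 1" using O_unit[OF aO O_diff[OF mO aO]] by blast
    have e1: "\<alpha> i j = of_int (int j) + of_int (int i) * w" by (simp add: \<alpha>_def)
    have "\<bar>of_int (int i)\<bar> \<le> 1 / y" using coord_bounds(1)[OF e1, of 1] u by simp
    also have "\<dots> < 1" using y1 by simp
    finally have i0: "i = 0" by simp
    then have j1: "j = 1" using u by (simp add: \<alpha>_def)
    have "(\<Sum>N\<in>Ns i j m. 1 / real N) \<le> (\<Sum>N\<in>{1..B}. 1 / real N)"
      by (intro sum_mono2) (auto simp: Ns_def)
    also have "\<dots> \<le> h * X powr \<epsilon>" by (rule harmB)
    also have "\<dots> \<le> 1 / 2 * C4" using D(1) h0 by (simp add: C4_def algebra_simps)
    finally show ?thesis using i0 j1 by simp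
  next
    case False
    have mO: "m \<in> \<O>" and mK: "cmod m \<le> 2 * K" using m by (auto simp: Ms_def)
    have aZ: "cmod (\<alpha> i j) \<le> Z"
    proof -
      have "cmod (\<alpha> i j) \<le> cmod (of_nat j) + cmod (of_nat i * w)" unfolding \<alpha>_def by (rule norm_triangle_ineq)
      also have "\<dots> = real j + real i * cmod w" by (simp add: norm_mult)
      also have "\<dots> \<le> real B * y + real B * (3 * y)"
      proof (rule add_mono)
        have "real j * 1 \<le> real B * y" using ij y1 by (intro mult_mono) auto
        then show "real j \<le> real B * y" by simp
        show "real i * cmod w \<le> real B * (3 * y)" using ij cmod_w by (intro mult_mono) auto
      qed
      finally show ?thesis using BZ by (simp add: mult_ac)
    qed
    have "cmod (\<alpha> i j * (m - \<alpha> i j) - 1) \<le> cmod (\<alpha> i j * (m - \<alpha> i j)) + cmod 1" by (rule norm_triangle_ineq4)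
    also have "\<dots> = cmod (\<alpha> i j) * cmod (m - \<alpha> i j) + 1" by (simp add: norm_mult)
    also have "\<dots> \<le> Z * (Z + Z) + Z * Z"
    proof (rule add_mono)
      have "cmod (m - \<alpha> i j) \<le> cmod m + cmod (\<alpha> i j)" by (rule norm_triangle_ineq4)
      then have "cmod (m - \<alpha> i j) \<le> Z + Z" using mK aZ Z1 by linarith
      then show "cmod (\<alpha> i j) * cmod (m - \<alpha> i j) \<le> Z * (Z + Z)" using aZ Z1 by (intro mult_mono) auto
      show "1 \<le> Z * Z" using mult_mono[OF Z1(1) Z1(1)] Z1(1) by simp
    qed
    also have "\<dots> = 3 * Z\<^sup>2" by (simp add: power2_eq_square algebra_simps)
    finally have "(cmod (\<alpha> i j * (m - \<alpha> i j) - 1))\<^sup>2 \<le> (3 * Z\<^sup>2)\<^sup>2" by (intro power_mono) auto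
    also have "\<dots> = X" by (simp add: X power_mult_distrib power_mult[symmetric])
    finally have nX: "real (nrm i j m) \<le> X" using nrm[OF mO, of i j] by simp
    have "(\<Sum>N\<in>Ns i j m. 1 / real N) \<le> (\<Sum>N\<in>Ns i j m. 1 / (real (i + 1) * real (j + 1)))"
    proof (rule sum_mono)
      fix N assume "N \<in> Ns i j m"
      then have "real ((i + 1) * (j + 1)) \<le> real N" unfolding of_nat_le_iff by (simp add: Ns_def)
      then show "1 / real N \<le> 1 / (real (i + 1) * real (j + 1))" unfolding of_nat_mult by (intro frac_le mult_pos_pos) auto
    qed
    also have "\<dots> = real (card (Ns i j m)) * (1 / (real (i + 1) * real (j + 1)))" by simp
    also have "\<dots> \<le> C4 * (1 / (real (i + 1) * real (j + 1)))"
    proof (rule mult_right_mono)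
      have "card (Ns i j m) \<le> card {d. d dvd nrm i j m}"
        using False by (intro card_mono) (auto simp: Ns_def)
      then have "real (card (Ns i j m)) \<le> real (card {d. d dvd nrm i j m})" by simp
      also have "\<dots> \<le> D * real (nrm i j m) powr \<epsilon>" using False by (intro D(2)) simp
      also have "\<dots> \<le> D * X powr \<epsilon>" using nX e D(1) by (intro mult_left_mono powr_mono2) auto
      also have "\<dots> \<le> C4" unfolding C4_def using h0 by (intro mult_right_mono) auto
      finally show "real (card (Ns i j m)) \<le> C4" .
    qed simp
    finally show ?thesis by (simp add: mult.commute)
  qed
  define g where "g = (\<lambda>((i :: nat, j :: nat), (m :: complex, (N :: nat, \<kappa> :: complex))). 1 / ((of_int a)\<^sup>2 * real N))"
  have "(\<Sum>(i, j, \<kappa>)\<in>thin_index K a. 1 / (cmod \<kappa>)\<^sup>2) \<le> sum g T"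
  proof (rule sum_le_included[OF fin T, where i = f])
    show "\<forall>t\<in>T. 0 \<le> g t" by (auto simp: g_def)
    show "\<forall>u\<in>thin_index K a. \<exists>t\<in>T. f t = u \<and> (case u of (i, j, \<kappa>) \<Rightarrow> 1 / (cmod \<kappa>)\<^sup>2) \<le> g t"
    proof
      fix u assume "u \<in> thin_index K a"
      then obtain t where t: "t \<in> T" "f t = u" using sub by blast
      obtain i j m N \<kappa> where te: "t = ((i, j), (m, (N, \<kappa>)))" by (metis prod.exhaust)
      have "cmod \<kappa> = of_int a * sqrt (real N)" using t(1) by (auto simp: te T_def Ks_def)
      then have "(cmod \<kappa>)\<^sup>2 = (of_int a)\<^sup>2 * real N" by (simp add: power_mult_distrib)
      then have "(case u of (i, j, \<kappa>) \<Rightarrow> 1 / (cmod \<kappa>)\<^sup>2) \<le> g t" using t(2) by (auto simp: te f_def g_def)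
      then show "\<exists>t\<in>T. f t = u \<and> (case u of (i, j, \<kappa>) \<Rightarrow> 1 / (cmod \<kappa>)\<^sup>2) \<le> g t" using t by blast
    qed
  qed
  also have "sum g T = (\<Sum>(i, j)\<in>{..<B} \<times> {..<B}. \<Sum>m\<in>Ms. \<Sum>N\<in>Ns i j m. \<Sum>\<kappa>\<in>Ks N. 1 / ((of_int a)\<^sup>2 * real N))"
  proof -
    define g' where "g' N = 1 / ((of_int a)\<^sup>2 * real N)" for N
    have 1: "(\<Sum>N\<in>Ns i j m. \<Sum>\<kappa>\<in>Ks N. g' N) = (\<Sum>v\<in>Sigma (Ns i j m) Ks. g' (fst v))" for i j m
      using Ns Ks by (subst sum.Sigma) (auto simp: split_beta)
    have 2: "(\<Sum>m\<in>Ms. \<Sum>v\<in>Sigma (Ns i j m) Ks. g' (fst v)) = (\<Sum>v\<in>Sigma Ms (\<lambda>m. Sigma (Ns i j m) Ks). g' (fst (snd v)))" for i j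
      using Ms Ns Ks by (subst sum.Sigma) (auto simp: split_beta)
    have 3: "(\<Sum>q\<in>{..<B} \<times> {..<B}. \<Sum>v\<in>Sigma Ms (\<lambda>m. Sigma (Ns (fst q) (snd q) m) Ks). g' (fst (snd v))) = (\<Sum>t\<in>T. g' (fst (snd (snd t))))"
      unfolding T_def using Ms Ns Ks by (subst sum.Sigma) (auto simp: split_beta)
    show ?thesis unfolding g_def split_beta g'_def[symmetric] 1 2 3 ..
  qed
  also have "\<dots> \<le> (\<Sum>(i, j)\<in>{..<B} \<times> {..<B}. \<Sum>m\<in>Ms. C3 * C4 / (of_int a)\<^sup>2 * (1 / (real (i + 1) * real (j + 1))))"
  proof (rule sum_mono, unfold split_beta, rule sum_mono)
    fix q m assume q: "q \<in> {..<B} \<times> {..<B}" and m: "m \<in> Ms"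
    obtain i j where qe: "q = (i, j)" by (cases q)
    have ij: "i \<in> {..<B}" "j \<in> {..<B}" using q qe by auto
    have "(\<Sum>N\<in>Ns i j m. \<Sum>\<kappa>\<in>Ks N. 1 / ((of_int a)\<^sup>2 * real N)) = (\<Sum>N\<in>Ns i j m. real (card (Ks N)) * (1 / ((of_int a)\<^sup>2 * real N)))" by simp
    also have "\<dots> \<le> (\<Sum>N\<in>Ns i j m. C3 * (1 / ((of_int a)\<^sup>2 * real N)))"
      using C3 unfolding C3_def[symmetric] by (intro sum_mono mult_right_mono) auto
    also have "\<dots> = C3 / (of_int a)\<^sup>2 * (\<Sum>N\<in>Ns i j m. 1 / real N)" by (simp add: sum_distrib_left)
    also have "\<dots> \<le> C3 / (of_int a)\<^sup>2 * (1 / (real (i + 1) * real (j + 1)) * C4)"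
      using inner[of i j m] ij m C30 by (intro mult_left_mono) auto
    finally show "(\<Sum>N\<in>Ns (fst q) (snd q) m. \<Sum>\<kappa>\<in>Ks N. 1 / ((of_int a)\<^sup>2 * real N)) \<le> C3 * C4 / (of_int a)\<^sup>2 * (1 / (real (fst q + 1) * real (snd q + 1)))"
      by (simp add: qe mult_ac)
  qed
  also have "\<dots> = real (card Ms) * (C3 * C4 / (of_int a)\<^sup>2) * (\<Sum>(i, j)\<in>{..<B} \<times> {..<B}. 1 / (real (i + 1) * real (j + 1)))"
    by (simp add: sum_distrib_left split_beta mult_ac)
  also have "(\<Sum>(i, j)\<in>{..<B} \<times> {..<B}. 1 / (real (i + 1) * real (j + 1))) = (\<Sum>i<B. 1 / real (i + 1)) * (\<Sum>j<B. 1 / real (j + 1))"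
    by (simp add: sum.cartesian_product[symmetric] sum_product)
  also have "(\<Sum>j<B. 1 / real (j + 1)) = (\<Sum>N=1..B. 1 / real N)"
    by (intro sum.reindex_bij_witness[of _ "\<lambda>N. N - 1" "\<lambda>j. j + 1"]) auto
  also have "real (card Ms) * (C3 * C4 / (of_int a)\<^sup>2) * ((\<Sum>N=1..B. 1 / real N) * (\<Sum>N=1..B. 1 / real N)) \<le>
      (16 * K + 1)\<^sup>2 * (C3 * C4 / (of_int a)\<^sup>2) * ((h * X powr \<epsilon>) * (h * X powr \<epsilon>))"
  proof (intro mult_mono harmB)
    show "real (card Ms) \<le> (16 * K + 1)\<^sup>2" unfolding Ms_def using card_O_ball[of "2 * K"] K by simp
  qed (use C30 D(1) h0 in \<open>auto simp: C4_def intro!: sum_nonneg mult_nonneg_nonneg\<close>)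
  finally show "(\<Sum>(i, j, \<kappa>)\<in>thin_index K a. 1 / (cmod \<kappa>)\<^sup>2) \<le>
       (h * X powr \<epsilon>)\<^sup>2 * ((16 * K + 1)\<^sup>2 * ((320 * K + 2) * (D + 2 * h) * X powr \<epsilon> / (of_int a)\<^sup>2))"
    by (simp add: C3_def C4_def power2_eq_square mult_ac)
qed

end

section \<open>The volume of the thin part\<close>

context quad_ring
begin

lemma Union_thin_part_H3: "\<Union>(thin_part \<Gamma> R) \<subseteq> H3"
  using Union_hyp_quotient by (auto simp: thin_part_def)

text \<open>At height \<open>1 / (a K)\<close> the dependence on \<open>a\<close> cancels, so each
  neighbourhood costs \<open>y K\<^sup>2 / 2\<close> and \<open>card_cusps\<close> applies; the
  boxes carry \<open>1 / a\<^sup>2\<close> and \<open>sum_cusps\<close> applies. The fourth power of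
  \<open>P\<close> comes from two harmonic sums, the divisor bound and the sum over cusps.\<close>

lemma thin_volume_bound:
  fixes R :: real
  assumes e: "\<epsilon> > 0" and y1: "y > 1" and D: "D \<ge> 0" "\<And>n::nat. n > 0 \<Longrightarrow> real (card {d. d dvd n}) \<le> D * real n powr \<epsilon>"
  defines "K \<equiv> 2 * cosh (2 * R + 1)"
  defines "X \<equiv> 9 * (25600 * K\<^sup>2 * y ^ 3) ^ 4" and "h \<equiv> 1 + 1 / \<epsilon>"
  shows "quotient_volume \<Gamma> (thin_part \<Gamma> R) \<le>
    ennreal ((D * K\<^sup>2 + 12800 * K\<^sup>2 * (h * (h\<^sup>2 * ((16 * K + 1)\<^sup>2 * ((320 * K + 2) * (D + 2 * h)))))) * (y\<^sup>2 * X powr (4 * \<epsilon>)))"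
proof -
  have K: "K \<ge> 1" unfolding K_def using cosh_real_ge_1[of "2 * R + 1"] by linarith
  have h0: "h \<ge> 0" using e by (simp add: h_def)
  define P where "P = X powr \<epsilon>"
  define Q where "Q = (h * P)\<^sup>2 * ((16 * K + 1)\<^sup>2 * ((320 * K + 2) * (D + 2 * h) * P))"
  have P0: "P \<ge> 0" by (simp add: P_def)
  have Q0: "Q \<ge> 0" unfolding Q_def using K D(1) h0 P0 by (intro mult_nonneg_nonneg add_nonneg_nonneg) auto
  define E where "E x = {p \<in> H3. hyp_act (frame x) p \<in> cusp_nbhd x (1 / (of_int (snd x) * K)) \<union> (\<Union>u\<in>thin_index K (snd x). thin_box K u)}" for x
  have a: "snd x \<ge> 1" if "x \<in> cusps" for x using cusps_bounds(1)[of "fst x" "snd x"] that by simp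
  have Ex: "E x \<in> sets hyp_volume"
    "emeasure hyp_volume (E x) \<le> ennreal (y * K\<^sup>2 / 2 + 12800 * K\<^sup>2 * y\<^sup>2 * (Q * (1 / (of_int (snd x))\<^sup>2)))" if x: "x \<in> cusps" for x
  proof -
    define N where "N = cusp_nbhd x (1 / (of_int (snd x) * K))"
    define U where "U = (\<Union>u\<in>thin_index K (snd x). thin_box K u)"
    have t: "1 / (of_int (snd x) * K) > 0" using a[OF x] K by simp
    have N: "N \<in> sets hyp_volume" "emeasure hyp_volume N = ennreal (y * K\<^sup>2 / 2)"
      unfolding N_def using cusp_nbhd[OF x t] a[OF x] K by (auto simp: power_mult_distrib power_divide)
    note ti = sum_thin_index[OF e y1 D K a[OF x], folded X_def h_def, folded P_def]
    have bx: "thin_box K u \<in> sets hyp_volume \<and> emeasure hyp_volume (thin_box K u) = ennreal (12800 * K\<^sup>2 * y\<^sup>2 / (cmod (snd (snd u)))\<^sup>2)"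
      if "u \<in> thin_index K (snd x)" for u
    proof -
      obtain i j \<kappa> where u: "u = (i, j, \<kappa>)" by (cases u)
      have "\<kappa> \<noteq> 0" using that by (auto simp: u thin_index_def)
      then show ?thesis using thin_box[of K \<kappa> i j] K by (simp add: u)
    qed
    have U: "U \<in> sets hyp_volume" unfolding U_def using ti(1) bx by (intro sets.finite_UN) auto
    show "E x \<in> sets hyp_volume"
      unfolding E_def N_def[symmetric] U_def[symmetric] using N(1) U by (intro frame_vimage(1)[OF x]) auto
    have "emeasure hyp_volume (E x) = emeasure hyp_volume (N \<union> U)"
      unfolding E_def N_def[symmetric] U_def[symmetric] using N(1) U by (intro frame_vimage(2)[OF x]) auto
    also have "\<dots> \<le> emeasure hyp_volume N + emeasure hyp_volume U" by (rule emeasure_subadditive[OF N(1) U])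
    also have "\<dots> \<le> ennreal (y * K\<^sup>2 / 2) + (\<Sum>u\<in>thin_index K (snd x). emeasure hyp_volume (thin_box K u))"
      unfolding N(2) U_def using ti(1) bx by (intro add_left_mono emeasure_subadditive_finite) auto
    also have "(\<Sum>u\<in>thin_index K (snd x). emeasure hyp_volume (thin_box K u)) = (\<Sum>u\<in>thin_index K (snd x). ennreal (12800 * K\<^sup>2 * y\<^sup>2 / (cmod (snd (snd u)))\<^sup>2))"
      using bx by (intro sum.cong) auto
    also have "\<dots> = ennreal (\<Sum>u\<in>thin_index K (snd x). 12800 * K\<^sup>2 * y\<^sup>2 / (cmod (snd (snd u)))\<^sup>2)"
      by (intro sum_ennreal) simp
    also have "(\<Sum>u\<in>thin_index K (snd x). 12800 * K\<^sup>2 * y\<^sup>2 / (cmod (snd (snd u)))\<^sup>2) = 12800 * K\<^sup>2 * y\<^sup>2 * (\<Sum>(i, j, \<kappa>)\<in>thin_index K (snd x). 1 / (cmod \<kappa>)\<^sup>2)"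
      by (simp add: sum_distrib_left split_beta)
    also have "ennreal (y * K\<^sup>2 / 2) + ennreal \<dots> = ennreal (y * K\<^sup>2 / 2 + 12800 * K\<^sup>2 * y\<^sup>2 * (\<Sum>(i, j, \<kappa>)\<in>thin_index K (snd x). 1 / (cmod \<kappa>)\<^sup>2))"
      using Im_w by (intro ennreal_plus[symmetric] mult_nonneg_nonneg sum_nonneg) auto
    also have "\<dots> \<le> ennreal (y * K\<^sup>2 / 2 + 12800 * K\<^sup>2 * y\<^sup>2 * (Q * (1 / (of_int (snd x))\<^sup>2)))"
      using ti(2) by (intro ennreal_leI add_left_mono mult_left_mono) (auto simp: Q_def)
    finally show "emeasure hyp_volume (E x) \<le> \<dots>" .
  qed
  have Es: "(\<Union>x\<in>cusps. E x) \<in> sets hyp_volume" using finite_cusps Ex(1) by (intro sets.finite_UN) auto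
  have cov: "\<exists>A\<in>\<Gamma>. hyp_act A p \<in> (\<Union>x\<in>cusps. E x)" if p: "p \<in> \<Union>(thin_part \<Gamma> R)" for p
  proof -
    obtain \<sigma> A where s: "p \<in> H3" "\<sigma> \<in> \<Gamma>" "A \<in> \<Gamma>" "acts_nontrivially A" "hyp_dist (hyp_act \<sigma> p) (hyp_act A (hyp_act \<sigma> p)) \<le> 2 * R + 1"
      using thin_part_displacement[OF p] .
    obtain x \<omega> where x: "x \<in> cusps" "\<omega> \<in> \<Gamma>"
      "hyp_act (frame x) (hyp_act \<omega> (hyp_act \<sigma> p)) \<in> cusp_nbhd x (1 / (of_int (snd x) * K)) \<union> (\<Union>u\<in>thin_index K (snd x). thin_box K u)"
      using thin_cover[OF act_mem_H3[OF s(2,1)] s(3,4,5) y1] unfolding K_def by blast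
    have "hyp_act \<omega> (hyp_act \<sigma> p) = hyp_act (\<omega> ** \<sigma>) p" using s x det1 by (intro hyp_act_mult) auto
    moreover have "\<omega> ** \<sigma> \<in> \<Gamma>" using s x mult_mem by blast
    moreover have "hyp_act \<omega> (hyp_act \<sigma> p) \<in> H3" using s x act_mem_H3 by blast
    ultimately show ?thesis using x(1,3) unfolding E_def by (intro bexI[of _ "\<omega> ** \<sigma>"]) auto
  qed
  have Z: "25 * y\<^sup>2 \<le> X"
  proof -
    define Z where "Z = 25600 * K\<^sup>2 * y ^ 3"
    have "1 * y\<^sup>2 \<le> K\<^sup>2 * y ^ 3" using K y1 by (intro mult_mono power_increasing one_le_power) auto
    then have Z: "25600 * y\<^sup>2 \<le> Z" unfolding Z_def by simp
    have "1 \<le> y\<^sup>2" using y1 by simp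
    then have "Z ^ 1 \<le> Z ^ 4" using Z by (intro power_increasing) linarith+
    then show ?thesis using Z \<open>1 \<le> y\<^sup>2\<close> unfolding X_def Z_def[symmetric] by simp
  qed
  have "2 * y \<le> 25 * y\<^sup>2"
  proof -
    have "y * 1 \<le> y * y" using y1 by (intro mult_left_mono) auto
    then show ?thesis using y1 by (simp add: power2_eq_square)
  qed
  then have "(2 * y) powr \<epsilon> \<le> P" unfolding P_def using Z y1 e by (intro powr_mono2) auto
  then have c1: "(\<Sum>x\<in>cusps. 1 / (of_int (snd x))\<^sup>2) \<le> h * P"
    using sum_cusps[OF e y1] h0 unfolding h_def[symmetric] by (smt (verit) mult_left_mono)
  have "(25 * y\<^sup>2) powr \<epsilon> \<le> P" unfolding P_def using Z e by (intro powr_mono2) auto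
  then have "2 * y * (D * (25 * y\<^sup>2) powr \<epsilon>) \<le> 2 * y * (D * P)" using D(1) y1 by (intro mult_left_mono) auto
  then have c2: "real (card cusps) \<le> 2 * y * (D * P)" using card_cusps[OF e y1 D] by linarith
  have P4: "X powr (4 * \<epsilon>) = P ^ 4"
  proof -
    have "0 < 25 * y\<^sup>2" using y1 by simp
    then have "X > 0" using Z by linarith
    then show ?thesis unfolding P_def by (subst powr_power) (simp_all add: mult.commute)
  qed
  have P1: "P \<le> P ^ 4"
  proof -
    have "1 \<le> y\<^sup>2" using y1 by simp
    then have "1 \<le> P" unfolding P_def using Z e by (intro ge_one_powr_ge_zero) linarith+
    then have "P ^ 1 \<le> P ^ 4" by (intro power_increasing) auto
    then show ?thesis by simp
  qed
  have "quotient_volume \<Gamma> (thin_part \<Gamma> R) \<le> emeasure hyp_volume (\<Union>x\<in>cusps. E x)"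
    unfolding quotient_volume_fd by (rule volume_le_cover[OF Es cov Union_thin_part_H3])
  also have "\<dots> \<le> (\<Sum>x\<in>cusps. emeasure hyp_volume (E x))"
    using finite_cusps Ex(1) by (intro emeasure_subadditive_finite) auto
  also have "\<dots> \<le> (\<Sum>x\<in>cusps. ennreal (y * K\<^sup>2 / 2 + 12800 * K\<^sup>2 * y\<^sup>2 * (Q * (1 / (of_int (snd x))\<^sup>2))))"
    by (intro sum_mono Ex(2))
  also have "\<dots> = ennreal (\<Sum>x\<in>cusps. y * K\<^sup>2 / 2 + 12800 * K\<^sup>2 * y\<^sup>2 * (Q * (1 / (of_int (snd x))\<^sup>2)))"
    using Q0 Im_w by (intro sum_ennreal) simp
  also have "(\<Sum>x\<in>cusps. y * K\<^sup>2 / 2 + 12800 * K\<^sup>2 * y\<^sup>2 * (Q * (1 / (of_int (snd x))\<^sup>2))) =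
      real (card cusps) * (y * K\<^sup>2 / 2) + 12800 * K\<^sup>2 * y\<^sup>2 * (Q * (\<Sum>x\<in>cusps. 1 / (of_int (snd x))\<^sup>2))"
    by (simp add: sum.distrib sum_distrib_left)
  also have "ennreal \<dots> \<le> ennreal (2 * y * (D * P ^ 4) * (y * K\<^sup>2 / 2) + 12800 * K\<^sup>2 * y\<^sup>2 * (Q * (h * P)))"
  proof (intro ennreal_leI add_mono mult_left_mono mult_right_mono c1)
    have "2 * y * (D * P) \<le> 2 * y * (D * P ^ 4)" using P1 D(1) Im_w by (intro mult_left_mono) auto
    then show "real (card cusps) \<le> 2 * y * (D * P ^ 4)" using c2 by linarith
  qed (use Q0 Im_w in auto)
  also have "2 * y * (D * P ^ 4) * (y * K\<^sup>2 / 2) + 12800 * K\<^sup>2 * y\<^sup>2 * (Q * (h * P)) =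
      (D * K\<^sup>2 + 12800 * K\<^sup>2 * (h * (h\<^sup>2 * ((16 * K + 1)\<^sup>2 * ((320 * K + 2) * (D + 2 * h)))))) * (y\<^sup>2 * P ^ 4)"
  proof -
    have "2 * y * (D * P ^ 4) * (y * K\<^sup>2 / 2) = D * K\<^sup>2 * (y\<^sup>2 * P ^ 4)" by (simp add: power2_eq_square)
    moreover have "12800 * K\<^sup>2 * y\<^sup>2 * (Q * (h * P)) = 12800 * K\<^sup>2 * (h * (h\<^sup>2 * ((16 * K + 1)\<^sup>2 * ((320 * K + 2) * (D + 2 * h))))) * (y\<^sup>2 * P ^ 4)"
      unfolding Q_def by (simp add: power_mult_distrib power4_eq_xxxx power2_eq_square[of P] mult_ac)
    ultimately show ?thesis by (simp only: distrib_right)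
  qed
  finally show ?thesis unfolding P4 .
qed

lemma volume_finite: "emeasure hyp_volume fd < \<infinity>"
proof -
  have "(\<Sum>x\<in>cusps. ennreal (3200 * y ^ 3 / (of_int (snd x))\<^sup>2)) < \<infinity>" using Im_w by (subst sum_ennreal) auto
  then show ?thesis using volume_upper_bound by (rule le_less_trans[rotated])
qed

text \<open>Here \<open>4 y\<^sup>2\<close> is 3 or 4, the Eisenstein and Gaussian cases with their
  additional units, which \<open>thin_cover\<close> excludes. The whole volume is bounded instead,
  by four pairs of 3200 each.\<close>

lemma volume_le_small:
  assumes y1: "y \<le> 1"
  shows "emeasure hyp_volume fd \<le> ennreal 12800"
proof -
  have sub: "cusps \<subseteq> {0..1} \<times> {1..2}"
  proof
    fix x assume x: "x \<in> cusps"
    obtain s a where sa: "x = (s, a)" by (cases x)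
    have b: "1 \<le> a" "0 \<le> s" "s < a" "of_int a \<le> 2 * y" using cusps_bounds x sa by auto
    then have "a \<le> 2" using y1 by linarith
    then show "x \<in> {0..1} \<times> {1..2}" using b sa by auto
  qed
  have "(\<Sum>x\<in>cusps. ennreal (3200 * y ^ 3 / (of_int (snd x))\<^sup>2)) \<le> (\<Sum>x\<in>cusps. ennreal 3200)"
  proof (intro sum_mono ennreal_leI)
    fix x assume x: "x \<in> cusps"
    then have "1 \<le> snd x" using sub by auto
    then have "1 \<le> (real_of_int (snd x))\<^sup>2" by simp
    moreover have "y ^ 3 \<le> 1" using y1 Im_w by (intro power_le_one) auto
    ultimately have "3200 * y ^ 3 / (of_int (snd x))\<^sup>2 \<le> 3200 / 1" using Im_w by (intro frac_le) auto
    then show "3200 * y ^ 3 / (of_int (snd x))\<^sup>2 \<le> 3200" by simp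
  qed
  also have "\<dots> = ennreal (real (card cusps) * 3200)" by (simp add: ennreal_of_nat_eq_real_of_nat ennreal_mult)
  also have "\<dots> \<le> ennreal 12800"
  proof (rule ennreal_leI)
    have "card cusps \<le> card ({0..1::int} \<times> {1..2::int})" using sub by (intro card_mono) auto
    then show "real (card cusps) * 3200 \<le> 12800" by (simp add: card_cartesian_product)
  qed
  finally show ?thesis using volume_upper_bound by (rule order_trans[rotated])
qed

end

theorem theoremC:
  "\<forall>R::real. \<forall>\<epsilon>::real. R > 0 \<and> \<epsilon> > 0 \<longrightarrow>
     (\<exists>C::real. C > 0 \<and>
       (\<forall>F. imaginary_quadratic_field F \<longrightarrow>
          (let \<Gamma> = SL2 (ring_of_integers F)
           in quotient_volume \<Gamma> (thin_part \<Gamma> R)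
                \<le> ennreal (C * enn2real (quotient_volume \<Gamma> (hyp_quotient \<Gamma>))
                                powr (1 - (1 / 3 - \<epsilon>))))))"
proof (intro allI impI)
  fix R \<epsilon> :: real assume "R > 0 \<and> \<epsilon> > 0"
  then have e: "\<epsilon> > 0" and e16: "\<epsilon> / 16 > 0" by auto
  \<comment> \<open>\<open>X\<close> is a constant times \<open>y ^ 12\<close> and enters to the
    power \<open>4 (\<epsilon> / 16)\<close>, which makes \<open>y\<close> to the power
    \<open>3 \<epsilon>\<close>.\<close>
  obtain D where D: "D \<ge> 1" "\<forall>n::nat>0. real (card {d. d dvd n}) \<le> D * real n powr (\<epsilon> / 16)"
    using divisor_bound[OF e16] by blast
  define K where "K = 2 * cosh (2 * R + 1)"
  define h where "h = 1 + 1 / (\<epsilon> / 16)"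
  define C0 where "C0 = D * K\<^sup>2 + 12800 * K\<^sup>2 * (h * (h\<^sup>2 * ((16 * K + 1)\<^sup>2 * ((320 * K + 2) * (D + 2 * h)))))"
  define C1 where "C1 = C0 * (9 * (25600 * K\<^sup>2) ^ 4) powr (\<epsilon> / 4)"
  \<comment> \<open>Three times the target exponent \<open>1 - (1 / 3 - \<epsilon>)\<close>, because
    \<open>V\<close> is at least of order \<open>y ^ 3\<close>.\<close>
  define q where "q = 2 + 3 * \<epsilon>"
  \<comment> \<open>The factor with 5/4 raises the power of \<open>y\<close> to at least 1 when
    \<open>y \<le> 1\<close>, by \<open>y \<ge> 4 / 5\<close>; the last factor undoes the constant
    of the lower bound for the volume.\<close>
  define C where "C = (C1 + 12800) * (5 / 4) powr q * 100000 powr (q / 3)"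
  have K: "K \<ge> 1" unfolding K_def using cosh_real_ge_1[of "2 * R + 1"] by linarith
  have h: "h \<ge> 0" using e by (simp add: h_def)
  have "C0 \<ge> 0" unfolding C0_def using K h D(1) by (intro add_nonneg_nonneg mult_nonneg_nonneg) auto
  then have C1: "C1 \<ge> 0" by (simp add: C1_def)
  then have C: "C > 0" by (simp add: C_def)
  have q: "q > 0" using e by (simp add: q_def)
  have main: "quotient_volume (SL2 (ring_of_integers F)) (thin_part (SL2 (ring_of_integers F)) R) \<le>
      ennreal (C * enn2real (quotient_volume (SL2 (ring_of_integers F)) (hyp_quotient (SL2 (ring_of_integers F)))) powr (1 - (1 / 3 - \<epsilon>)))"
    if F: "imaginary_quadratic_field F" for F
  proof -
    obtain w where w: "quad_ring w" and OF: "ring_of_integers F = quad_ints w"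
      using imaginary_quadratic_field_quad_ring[OF F] by blast
    interpret quad_ring w by (rule w)
    define V where "V = enn2real (emeasure hyp_volume fd)"
    have V: "emeasure hyp_volume fd = ennreal V" using volume_finite by (simp add: V_def)
    have yV: "y ^ 3 / 100000 \<le> V" using volume_lower_bound unfolding V by (simp add: V_def)
    have y0: "y > 0" by (rule Im_w)
    have yq: "(5 / 4) powr q * y powr q = (5 / 4 * y) powr q" by (rule powr_mult[symmetric])
    have C12: "quotient_volume \<Gamma> (thin_part \<Gamma> R) \<le> ennreal ((C1 + 12800) * ((5 / 4) powr q * y powr q))"
    proof (cases "y > 1")
      case True
      define X where "X = 9 * (25600 * K\<^sup>2 * y ^ 3) ^ 4"
      have "X = 9 * (25600 * K\<^sup>2) ^ 4 * y ^ 12" by (simp add: X_def power_mult_distrib power_mult[symmetric])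
      then have "X powr (4 * (\<epsilon> / 16)) = (9 * (25600 * K\<^sup>2) ^ 4) powr (\<epsilon> / 4) * (y ^ 12) powr (\<epsilon> / 4)"
        using y0 by (simp add: powr_mult)
      also have "(y ^ 12) powr (\<epsilon> / 4) = (y powr 12) powr (\<epsilon> / 4)" using y0 by simp
      also have "\<dots> = y powr (3 * \<epsilon>)" unfolding powr_powr by simp
      finally have X: "y\<^sup>2 * X powr (4 * (\<epsilon> / 16)) = (9 * (25600 * K\<^sup>2) ^ 4) powr (\<epsilon> / 4) * y powr q"
        unfolding q_def powr_add powr_numeral[OF less_imp_le[OF y0]] by (simp only: mult.left_commute)
      have "quotient_volume \<Gamma> (thin_part \<Gamma> R) \<le> ennreal (C0 * (y\<^sup>2 * X powr (4 * (\<epsilon> / 16))))"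
        using thin_volume_bound[OF e16 True, of D R] D unfolding X_def C0_def h_def K_def by simp
      also have "C0 * (y\<^sup>2 * X powr (4 * (\<epsilon> / 16))) = C1 * (1 * y powr q)" unfolding X C1_def mult_1 by (rule mult.assoc[symmetric])
      also have "ennreal \<dots> \<le> ennreal ((C1 + 12800) * ((5 / 4) powr q * y powr q))"
        using C1 q by (intro ennreal_leI mult_mono ge_one_powr_ge_zero) auto
      finally show ?thesis .
    next
      case False
      have "quotient_volume \<Gamma> (thin_part \<Gamma> R) \<le> emeasure hyp_volume fd"
        unfolding quotient_volume_fd by (intro emeasure_mono fd_sets) auto
      also have "\<dots> \<le> ennreal (12800 * 1)" using volume_le_small False by simp
      also have "\<dots> \<le> ennreal ((C1 + 12800) * ((5 / 4) powr q * y powr q))"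
        unfolding yq using C1 q y_ge by (intro ennreal_leI mult_mono ge_one_powr_ge_zero) auto
      finally show ?thesis .
    qed
    have "y powr q = (y powr 3) powr (q / 3)" unfolding powr_powr by simp
    also have "\<dots> = (100000 * (y ^ 3 / 100000)) powr (q / 3)" using y0 by simp
    also have "\<dots> = 100000 powr (q / 3) * (y ^ 3 / 100000) powr (q / 3)" by (rule powr_mult)
    also have "\<dots> \<le> 100000 powr (q / 3) * V powr (q / 3)"
      using yV y0 q by (intro mult_left_mono powr_mono2) auto
    finally have "(C1 + 12800) * ((5 / 4) powr q * y powr q) \<le> (C1 + 12800) * ((5 / 4) powr q * (100000 powr (q / 3) * V powr (q / 3)))"
      using C1 by (intro mult_left_mono) auto
    also have "\<dots> = C * V powr (q / 3)" by (simp add: C_def mult_ac)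
    also have "q / 3 = 1 - (1 / 3 - \<epsilon>)" by (simp add: q_def)
    finally have "ennreal ((C1 + 12800) * ((5 / 4) powr q * y powr q)) \<le> ennreal (C * V powr (1 - (1 / 3 - \<epsilon>)))"
      by (rule ennreal_leI)
    then have "quotient_volume \<Gamma> (thin_part \<Gamma> R) \<le> ennreal (C * V powr (1 - (1 / 3 - \<epsilon>)))"
      by (rule order_trans[OF C12])
    then show ?thesis unfolding V_def quotient_volume_total[symmetric] unfolding \<Gamma>_def OF .
  qed
  show "\<exists>C>0. \<forall>F. imaginary_quadratic_field F \<longrightarrow>
      (let \<Gamma> = SL2 (ring_of_integers F)
       in quotient_volume \<Gamma> (thin_part \<Gamma> R)
            \<le> ennreal (C * enn2real (quotient_volume \<Gamma> (hyp_quotient \<Gamma>)) powr (1 - (1 / 3 - \<epsilon>))))"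
    unfolding Let_def using C main by blast
qed

end
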